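(* Let $\mathcal{F}=(f_i)_{i\in\mathcal{A}}$ be a $C^{1+\theta}$ conformal IFS on $\mathbb{R}^n$ with attractor $\Lambda$, satisfying the Strong Separation Condition (the sets $f_i(\Lambda)$, $i\in\mathcal{A}$, are pairwise disjoint). Then the family of all ergodic measures on $\Lambda$ is relative dimension separable (with respect to the Euclidean metric), and hence for every $1\le d<n$, for almost every $V\in\mathrm{Gr}(d,n)$, $$\dim_H P_V\mu=\min\{d,\dim_H\mu\}\quad\text{simultaneously for all ergodic measures }\mu\text{ on }\Lambda,$$ i.e. the set of $V\in\mathrm{Gr}(d,n)$ for which the equality fails for at least one ergodic measure $\mu$ on $\Lambda$ has measure zero.
   Context: Conformal IFS: let $V_0\subset\mathbb{R}^n$ be a compact connected set with $V_0=\overline{\mathrm{Int}(V_0)}$. A map $f:V_0\to V_0$ is conformal $C^{1+\theta}$ if it extends to a diffeomorphism $f:W\to W$ of an open connected set $W\supset V_0$ such that for every $x\in V_0$ the differential $f'(x)=D_xf$ is a non-singular similitude and $V_0\ni x\mapsto D_xf$ is $\theta$-Hölder for some $\theta>0$. A conformal $C^{1+\theta}$ IFS is a collection $\mathcal{F}=(f_i)_{i\in\mathcal{A}}$ ($\mathcal{A}$ finite) of conformal $C^{1+\theta}$ maps $f_i:V_0\to V_0$ with $0<\|f_i'(x)\|<1$ (operator norm) for every $x\in V_0$. Let $\Sigma=\mathcal{A}^{\mathbb{N}}$ and let $\Pi_{\mathcal{F}}:\Sigma\to V_0$, $\Pi_{\mathcal{F}}(\omega)=\lim_{n\to\infty}f_{\omega_1}\circ\cdots\circ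 f_{\omega_n}(x)$ (any $x\in V_0$), be the natural projection. The attractor is $\Lambda=\Pi_{\mathcal{F}}(\Sigma)$. An ergodic measure on $\Lambda$ is a push-forward $\Pi_{\mathcal{F}}\mu$, where $\mu$ is an ergodic (left-)shift-invariant Borel probability measure on $\Sigma$. $\mathrm{Gr}(d,n)$ is the Grassmannian of $d$-dimensional linear subspaces of $\mathbb{R}^n$, with its unique orthogonally invariant Borel probability measure ("almost every" refers to it); $P_V$ is the orthogonal projection onto $V$ and $P_V\mu$ the push-forward measure. For a finite Borel measure $\mu$, with $\underline d(\mu,x)=\liminf_{r\to0}\frac{\log\mu(B(x,r))}{\log r}$, let $\underline{\dim}_H\mu=\operatorname{ess\,inf}_{x\sim\mu}\underline d(\mu,x)$, $\overline{\dim}_H\mu=\operatorname{ess\,sup}_{x\sim\mu}\underline d(\mu,x)$; if they coincide the common value is $\dim_H\mu$. For finite Borel measures $\mu,\nu$ on a metric space $(X,\rho)$, $\dim(\mu\|\nu,\rho)$ is the infimum of all $\varepsilon>0$ such that $$-\varepsilon<\operatorname*{ess\,inf}_{x\sim\mu}\liminf_{r\to0}\frac{\log\frac{\mu(B(x,r))}{\nu(B(x,r))}}{\log r}\le\operatorname*{ess\,sup}_{x\sim\mu}\limsup_{r\to0}\frac{\log\frac{\mu(B(x,r))}{\nu(B(x,r))}}{\log r}<\varepsilon,$$ with $\log\frac{\mu(B(x,r))}{0}=+\infty$ if $\mu(B(x,r))>0$. A collection $\mathcal{M}$ of finite Borel measures on $(X,\rho)$ is relative dimension separable if there is a countable set $\mathcal{V}$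 of finite Borel measures on $X$ such that for every $\mu\in\mathcal{M}$, $\varepsilon>0$ there is $\nu\in\mathcal{V}$ with $\dim(\mu\|\nu,\rho)<\varepsilon$. *)

theory Defs
  imports "HOL-Probability.Probability"
begin

section \<open>Conformal iterated function systems\<close>

definition C1_on :: "(real^'n) set \<Rightarrow> (real^'n \<Rightarrow> real^'n) \<Rightarrow> bool" where
  "C1_on W g \<longleftrightarrow> (\<exists>D :: real^'n \<Rightarrow> (real^'n) \<Rightarrow>\<^sub>L (real^'n).
     (\<forall>x\<in>W. (g has_derivative blinfun_apply (D x)) (at x)) \<and> continuous_on W D)"

definition C1_diffeomorphism_of :: "(real^'n) set \<Rightarrow> (real^'n \<Rightarrow> real^'n) \<Rightarrow> bool" where
  "C1_diffeomorphism_of W g \<longleftrightarrow>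
     bij_betw g W W \<and> C1_on W g \<and> C1_on W (inv_into W g)"

definition nonsingular_similitude :: "(real^'n) \<Rightarrow>\<^sub>L (real^'n) \<Rightarrow> bool" where
  "nonsingular_similitude L \<longleftrightarrow> (\<exists>c>0. \<forall>v. norm (blinfun_apply L v) = c * norm v)"

text \<open>\<open>D\<close> is the differential of \<open>f\<close> on \<open>V0\<close>. It does not depend on the extension \<open>g\<close> when \<open>V0\<close> is
  the closure of its interior.\<close>

definition conformal_map ::
  "real \<Rightarrow> (real^'n) set \<Rightarrow> (real^'n \<Rightarrow> real^'n) \<Rightarrow> (real^'n \<Rightarrow> (real^'n) \<Rightarrow>\<^sub>L (real^'n)) \<Rightarrow> bool"
where
  "conformal_map \<theta> V0 f D \<longleftrightarrow>
     \<theta> > 0 \<and> f \<in> V0 \<rightarrow> V0 \<and>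
     (\<exists>W g. open W \<and> connected W \<and> V0 \<subseteq> W \<and> C1_diffeomorphism_of W g \<and>
        (\<forall>x\<in>V0. g x = f x \<and> (g has_derivative blinfun_apply (D x)) (at x))) \<and>
     (\<forall>x\<in>V0. nonsingular_similitude (D x)) \<and>
     (\<exists>C. \<forall>x\<in>V0. \<forall>y\<in>V0. norm (D x - D y) \<le> C * dist x y powr \<theta>)"

definition conformal_IFS ::
  "real \<Rightarrow> (real^'n) set \<Rightarrow> 'i set \<Rightarrow> ('i \<Rightarrow> real^'n \<Rightarrow> real^'n) \<Rightarrow> bool"
where
  "conformal_IFS \<theta> V0 A f \<longleftrightarrow>
     V0 \<noteq> {} \<and> compact V0 \<and> connected V0 \<and> V0 = closure (interior V0) \<and> finite A \<and>
     (\<forall>i\<in>A. \<exists>D. conformal_map \<theta> V0 (f i) D \<and> (\<forall>x\<in>V0. 0 < norm (D x) \<and> norm (D x) < 1))"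

text \<open>Sequences are indexed from 0. For finite \<open>A\<close> this product sigma-algebra is the Borel
  sigma-algebra of the product of the discrete topologies.\<close>

definition code_space :: "'i set \<Rightarrow> (nat \<Rightarrow> 'i) measure" where
  "code_space A = (\<Pi>\<^sub>M k\<in>UNIV. count_space A)"

definition left_shift :: "(nat \<Rightarrow> 'i) \<Rightarrow> nat \<Rightarrow> 'i" where
  "left_shift \<omega> k = \<omega> (Suc k)"

primrec compose_along :: "('i \<Rightarrow> 'a \<Rightarrow> 'a) \<Rightarrow> (nat \<Rightarrow> 'i) \<Rightarrow> nat \<Rightarrow> 'a \<Rightarrow> 'a" where
  "compose_along f \<omega> 0 = id"
| "compose_along f \<omega> (Suc k) = compose_along f \<omega> k \<circ> f (\<omega> k)"

definition natural_projection ::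
  "(real^'n) set \<Rightarrow> ('i \<Rightarrow> real^'n \<Rightarrow> real^'n) \<Rightarrow> (nat \<Rightarrow> 'i) \<Rightarrow> real^'n"
where
  "natural_projection V0 f \<omega> = (THE y. \<forall>x\<in>V0. (\<lambda>k. compose_along f \<omega> k x) \<longlonglongrightarrow> y)"

definition attractor :: "(real^'n) set \<Rightarrow> 'i set \<Rightarrow> ('i \<Rightarrow> real^'n \<Rightarrow> real^'n) \<Rightarrow> (real^'n) set" where
  "attractor V0 A f = natural_projection V0 f ` space (code_space A)"

definition strong_separation ::
  "(real^'n) set \<Rightarrow> 'i set \<Rightarrow> ('i \<Rightarrow> real^'n \<Rightarrow> real^'n) \<Rightarrow> bool"
where
  "strong_separation V0 A f \<longleftrightarrow> disjoint_family_on (\<lambda>i. f i ` attractor V0 A f) A"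

definition ergodic_shift_measure :: "'i set \<Rightarrow> (nat \<Rightarrow> 'i) measure \<Rightarrow> bool" where
  "ergodic_shift_measure A \<mu> \<longleftrightarrow>
     prob_space \<mu> \<and> sets \<mu> = sets (code_space A) \<and>
     distr \<mu> \<mu> left_shift = \<mu> \<and>
     (\<forall>B\<in>sets \<mu>. left_shift -` B \<inter> space \<mu> = B \<longrightarrow> emeasure \<mu> B = 0 \<or> emeasure \<mu> B = 1)"

definition ergodic_measures ::
  "(real^'n) set \<Rightarrow> 'i set \<Rightarrow> ('i \<Rightarrow> real^'n \<Rightarrow> real^'n) \<Rightarrow> (real^'n) measure set"
where
  "ergodic_measures V0 A f =
     {distr \<mu> (restrict_space borel (attractor V0 A f)) (natural_projection V0 f) | \<mu>.
        ergodic_shift_measure A \<mu>}"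

section \<open>Dimensions of measures\<close>

definition elog :: "ereal \<Rightarrow> ereal" where
  "elog t = (if t = \<infinity> then \<infinity> else if t \<le> 0 then - \<infinity> else ereal (ln (real_of_ereal t)))"

text \<open>A measure \<open>\<mu>\<close> lives on the metric space \<open>(space \<mu>, dist)\<close>, so its balls are
  \<open>ball x r \<inter> space \<mu>\<close>. The library's \<open>esssup\<close> is, for measurable functions, the
  \<open>Limsup\<close> along \<open>ae_filter\<close> used below.\<close>

definition lower_local_dim :: "'a::metric_space measure \<Rightarrow> 'a \<Rightarrow> ereal" where
  "lower_local_dim \<mu> x =
     Liminf (at_right 0) (\<lambda>r. elog (ereal (measure \<mu> (ball x r \<inter> space \<mu>))) / ereal (ln r))"

definition lower_hdim :: "'a::metric_space measure \<Rightarrow> ereal" where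
  "lower_hdim \<mu> = Liminf (ae_filter \<mu>) (lower_local_dim \<mu>)"

definition upper_hdim :: "'a::metric_space measure \<Rightarrow> ereal" where
  "upper_hdim \<mu> = Limsup (ae_filter \<mu>) (lower_local_dim \<mu>)"

text \<open>\<open>dim\<^sub>H \<mu>\<close> is defined and equals \<open>s\<close>.\<close>

definition has_hdim :: "'a::metric_space measure \<Rightarrow> ereal \<Rightarrow> bool" where
  "has_hdim \<mu> s \<longleftrightarrow> lower_hdim \<mu> = s \<and> upper_hdim \<mu> = s"

text \<open>The quotient of the \<open>\<mu>\<close>- and \<open>\<nu>\<close>-measures of a ball, with value \<open>\<infinity>\<close> when the latter
  vanishes. (Balls centred at \<open>\<mu>\<close>-almost every point have positive \<open>\<mu>\<close>-measure.)\<close>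

definition ball_ratio :: "'a::metric_space measure \<Rightarrow> 'a measure \<Rightarrow> 'a \<Rightarrow> real \<Rightarrow> ereal" where
  "ball_ratio \<mu> \<nu> x r =
     (if measure \<nu> (ball x r \<inter> space \<nu>) = 0 then \<infinity>
      else ereal (measure \<mu> (ball x r \<inter> space \<mu>) / measure \<nu> (ball x r \<inter> space \<nu>)))"

definition lower_rel_dim :: "'a::metric_space measure \<Rightarrow> 'a measure \<Rightarrow> ereal" where
  "lower_rel_dim \<mu> \<nu> =
     Liminf (ae_filter \<mu>) (\<lambda>x. Liminf (at_right 0) (\<lambda>r. elog (ball_ratio \<mu> \<nu> x r) / ereal (ln r)))"

definition upper_rel_dim :: "'a::metric_space measure \<Rightarrow> 'a measure \<Rightarrow> ereal" where
  "upper_rel_dim \<mu> \<nu> =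
     Limsup (ae_filter \<mu>) (\<lambda>x. Limsup (at_right 0) (\<lambda>r. elog (ball_ratio \<mu> \<nu> x r) / ereal (ln r)))"

definition rel_dim :: "'a::metric_space measure \<Rightarrow> 'a measure \<Rightarrow> ereal" where
  "rel_dim \<mu> \<nu> = Inf {ereal \<epsilon> | \<epsilon>. \<epsilon> > 0 \<and>
     - ereal \<epsilon> < lower_rel_dim \<mu> \<nu> \<and> lower_rel_dim \<mu> \<nu> \<le> upper_rel_dim \<mu> \<nu> \<and>
     upper_rel_dim \<mu> \<nu> < ereal \<epsilon>}"

definition finite_borel_measure_on :: "'a::metric_space set \<Rightarrow> 'a measure \<Rightarrow> bool" where
  "finite_borel_measure_on X \<mu> \<longleftrightarrow> finite_measure \<mu> \<and> sets \<mu> = sets (restrict_space borel X)"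

definition relative_dimension_separable :: "'a::metric_space set \<Rightarrow> 'a measure set \<Rightarrow> bool" where
  "relative_dimension_separable X M \<longleftrightarrow>
     (\<forall>\<mu>\<in>M. finite_borel_measure_on X \<mu>) \<and>
     (\<exists>N. countable N \<and> (\<forall>\<nu>\<in>N. finite_borel_measure_on X \<nu>) \<and>
        (\<forall>\<mu>\<in>M. \<forall>\<epsilon>>0. \<exists>\<nu>\<in>N. rel_dim \<mu> \<nu> < ereal \<epsilon>))"

section \<open>The Grassmannian\<close>

definition orth_proj :: "(real^'n) set \<Rightarrow> real^'n \<Rightarrow> real^'n" where
  "orth_proj V x = (THE p. p \<in> V \<and> x - p \<in> orthogonal_comp V)"

definition Grassmannian :: "nat \<Rightarrow> (real^'n) set set" where
  "Grassmannian d = {V. subspace V \<and> dim V = d}"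

text \<open>The operator norm of the difference of the projections, a metric on \<open>Grassmannian d\<close>.\<close>

definition Grassmannian_dist :: "(real^'n) set \<Rightarrow> (real^'n) set \<Rightarrow> real" where
  "Grassmannian_dist V W = norm (Blinfun (orth_proj V) - Blinfun (orth_proj W))"

definition Grassmannian_borel :: "nat \<Rightarrow> (real^'n) set measure" where
  "Grassmannian_borel d = sigma (Grassmannian d)
     {U. openin (Metric_space.mtopology (Grassmannian d) Grassmannian_dist) U}"

text \<open>For each \<open>d \<le> CARD('n)\<close> exactly one measure has this property.\<close>

definition invariant_Grassmannian_measure :: "nat \<Rightarrow> (real^'n) set measure \<Rightarrow> bool" where
  "invariant_Grassmannian_measure d \<gamma> \<longleftrightarrow>
     prob_space \<gamma> \<and> sets \<gamma> = sets (Grassmannian_borel d) \<and>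
     (\<forall>T. orthogonal_transformation T \<longrightarrow> distr \<gamma> \<gamma> (\<lambda>V. T ` V) = \<gamma>)"

end

theory Submission
  imports Defs
begin

text \<open>One measure \<open>\<nu>\<close> separates all ergodic measures \<open>\<mu>\<close>: the law of a code sequence obtained by concatenating
  independent blocks from a random finite block code. By the Ornstein--Weiss parsing argument
  the typical words of \<open>\<mu>\<close> are cheaply encoded by such a code, so \<open>\<nu>\<close> gives cylinders around \<open>\<mu>\<close>-typical
  points their \<open>\<mu>\<close>-mass up to a subexponential factor. Strong separation and the bounded
  (subexponential) distortion of conformal maps turn cylinders into balls.

  The classical transversality estimate, integrated against \<open>\<nu> \<times> \<nu>\<close> restricted to points with
  \<open>\<nu>(B(x, r)) \<le> r\<^sup>t\<close>, holds for almost every \<open>V\<close> with all rational \<open>t\<close> at once. Since \<open>\<nu>\<close> and \<open>\<mu>\<close> have comparable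
  balls around \<open>\<mu>\<close>-typical points, a covering argument at every dyadic scale carries the estimate over to all \<open>\<mu>\<close>
  for each such \<open>V\<close>.\<close>

section \<open>The code space\<close>

text \<open>Distinct ergodic measures are mutually singular and in general there are uncountably
  many of them, so a projection theorem valid for each \<mu> off its own null set cannot be applied
  measure by measure: the exceptional null set has to be chosen from \<nu> alone. The measure \<nu>
  is purely atomic, so almost everywhere with respect to itself it has local dimension 0. This is
  why pairs are counted only from points whose \<nu>-balls are small down to the scale in question;
  such points occur near \<mu>-typical ones, where the balls of \<mu> and \<nu> are comparable.
  Every estimate may lose a factor \<open>2 powr (\<epsilon> * k)\<close> at the scale
  \<open>(1 / 2) ^ k\<close>. Such losses are invisible to dimension, and they pay for non-uniform
  distortion, for Borel--Cantelli arguments in place of density theorems, and for the letters that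
  the block code parses badly. No formula of the type entropy over Lyapunov exponent appears: the
  dimension of \<mu> is only known as the almost sure decay exponent of a quantity that is monotone
  along the shift.\<close>

lemma space_code_space: "space (code_space A) = {\<omega>. \<forall>k. \<omega> k \<in> A}"
  by (auto simp: code_space_def space_PiM PiE_def Pi_def extensional_def)

lemma measurable_coordinate: "(\<lambda>\<omega>. \<omega> k) \<in> measurable (code_space A) (count_space A)"
  unfolding code_space_def by (rule measurable_component_singleton) simp

lemma measurable_left_shift: "left_shift \<in> measurable (code_space A) (code_space A)"
  unfolding code_space_def
proof (rule measurable_PiM_single')
  show "(\<lambda>\<omega>. left_shift \<omega> k) \<in> measurable (PiM UNIV (\<lambda>k. count_space A)) (count_space A)" for k
    unfolding left_shift_def by (rule measurable_component_singleton) simp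
qed (auto simp: space_PiM left_shift_def)

lemma funpow_left_shift: "(left_shift ^^ n) \<omega> k = \<omega> (n + k)"
  by (induction n arbitrary: k) (auto simp: left_shift_def)

definition prefix_word :: "nat \<Rightarrow> (nat \<Rightarrow> 'i) \<Rightarrow> 'i list" where
  "prefix_word n \<omega> = map \<omega> [0..<n]"

definition cylinder :: "'i set \<Rightarrow> 'i list \<Rightarrow> (nat \<Rightarrow> 'i) set" where
  "cylinder A u = {\<omega> \<in> space (code_space A). prefix_word (length u) \<omega> = u}"

lemma length_prefix_word [simp]: "length (prefix_word n \<omega>) = n"
  by (simp add: prefix_word_def)

lemma prefix_word_eq_list: "prefix_word (length u) \<omega> = u \<longleftrightarrow> (\<forall>i\<in>{..<length u}. \<omega> i = u ! i)"
proof
  assume "prefix_word (length u) \<omega> = u"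
  then show "\<forall>i\<in>{..<length u}. \<omega> i = u ! i"
    unfolding prefix_word_def by (metis add_0 diff_zero lessThan_iff nth_map_upt)
next
  assume "\<forall>i\<in>{..<length u}. \<omega> i = u ! i"
  then show "prefix_word (length u) \<omega> = u"
    unfolding prefix_word_def by (auto intro: nth_equalityI)
qed

lemma prefix_word_eq_iff: "prefix_word n \<omega> = prefix_word n \<omega>' \<longleftrightarrow> (\<forall>i<n. \<omega> i = \<omega>' i)"
  by (auto simp: prefix_word_def)

lemma cylinder_prefix_word:
  "cylinder A (prefix_word n \<omega>) = {\<omega>' \<in> space (code_space A). \<forall>i<n. \<omega>' i = \<omega> i}"
  by (auto simp: cylinder_def prefix_word_eq_iff)

lemma sets_cylinder [measurable]:
  "cylinder A u \<in> sets (code_space A)"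
proof -
  have "cylinder A u = {\<omega> \<in> space (code_space A). \<forall>i\<in>{..<length u}. \<omega> i = u ! i}"
    by (simp add: cylinder_def prefix_word_eq_list)
  also have "\<dots> \<in> sets (code_space A)"
  proof (rule sets.sets_Collect_finite_All)
    show "{\<omega> \<in> space (code_space A). \<omega> i = u ! i} \<in> sets (code_space A)" for i
    proof -
      have "(\<lambda>\<omega>. \<omega> i) -` ({u ! i} \<inter> A) \<inter> space (code_space A) \<in> sets (code_space A)"
        by (rule measurable_sets[OF measurable_coordinate]) auto
      also have "(\<lambda>\<omega>. \<omega> i) -` ({u ! i} \<inter> A) \<inter> space (code_space A) =
          {\<omega> \<in> space (code_space A). \<omega> i = u ! i}"
        by (auto simp: space_code_space)
      finally show ?thesis .
    qed
  qed simp
  finally show ?thesis .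
qed

abbreviation words :: "'i set \<Rightarrow> nat \<Rightarrow> 'i list set" where
  "words A n \<equiv> {u. set u \<subseteq> A \<and> length u = n}"

lemma prefix_word_in_words: "\<omega> \<in> space (code_space A) \<Longrightarrow> prefix_word n \<omega> \<in> words A n"
  by (auto simp: prefix_word_def space_code_space)

lemma measurable_prefix_word:
  assumes "finite A"
  shows "prefix_word n \<in> measurable (code_space A) (count_space (words A n))"
proof (subst measurable_count_space_eq2)
  show "finite (words A n)" by (rule finite_lists_length_eq[OF assms])
  show "prefix_word n \<in> space (code_space A) \<rightarrow> words A n \<and>
    (\<forall>u\<in>words A n. prefix_word n -` {u} \<inter> space (code_space A) \<in> sets (code_space A))"
  proof (intro conjI ballI)
    show "prefix_word n \<in> space (code_space A) \<rightarrow> words A n"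
      using prefix_word_in_words by blast
    fix u assume "u \<in> words A n"
    then have "prefix_word n -` {u} \<inter> space (code_space A) = cylinder A u"
      by (auto simp: cylinder_def)
    then show "prefix_word n -` {u} \<inter> space (code_space A) \<in> sets (code_space A)" by simp
  qed
qed

lemma disjoint_cylinders: "disjoint_family_on (cylinder A) (words A n)"
  by (auto simp: disjoint_family_on_def cylinder_def)

section \<open>Ergodic shift measures\<close>

locale ergodic_code =
  fixes A :: "'i set" and \<mu> :: "(nat \<Rightarrow> 'i) measure"
  assumes ergodic: "ergodic_shift_measure A \<mu>" and finite_alphabet: "finite A"
begin

lemma prob_space: "prob_space \<mu>"
  using ergodic by (simp add: ergodic_shift_measure_def)

sublocale prob_space \<mu> by (rule prob_space)

lemma sets_eq [measurable_cong]: "sets \<mu> = sets (code_space A)"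
  using ergodic by (simp add: ergodic_shift_measure_def)

lemma space_eq: "space \<mu> = space (code_space A)"
  using sets_eq by (rule sets_eq_imp_space_eq)

lemma shift_measurable [measurable]: "left_shift \<in> measurable \<mu> \<mu>"
  using measurable_left_shift[of A] measurable_cong_sets[OF sets_eq sets_eq] by blast

lemma shift_in_space: "\<omega> \<in> space \<mu> \<Longrightarrow> left_shift \<omega> \<in> space \<mu>"
  by (rule measurable_space[OF shift_measurable])

lemma distr_shift: "distr \<mu> \<mu> left_shift = \<mu>"
  using ergodic by (simp add: ergodic_shift_measure_def)

lemma measure_shift_vimage:
  assumes "B \<in> sets \<mu>"
  shows "measure \<mu> (left_shift -` B \<inter> space \<mu>) = measure \<mu> B"
  using measure_distr[OF shift_measurable assms] distr_shift by simp

lemma alphabet_nonempty: "A \<noteq> {}"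
  using not_empty by (auto simp: space_eq space_code_space)

lemma sets_cylinder_\<mu> [measurable]: "cylinder A u \<in> sets \<mu>"
  using sets_cylinder sets_eq by blast

lemma borel_prefix_word:
  "(\<lambda>\<omega>. F (prefix_word n \<omega>)) \<in> borel_measurable \<mu>"
proof -
  have "prefix_word n \<in> measurable \<mu> (count_space (words A n))"
    using measurable_prefix_word[OF finite_alphabet] measurable_cong_sets[OF sets_eq refl] by blast
  then show ?thesis by (rule measurable_compose) simp
qed

text \<open>The iterated preimages of \<open>B\<close> decrease and all have the measure of
  \<open>B\<close>, so their intersection has it too; that intersection is strictly invariant, which
  is what the definition of ergodicity asks for.\<close>

lemma zero_one:
  assumes B: "B \<in> sets \<mu>" and sub: "left_shift -` B \<inter> space \<mu> \<subseteq> B"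
  shows "(AE \<omega> in \<mu>. \<omega> \<in> B) \<or> (AE \<omega> in \<mu>. \<omega> \<notin> B)"
proof -
  define C where "C n = (left_shift ^^ n) -` B \<inter> space \<mu>" for n
  have Cm [measurable]: "C n \<in> sets \<mu>" for n
    unfolding C_def by (rule measurable_sets[OF measurable_compose_n[OF shift_measurable] B])
  have Cspace: "(left_shift ^^ n) \<omega> \<in> space \<mu>" if "\<omega> \<in> space \<mu>" for n \<omega>
    using measurable_space[OF measurable_compose_n[OF shift_measurable] that] .
  have dec: "C (Suc n) \<subseteq> C n" for n
    using sub Cspace by (auto simp: C_def)
  have CS: "left_shift -` C n \<inter> space \<mu> = C (Suc n)" for n
    using shift_in_space by (auto simp: C_def funpow_swap1)
  have mC: "measure \<mu> (C n) = measure \<mu> B" for n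
  proof (induction n)
    case 0
    then show ?case using sets.sets_into_space[OF B] by (simp add: C_def Int_absorb2)
  next
    case (Suc n)
    then show ?case using measure_shift_vimage[OF Cm[of n]] CS by simp
  qed
  have lim: "(\<lambda>n. measure \<mu> (C n)) \<longlonglongrightarrow> measure \<mu> (\<Inter>n. C n)"
    by (rule finite_Lim_measure_decseq) (use dec in \<open>auto intro: decseq_SucI\<close>)
  then have meq: "measure \<mu> (\<Inter>n. C n) = measure \<mu> B"
    using LIMSEQ_unique by (auto simp: mC)
  have "left_shift -` (\<Inter>n. C n) \<inter> space \<mu> = (\<Inter>n. C (Suc n))"
    unfolding CS[symmetric] by auto
  also have "\<dots> = (\<Inter>n. C n)" using dec by blast
  finally have inv: "left_shift -` (\<Inter>n. C n) \<inter> space \<mu> = (\<Inter>n. C n)" .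
  have "(\<Inter>n. C n) \<in> sets \<mu>" by measurable
  then have "emeasure \<mu> (\<Inter>n. C n) = 0 \<or> emeasure \<mu> (\<Inter>n. C n) = 1"
    using ergodic inv unfolding ergodic_shift_measure_def by blast
  then have "measure \<mu> (\<Inter>n. C n) = 0 \<or> measure \<mu> (\<Inter>n. C n) = 1"
    by (metis enn2real_1 enn2real_0 measure_def)
  then have "measure \<mu> B = 0 \<or> measure \<mu> B = 1"
    unfolding meq .
  then show ?thesis using prob_eq_0[OF B] prob_eq_1[OF B] by blast
qed

text \<open>A function that does not decrease along the shift has an almost surely constant
  exponent of decay; this covers both the entropy and the local dimension of an ergodic measure.\<close>

lemma decay_exponent:
  fixes m :: "(nat \<Rightarrow> 'i) \<Rightarrow> nat \<Rightarrow> real"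
  assumes meas [measurable]: "\<And>k. (\<lambda>\<omega>. m \<omega> k) \<in> borel_measurable \<mu>"
    and le: "\<And>\<omega> k. \<omega> \<in> space \<mu> \<Longrightarrow> m \<omega> (k + c) \<le> m (left_shift \<omega>) k"
    and le1: "\<And>\<omega> k. m \<omega> k \<le> 1"
  obtains s :: ereal where "0 \<le> s"
    and "\<And>t::real. ereal t < s \<Longrightarrow> AE \<omega> in \<mu>. eventually (\<lambda>k. m \<omega> k \<le> 2 powr (- t * k)) sequentially"
    and "\<And>t::real. s < ereal t \<Longrightarrow> AE \<omega> in \<mu>. frequently (\<lambda>k. 2 powr (- t * k) < m \<omega> k) sequentially"
proof -
  \<comment> \<open>The slack \<open>1 / (real q + 1)\<close>, for all \<open>q\<close> at once,
    lets the condition pass from \<open>left_shift \<omega>\<close> to \<omega>: moving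
    \<open>k\<close> by \<open>c\<close> costs a bounded factor, which the step from
    \<open>q + 1\<close> to \<open>q\<close> absorbs.\<close>
  define D where "D t = {\<omega> \<in> space \<mu>. \<forall>q::nat.
    eventually (\<lambda>k. m \<omega> k \<le> 2 powr (- (t - 1 / (real q + 1)) * k)) sequentially}" for t :: real
  have Dm [measurable]: "D t \<in> sets \<mu>" for t
  proof -
    have "{\<omega> \<in> space \<mu>. m \<omega> k \<le> a} \<in> sets \<mu>" for k a
      using meas[of k] by (simp add: borel_measurable_iff_le)
    then show ?thesis
      unfolding D_def eventually_sequentially
      by (intro sets.sets_Collect_countable_All sets.sets_Collect_countable_Ex
          sets.sets_Collect_imp sets.sets_Collect_const)
  qed
  have "(AE \<omega> in \<mu>. \<omega> \<in> D t) \<or> (AE \<omega> in \<mu>. \<omega> \<notin> D t)" for t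
  proof (rule zero_one[OF Dm], safe)
    fix \<omega> assume w: "left_shift \<omega> \<in> D t" "\<omega> \<in> space \<mu>"
    have "eventually (\<lambda>k. m \<omega> k \<le> 2 powr (- (t - 1 / (real q + 1)) * k)) sequentially" for q :: nat
    proof -
      define \<eta> where "\<eta> = 1 / (real q + 1) - 1 / (real (Suc q) + 1)"
      have \<eta>: "\<eta> > 0" unfolding \<eta>_def by (simp add: frac_less2)
      have "eventually (\<lambda>k. m (left_shift \<omega>) k \<le> 2 powr (- (t - 1 / (real (Suc q) + 1)) * k)) sequentially"
        using w(1) unfolding D_def by blast
      moreover have "eventually (\<lambda>k. k > nat \<lceil>\<bar>t - 1 / (real q + 1)\<bar> * c / \<eta>\<rceil>) sequentially"
        by (rule eventually_gt_at_top)
      ultimately have "eventually (\<lambda>k. m \<omega> (k + c) \<le> 2 powr (- (t - 1 / (real q + 1)) * real (k + c))) sequentially"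
      proof eventually_elim
        case (elim k)
        have "real k > \<bar>t - 1 / (real q + 1)\<bar> * c / \<eta>"
          using elim(2) by linarith
        then have "\<bar>t - 1 / (real q + 1)\<bar> * c < \<eta> * k"
          unfolding pos_divide_less_eq[OF \<eta>] by (simp only: mult.commute)
        moreover have "(t - 1 / (real q + 1)) * c \<le> \<bar>t - 1 / (real q + 1)\<bar> * c"
          by (intro mult_right_mono) auto
        ultimately have "(t - 1 / (real q + 1)) * c \<le> \<eta> * k" by linarith
        then have "- (t - 1 / (real (Suc q) + 1)) * k \<le> - (t - 1 / (real q + 1)) * real (k + c)"
          unfolding \<eta>_def by (simp only: of_nat_add ring_distribs) (simp add: algebra_simps)
        then have "2 powr (- (t - 1 / (real (Suc q) + 1)) * k) \<le> 2 powr (- (t - 1 / (real q + 1)) * real (k + c))"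
          by simp
        then show ?case using le[OF w(2), of k] elim(1) by linarith
      qed
      then show ?thesis
        using eventually_sequentially_seg[of "\<lambda>k. m \<omega> k \<le> 2 powr (- (t - 1 / (real q + 1)) * real k)" c] by simp
    qed
    then show "\<omega> \<in> D t" using w(2) unfolding D_def by blast
  qed
  note D01 = this
  \<comment> \<open>Since \<open>m\<close> is at most 1, the exponent 0 is always admissible; the
    supremum below is therefore nonnegative, but it may be infinite.\<close>
  have D0: "\<omega> \<in> D 0" if "\<omega> \<in> space \<mu>" for \<omega>
  proof -
    have "m \<omega> k \<le> 2 powr (- (0 - 1 / (real q + 1)) * k)" for q k
    proof -
      have "(1::real) \<le> 2 powr (- (0 - 1 / (real q + 1)) * k)"
        by (rule ge_one_powr_ge_zero) auto
      then show ?thesis using le1[of \<omega> k] by linarith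
    qed
    then show ?thesis using that by (auto simp: D_def)
  qed
  define s where "s = Sup {ereal t | t. AE \<omega> in \<mu>. \<omega> \<in> D t}"
  show ?thesis
  proof (rule that[of s])
    have "AE \<omega> in \<mu>. \<omega> \<in> D 0" using D0 by (intro AE_I2) auto
    then show "0 \<le> s" unfolding s_def zero_ereal_def by (intro Sup_upper) auto
  next
    fix t assume "ereal t < s"
    then obtain t' where t': "AE \<omega> in \<mu>. \<omega> \<in> D t'" "t < t'"
      unfolding s_def less_Sup_iff by auto
    obtain q :: nat where q: "1 / (real q + 1) < t' - t"
      using reals_Archimedean[of "t' - t"] t'(2) by (auto simp: inverse_eq_divide add.commute)
    show "AE \<omega> in \<mu>. eventually (\<lambda>k. m \<omega> k \<le> 2 powr (- t * k)) sequentially"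
      using t'(1)
    proof eventually_elim
      case (elim \<omega>)
      then have "eventually (\<lambda>k. m \<omega> k \<le> 2 powr (- (t' - 1 / (real q + 1)) * k)) sequentially"
        unfolding D_def by blast
      then show ?case
      proof eventually_elim
        case (elim k)
        have "- (t' - 1 / (real q + 1)) * k \<le> - t * k"
          using q by (intro mult_right_mono) auto
        then have "2 powr (- (t' - 1 / (real q + 1)) * k) \<le> 2 powr (- t * k)" by simp
        then show ?case using elim by linarith
      qed
    qed
  next
    fix t assume st: "s < ereal t"
    have "\<not> (AE \<omega> in \<mu>. \<omega> \<in> D t)"
    proof
      assume "AE \<omega> in \<mu>. \<omega> \<in> D t"
      then have "ereal t \<le> s" unfolding s_def by (intro Sup_upper) auto
      then show False using st by simp
    qed
    then have "AE \<omega> in \<mu>. \<omega> \<notin> D t" using D01 by blast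
    then show "AE \<omega> in \<mu>. frequently (\<lambda>k. 2 powr (- t * k) < m \<omega> k) sequentially"
      using AE_space
    proof eventually_elim
      case (elim \<omega>)
      then obtain q :: nat where
        "\<not> eventually (\<lambda>k. m \<omega> k \<le> 2 powr (- (t - 1 / (real q + 1)) * k)) sequentially"
        unfolding D_def by blast
      then have "frequently (\<lambda>k. 2 powr (- (t - 1 / (real q + 1)) * k) < m \<omega> k) sequentially"
        by (simp add: not_eventually not_le)
      then show ?case
      proof (rule frequently_elim1)
        fix k :: nat
        assume *: "2 powr (- (t - 1 / (real q + 1)) * k) < m \<omega> k"
        have "- t * k \<le> - (t - 1 / (real q + 1)) * k"
          by (intro mult_right_mono) auto
        then have "2 powr (- t * k) \<le> 2 powr (- (t - 1 / (real q + 1)) * k)" by simp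
        then show "2 powr (- t * k) < m \<omega> k" using * by linarith
      qed
    qed
  qed
qed

end

section \<open>Visit frequencies and comparison of cylinder masses\<close>

context ergodic_code
begin

text \<open>Garsia's proof of the maximal ergodic inequality: \<open>F N\<close> is the maximum of \<open>0\<close> and the first
  \<open>N\<close> Birkhoff sums of \<open>indicator B - \<delta>\<close>, and \<open>F N - F N \<circ> left_shift\<close> has integral \<open>0\<close>.\<close>

lemma maximal_inequality:
  assumes B [measurable]: "B \<in> sets \<mu>" and \<delta>: "0 \<le> \<delta>"
    and large: "AE \<omega> in \<mu>. \<exists>n>0. \<delta> * n < (\<Sum>j<n. indicator B ((left_shift ^^ j) \<omega>))"
  shows "\<delta> \<le> measure \<mu> B"
proof -
  define f where "f \<omega> = indicator B \<omega> - \<delta>" for \<omega>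
  define F where "F = rec_nat (\<lambda>\<omega>. 0) (\<lambda>n g \<omega>. max 0 (f \<omega> + g (left_shift \<omega>)))"
  have F0: "F 0 = (\<lambda>\<omega>. 0)" and FS: "F (Suc n) = (\<lambda>\<omega>. max 0 (f \<omega> + F n (left_shift \<omega>)))" for n
    by (simp_all add: F_def)
  have fm [measurable]: "f \<in> borel_measurable \<mu>"
    unfolding f_def by measurable
  have Fm [measurable]: "F n \<in> borel_measurable \<mu>" for n
    by (induction n) (simp_all add: F0 FS)
  have F_nonneg: "0 \<le> F n \<omega>" for n \<omega>
    by (cases n) (simp_all add: F0 FS)
  have F_le: "F n \<omega> \<le> n" for n \<omega>
  proof (induction n arbitrary: \<omega>)
    case (Suc n)
    have "f \<omega> \<le> 1" using \<delta> by (auto simp: f_def indicator_def)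
    then show ?case using Suc[of "left_shift \<omega>"] by (simp add: FS)
  qed (simp add: F0)
  have F_mono: "F n \<omega> \<le> F (Suc n) \<omega>" for n \<omega>
  proof (induction n arbitrary: \<omega>)
    case (Suc n)
    have "f \<omega> + F n (left_shift \<omega>) \<le> f \<omega> + F (Suc n) (left_shift \<omega>)" using Suc by simp
    then show ?case by (subst (1 2) FS) (rule max.mono[OF order_refl])
  qed (simp add: F0 FS)
  have F_ge: "(\<Sum>j<n. f ((left_shift ^^ j) \<omega>)) \<le> F n \<omega>" for n \<omega>
  proof (induction n arbitrary: \<omega>)
    case (Suc n)
    have "(\<Sum>j<Suc n. f ((left_shift ^^ j) \<omega>)) = f \<omega> + (\<Sum>j<n. f ((left_shift ^^ j) (left_shift \<omega>)))"
      by (subst sum.lessThan_Suc_shift) (simp add: funpow_swap1)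
    then show ?case using Suc[of "left_shift \<omega>"] by (simp add: FS)
  qed (simp add: F0)
  have Fint: "integrable \<mu> (F n)" for n
    by (rule integrable_const_bound[of _ "real n"]) (use F_nonneg F_le in auto)
  have Fint': "integrable \<mu> (\<lambda>\<omega>. F n (left_shift \<omega>))" for n
    by (rule integrable_const_bound[of _ "real n"]) (use F_nonneg F_le in auto)
  have Feq: "(\<integral>\<omega>. F n (left_shift \<omega>) \<partial>\<mu>) = (\<integral>\<omega>. F n \<omega> \<partial>\<mu>)" for n
    using integral_distr[OF shift_measurable, of "F n"] distr_shift by simp
  define P where "P n = {\<omega> \<in> space \<mu>. 0 < F n \<omega>}" for n
  have Pm [measurable]: "P n \<in> sets \<mu>" for n
    unfolding P_def by measurable
  have ineq: "\<delta> * measure \<mu> (P n) \<le> measure \<mu> B" for n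
  proof -
    have int1: "integrable \<mu> (\<lambda>\<omega>. indicator B \<omega> - \<delta> * indicator (P n) \<omega> :: real)"
      by (intro Bochner_Integration.integrable_diff integrable_mult_right) (auto simp: emeasure_eq_measure)
    have "0 = (\<integral>\<omega>. F n \<omega> - F n (left_shift \<omega>) \<partial>\<mu>)"
      using Fint Fint' Feq by simp
    also have "\<dots> \<le> (\<integral>\<omega>. indicator B \<omega> - \<delta> * indicator (P n) \<omega> \<partial>\<mu>)"
    proof (rule integral_mono)
      fix \<omega> assume w: "\<omega> \<in> space \<mu>"
      \<comment> \<open>Where \<open>F n\<close> is positive it equals a sum that starts with
        \<open>f\<close>, so the difference is at most \<open>f\<close>; elsewhere
        \<open>F n\<close> vanishes and the difference is not positive.\<close>
      show "F n \<omega> - F n (left_shift \<omega>) \<le> indicator B \<omega> - \<delta> * indicator (P n) \<omega>"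
      proof (cases "\<omega> \<in> P n")
        case True
        then obtain k where k: "n = Suc k" by (cases n) (auto simp: P_def F0)
        have "F n \<omega> = f \<omega> + F k (left_shift \<omega>)"
          using True unfolding P_def k FS by auto
        also have "\<dots> \<le> f \<omega> + F n (left_shift \<omega>)" using F_mono k by simp
        finally show ?thesis using True by (simp add: f_def)
      next
        case False
        then have "F n \<omega> = 0" using w F_nonneg[of n \<omega>] by (auto simp: P_def)
        then show ?thesis using False F_nonneg[of n "left_shift \<omega>"] by (simp add: indicator_def)
      qed
    qed (use Fint Fint' int1 in auto)
    also have "\<dots> = measure \<mu> B - \<delta> * measure \<mu> (P n)"
      by (subst Bochner_Integration.integral_diff) (auto simp: emeasure_eq_measure)
    finally show ?thesis by simp
  qed
  have "incseq P"
    by (rule incseq_SucI) (use F_mono in \<open>auto simp: P_def intro: less_le_trans\<close>)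
  then have "(\<lambda>n. measure \<mu> (P n)) \<longlonglongrightarrow> measure \<mu> (\<Union>n. P n)"
    by (intro finite_Lim_measure_incseq) auto
  moreover have "measure \<mu> (\<Union>n. P n) = 1"
  proof (subst prob_eq_1)
    show "AE \<omega> in \<mu>. \<omega> \<in> (\<Union>n. P n)"
      using large AE_space
    proof eventually_elim
      case (elim \<omega>)
      then obtain n where "0 < n" "\<delta> * n < (\<Sum>j<n. indicator B ((left_shift ^^ j) \<omega>))" by blast
      then have "0 < (\<Sum>j<n. f ((left_shift ^^ j) \<omega>))"
        by (simp add: f_def sum_subtractf mult.commute)
      then have "0 < F n \<omega>" using F_ge by (rule less_le_trans)
      then show ?case using elim(2) by (auto simp: P_def)
    qed
  qed measurable
  ultimately have "(\<lambda>n. \<delta> * measure \<mu> (P n)) \<longlonglongrightarrow> \<delta> * 1"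
    by (intro tendsto_mult tendsto_const) simp
  then have "\<delta> * 1 \<le> measure \<mu> B"
    by (rule LIMSEQ_le_const2) (use ineq in auto)
  then show ?thesis by simp
qed

text \<open>One half of Birkhoff's theorem for an indicator. If the visits exceeded a density
  \<open>\<delta>\<^sub>0\<close> above \<open>measure \<mu> B\<close> infinitely often on a
  non-null set, they would do so almost everywhere by \<open>zero_one\<close>, and
  \<open>maximal_inequality\<close> would give
  \<open>\<delta>\<^sub>0 \<le> measure \<mu> B\<close>.\<close>

lemma eventually_visits_le:
  assumes B: "B \<in> sets \<mu>" and less: "measure \<mu> B < \<delta>"
  shows "AE \<omega> in \<mu>. eventually (\<lambda>n. (\<Sum>j<n. indicator B ((left_shift ^^ j) \<omega>)) \<le> \<delta> * n) sequentially"
proof -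
  define S :: "nat \<Rightarrow> (nat \<Rightarrow> 'i) \<Rightarrow> real"
    where "S n \<omega> = (\<Sum>j<n. indicator B ((left_shift ^^ j) \<omega>))" for n \<omega>
  obtain \<delta>\<^sub>0 where d0: "measure \<mu> B < \<delta>\<^sub>0" "\<delta>\<^sub>0 < \<delta>" using less dense by blast
  have S_Suc: "S (Suc n) \<omega> = indicator B \<omega> + S n (left_shift \<omega>)" for n \<omega>
    unfolding S_def by (subst sum.lessThan_Suc_shift) (simp add: funpow_swap1)
  have Sm: "S n \<in> borel_measurable \<mu>" for n
  proof -
    have "(left_shift ^^ j) \<in> measurable \<mu> \<mu>" for j
      by (rule measurable_compose_n[OF shift_measurable])
    then have "(\<lambda>\<omega>. indicator B ((left_shift ^^ j) \<omega>) :: real) \<in> borel_measurable \<mu>" for j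
      by (rule measurable_compose) (use B in simp)
    then show ?thesis unfolding S_def by (intro borel_measurable_sum)
  qed
  \<comment> \<open>A strict excess over \<open>\<delta>\<^sub>0\<close>, measured by some
    \<open>q\<close>, survives prepending one letter at the price of replacing \<open>q\<close> by
    \<open>q + 1\<close>; so \<open>X\<close> contains its preimage under the shift.\<close>
  define X where "X = {\<omega> \<in> space \<mu>. \<exists>q::nat. \<forall>N. \<exists>n\<ge>N. (\<delta>\<^sub>0 + 1 / (real q + 1)) * n \<le> S n \<omega>}"
  have Xm: "X \<in> sets \<mu>"
  proof -
    have "{\<omega> \<in> space \<mu>. a \<le> S n \<omega>} \<in> sets \<mu>" for n a
      using Sm[of n] by (simp add: borel_measurable_iff_ge)
    then show ?thesis
      unfolding X_def Bex_def
      by (intro sets.sets_Collect_countable_All sets.sets_Collect_countable_Ex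
          sets.sets_Collect_conj sets.sets_Collect_const)
  qed
  have "(AE \<omega> in \<mu>. \<omega> \<in> X) \<or> (AE \<omega> in \<mu>. \<omega> \<notin> X)"
  proof (rule zero_one[OF Xm], safe)
    fix \<omega> assume w: "left_shift \<omega> \<in> X" "\<omega> \<in> space \<mu>"
    then obtain q :: nat where q: "\<And>N. \<exists>n\<ge>N. (\<delta>\<^sub>0 + 1 / (real q + 1)) * n \<le> S n (left_shift \<omega>)"
      by (auto simp: X_def)
    define \<eta> where "\<eta> = 1 / (real q + 1) - 1 / (real (Suc q) + 1)"
    have \<eta>: "\<eta> > 0" unfolding \<eta>_def by (simp add: frac_less2)
    have "\<exists>n\<ge>N. (\<delta>\<^sub>0 + 1 / (real (Suc q) + 1)) * n \<le> S n \<omega>" for N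
    proof -
      obtain n where n: "n \<ge> max N (nat \<lceil>(\<delta>\<^sub>0 + 1 / (real (Suc q) + 1)) / \<eta>\<rceil>)"
        "(\<delta>\<^sub>0 + 1 / (real q + 1)) * n \<le> S n (left_shift \<omega>)" using q by blast
      have "(\<delta>\<^sub>0 + 1 / (real (Suc q) + 1)) / \<eta> \<le> n" using n(1) by linarith
      then have "\<delta>\<^sub>0 + 1 / (real (Suc q) + 1) \<le> n * \<eta>" unfolding pos_divide_le_eq[OF \<eta>] .
      then have "(\<delta>\<^sub>0 + 1 / (real (Suc q) + 1)) * Suc n \<le> (\<delta>\<^sub>0 + 1 / (real q + 1)) * n"
        unfolding \<eta>_def by (simp only: of_nat_Suc ring_distribs) (simp add: algebra_simps)
      also have "\<dots> \<le> S (Suc n) \<omega>" using n(2) by (simp add: S_Suc indicator_def)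
      finally show ?thesis using n(1) by (intro exI[of _ "Suc n"]) auto
    qed
    then show "\<omega> \<in> X" using w(2) unfolding X_def by blast
  qed
  moreover have "\<not> (AE \<omega> in \<mu>. \<omega> \<in> X)"
  proof
    assume "AE \<omega> in \<mu>. \<omega> \<in> X"
    then have "AE \<omega> in \<mu>. \<exists>n>0. \<delta>\<^sub>0 * n < (\<Sum>j<n. indicator B ((left_shift ^^ j) \<omega>))"
    proof eventually_elim
      case (elim \<omega>)
      then obtain q n where n: "n \<ge> (1::nat)" "(\<delta>\<^sub>0 + 1 / (real q + 1)) * n \<le> S n \<omega>"
        unfolding X_def by blast
      have "\<delta>\<^sub>0 * n < (\<delta>\<^sub>0 + 1 / (real q + 1)) * n"
        using n(1) by (intro mult_strict_right_mono) auto
      then have "\<delta>\<^sub>0 * n < S n \<omega>" using n(2) by (rule less_le_trans)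
      then show ?case using n(1) unfolding S_def by (intro exI[of _ n]) auto
    qed
    then have "\<delta>\<^sub>0 \<le> measure \<mu> B"
      using order_trans[OF measure_nonneg less_imp_le[OF d0(1)]] by (intro maximal_inequality[OF B])
    then show False using d0 by simp
  qed
  ultimately have "AE \<omega> in \<mu>. \<omega> \<notin> X" by blast
  then show ?thesis using AE_space
  proof eventually_elim
    case (elim \<omega>)
    obtain q :: nat where q: "1 / (real q + 1) < \<delta> - \<delta>\<^sub>0"
      using reals_Archimedean[of "\<delta> - \<delta>\<^sub>0"] d0 by (auto simp: inverse_eq_divide add.commute)
    obtain N where N: "\<And>n. n \<ge> N \<Longrightarrow> S n \<omega> < (\<delta>\<^sub>0 + 1 / (real q + 1)) * n"
      using elim unfolding X_def by (simp add: not_le) (metis leD)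
    have "S n \<omega> \<le> \<delta> * n" if "n \<ge> N" for n
    proof -
      have "(\<delta>\<^sub>0 + 1 / (real q + 1)) * n \<le> \<delta> * n" using q by (intro mult_right_mono) auto
      then show ?thesis using N[OF that] by linarith
    qed
    then show ?case unfolding S_def eventually_sequentially by blast
  qed
qed

text \<open>The words at which \<open>N\<close> is too heavy have disjoint cylinders, whose
  \<mu>-masses sum to at most \<open>2 powr (- \<epsilon> * n)\<close> times the total mass of
  \<open>N\<close>. This is summable in \<open>n\<close>, and Borel--Cantelli applies.\<close>

lemma finite_measure_cylinder_le:
  assumes N: "finite_measure N" "sets N = sets (code_space A)" and \<epsilon>: "0 < (\<epsilon>::real)"
  shows "AE \<omega> in \<mu>. eventually (\<lambda>n. measure N (cylinder A (prefix_word n \<omega>)) \<le>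
    2 powr (\<epsilon> * n) * measure \<mu> (cylinder A (prefix_word n \<omega>))) sequentially"
proof -
  interpret N: finite_measure N by fact
  define W where "W n = {u \<in> words A n. 2 powr (\<epsilon> * n) * measure \<mu> (cylinder A u) < measure N (cylinder A u)}" for n :: nat
  define B where "B n = (\<Union>u\<in>W n. cylinder A u)" for n
  have finW: "finite (W n)" for n
  proof (rule finite_subset)
    show "W n \<subseteq> words A n" by (auto simp: W_def)
    show "finite (words A n)" by (rule finite_lists_length_eq[OF finite_alphabet])
  qed
  have Bm: "B n \<in> sets \<mu>" for n
    unfolding B_def using finW by (intro sets.finite_UN) auto
  have disj: "disjoint_family_on (cylinder A) (W n)" for n
    by (rule disjoint_family_on_mono[OF _ disjoint_cylinders[of A n]]) (auto simp: W_def)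
  have Bn: "measure \<mu> (B n) \<le> measure N (space N) * (2 powr (- \<epsilon>)) ^ n" for n
  proof -
    have "measure \<mu> (B n) = (\<Sum>u\<in>W n. measure \<mu> (cylinder A u))"
      unfolding B_def by (rule finite_measure_finite_Union[OF finW _ disj]) auto
    also have "\<dots> \<le> (\<Sum>u\<in>W n. (2 powr (- \<epsilon>)) ^ n * measure N (cylinder A u))"
    proof (rule sum_mono)
      fix u assume "u \<in> W n"
      then have "2 powr (- (\<epsilon> * n)) * (2 powr (\<epsilon> * n) * measure \<mu> (cylinder A u)) \<le> 2 powr (- (\<epsilon> * n)) * measure N (cylinder A u)"
        by (intro mult_left_mono) (auto simp: W_def)
      then show "measure \<mu> (cylinder A u) \<le> (2 powr (- \<epsilon>)) ^ n * measure N (cylinder A u)"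
        by (simp add: powr_add[symmetric] mult.assoc[symmetric] powr_realpow[symmetric] powr_powr)
    qed
    also have "\<dots> = (2 powr (- \<epsilon>)) ^ n * (\<Sum>u\<in>W n. measure N (cylinder A u))"
      by (simp add: sum_distrib_left)
    also have "(\<Sum>u\<in>W n. measure N (cylinder A u)) = measure N (B n)"
      unfolding B_def by (rule N.finite_measure_finite_Union[OF finW _ disj, symmetric]) (auto simp: N(2))
    also have "(2 powr (- \<epsilon>)) ^ n * measure N (B n) \<le> (2 powr (- \<epsilon>)) ^ n * measure N (space N)"
      by (intro mult_left_mono N.bounded_measure) auto
    finally show ?thesis by (simp add: mult.commute)
  qed
  have "AE \<omega> in \<mu>. eventually (\<lambda>n. \<omega> \<in> space \<mu> - B n) sequentially"
  proof (rule borel_cantelli_AE1)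
    have "summable (\<lambda>n. measure N (space N) * (2 powr (- \<epsilon>)) ^ n)"
      using \<epsilon> by (intro summable_mult summable_geometric) (auto simp: powr_minus inverse_less_1_iff)
    then show "summable (\<lambda>n. measure \<mu> (B n))"
      by (rule summable_comparison_test') (use Bn in auto)
  qed (use Bm in \<open>auto simp: emeasure_eq_measure\<close>)
  then show ?thesis
  proof eventually_elim
    case (elim \<omega>)
    then show ?case
    proof eventually_elim
      case (elim n)
      then have "prefix_word n \<omega> \<notin> W n"
        by (auto simp: B_def cylinder_def space_eq)
      then show ?case using prefix_word_in_words[of \<omega> A n] elim by (auto simp: W_def space_eq)
    qed
  qed
qed

end

section \<open>A universal measure\<close>

text \<open>A random word is a geometric number of independent blocks drawn from the uniform
  distribution on a multiset; the multiset and the parameter of the geometric distribution are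
  themselves random. Every block code is thus dominated up to a constant factor.\<close>

definition universal_pmf :: "nat list pmf" where
  "universal_pmf =
     bind_pmf (map_pmf from_nat (geometric_pmf (1 / 2))) (\<lambda>(us :: nat list list, N :: nat).
       bind_pmf (geometric_pmf (1 / (real N + 2))) (\<lambda>b.
         map_pmf concat (replicate_pmf b (pmf_of_multiset (mset us)))))"

text \<open>Letters are numbered by naturals so that one distribution on words serves every
  alphabet; the random word is padded by the letter with number 0. For a nonempty alphabet the
  result is carried by countably many eventually constant sequences, which is harmless because only
  masses of cylinders and balls are compared.\<close>

definition universal_measure :: "'i set \<Rightarrow> (nat \<Rightarrow> 'i) measure" where
  "universal_measure A = distr (measure_pmf universal_pmf) (code_space A)
     (\<lambda>w k. from_nat_into A (if k < length w then w ! k else 0))"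

section \<open>Lower bounds for the universal measure\<close>

lemma pmf_bind_ge: "pmf M x * pmf (f x) y \<le> pmf (bind_pmf M f) y"
proof -
  have "pmf M x * pmf (f x) y = (\<integral>z. pmf (f x) y * indicator {x} z \<partial>measure_pmf M)"
    by (simp add: measure_pmf_single)
  also have "\<dots> \<le> (\<integral>z. pmf (f z) y \<partial>measure_pmf M)"
    by (intro integral_mono measure_pmf.integrable_const_bound[of _ 1])
      (auto simp: pmf_le_1 indicator_def)
  finally show ?thesis by (simp add: pmf_bind)
qed

lemma pmf_map_ge: "pmf M x \<le> pmf (map_pmf f M) (f x)"
  using pmf_bind_ge[of M x "\<lambda>z. return_pmf (f z)" "f x"] by (simp add: map_pmf_def)

lemma pmf_replicate_ge: "prod_list (map (pmf p) xs) \<le> pmf (replicate_pmf (length xs) p) xs"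
proof (induction xs)
  case (Cons x xs)
  have "pmf p x * prod_list (map (pmf p) xs) \<le> pmf p x * pmf (replicate_pmf (length xs) p) xs"
    by (intro mult_left_mono Cons.IH) simp
  also have "pmf (replicate_pmf (length xs) p) xs \<le>
      pmf (bind_pmf (replicate_pmf (length xs) p) (\<lambda>ys. return_pmf (x # ys))) (x # xs)"
    using pmf_bind_ge[of "replicate_pmf (length xs) p" xs "\<lambda>ys. return_pmf (x # ys)" "x # xs"] by simp
  then have "pmf p x * pmf (replicate_pmf (length xs) p) xs \<le> pmf p x * \<dots>"
    by (rule mult_left_mono) simp
  also have "\<dots> \<le> pmf (replicate_pmf (length (x # xs)) p) (x # xs)"
    using pmf_bind_ge[of p x "\<lambda>z. bind_pmf (replicate_pmf (length xs) p) (\<lambda>ys. return_pmf (z # ys))" "x # xs"]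
    by simp
  finally show ?case by simp
qed simp

text \<open>Fixing the outcome \<open>(us, N)\<close> costs only the constant, since
  \<open>from_nat\<close> reaches every pair and geometric weights are positive. Asking for exactly
  \<open>length vs\<close> blocks costs the geometric weight, whose rate per block is close to 1
  when \<open>N\<close> is large.\<close>

lemma pmf_universal_ge:
  "\<exists>C>0. \<forall>vs. C * (1 - 1 / (real N + 2)) ^ length vs * prod_list (map (pmf (pmf_of_multiset (mset us))) vs)
    \<le> pmf universal_pmf (concat vs)"
proof (intro exI conjI allI)
  define p where "p = pmf (map_pmf from_nat (geometric_pmf (1 / 2))) (us, N)"
  let ?\<eta> = "1 / (real N + 2)"
  have "0 < pmf (geometric_pmf (1 / 2)) (to_nat (us, N))"
    by simp
  also have "\<dots> \<le> p"
    using pmf_map_ge[of "geometric_pmf (1 / 2)" "to_nat (us, N)" "from_nat :: nat \<Rightarrow> nat list list \<times> nat"]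
    unfolding p_def from_nat_to_nat .
  finally have p: "0 < p" .
  then show "0 < p * ?\<eta>" by simp
  fix vs :: "nat list list"
  let ?g = "\<lambda>b. map_pmf concat (replicate_pmf b (pmf_of_multiset (mset us)))"
  let ?P = "prod_list (map (pmf (pmf_of_multiset (mset us))) vs)"
  have \<eta>: "0 < ?\<eta>" "?\<eta> \<le> 1" by auto
  have "?P \<le> pmf (replicate_pmf (length vs) (pmf_of_multiset (mset us))) vs"
    by (rule pmf_replicate_ge)
  also have "\<dots> \<le> pmf (?g (length vs)) (concat vs)" by (rule pmf_map_ge)
  finally have 1: "?P \<le> pmf (?g (length vs)) (concat vs)" .
  have "p * ?\<eta> * (1 - ?\<eta>) ^ length vs * ?P = p * (pmf (geometric_pmf ?\<eta>) (length vs) * ?P)"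
    using \<eta> by (subst pmf_geometric) auto
  also have "\<dots> \<le> p * (pmf (geometric_pmf ?\<eta>) (length vs) * pmf (?g (length vs)) (concat vs))"
    using p 1 by (intro mult_left_mono) auto
  also have "\<dots> \<le> p * pmf (bind_pmf (geometric_pmf ?\<eta>) ?g) (concat vs)"
    using p by (intro mult_left_mono pmf_bind_ge) auto
  also have "\<dots> \<le> pmf universal_pmf (concat vs)"
    unfolding universal_pmf_def p_def
    using pmf_bind_ge[of "map_pmf from_nat (geometric_pmf (1 / 2))" "(us, N)"
      "\<lambda>(us :: nat list list, N :: nat).
       bind_pmf (geometric_pmf (1 / (real N + 2))) (\<lambda>b.
         map_pmf concat (replicate_pmf b (pmf_of_multiset (mset us))))" "concat vs"] by simp
  finally show "p * ?\<eta> * (1 - ?\<eta>) ^ length vs * ?P \<le> pmf universal_pmf (concat vs)" .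
qed

lemma measurable_universal:
  assumes "A \<noteq> {}"
  shows "(\<lambda>w k. from_nat_into A (if k < length w then w ! k else 0)) \<in> measurable (measure_pmf M) (code_space A)"
  by (auto simp: space_code_space from_nat_into[OF assms])

lemma sets_universal_measure: "sets (universal_measure A) = sets (code_space A)"
  by (simp add: universal_measure_def)

lemma finite_universal_measure: "A \<noteq> {} \<Longrightarrow> finite_measure (universal_measure A)"
  unfolding universal_measure_def
  by (intro prob_space.finite_measure measure_pmf.prob_space_distr measurable_universal)

text \<open>A parse may end after position \<open>n\<close>, so \<open>w\<close> is allowed to be
  longer than the prefix; its padded sequence is an atom inside the cylinder.\<close>

lemma universal_cylinder_ge:
  assumes A: "finite A" "A \<noteq> {}" and \<omega>: "\<omega> \<in> space (code_space A)" and n: "n \<le> length w"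
    and w: "w = map (to_nat_on A) (map \<omega> [0..<length w])"
  shows "pmf universal_pmf w \<le> measure (universal_measure A) (cylinder A (prefix_word n \<omega>))"
proof -
  let ?c = "\<lambda>w k. from_nat_into A (if k < length w then w ! k else 0)"
  have *: "?c w k = \<omega> k" if "k < n" for k
  proof -
    have "w ! k = to_nat_on A (\<omega> k)"
      using that n by (subst w) simp
    then show ?thesis
      using that n \<omega> A by (simp add: space_code_space countable_finite)
  qed
  have "pmf universal_pmf w = measure (measure_pmf universal_pmf) {w}"
    by (simp add: measure_pmf_single)
  also have "\<dots> \<le> measure (measure_pmf universal_pmf) (?c -` cylinder A (prefix_word n \<omega>) \<inter> space (measure_pmf universal_pmf))"
  proof (rule measure_pmf.finite_measure_mono)
    have "?c w \<in> space (code_space A)" using A by (simp add: space_code_space from_nat_into)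
    then show "{w} \<subseteq> ?c -` cylinder A (prefix_word n \<omega>) \<inter> space (measure_pmf universal_pmf)"
      using * by (auto simp: cylinder_prefix_word)
  qed simp
  also have "\<dots> = measure (universal_measure A) (cylinder A (prefix_word n \<omega>))"
    unfolding universal_measure_def
    by (rule measure_distr[symmetric, OF measurable_universal[OF A(2)] sets_cylinder])
  finally show ?thesis .
qed

text \<open>Greedy parsing: a word of \<open>G\<close> is used wherever one occurs, a single letter otherwise.\<close>

lemma parsing:
  fixes G :: "'i list set" and c :: real and p :: "'i list \<Rightarrow> real"
  assumes G: "\<And>u. u \<in> G \<Longrightarrow> u \<noteq> [] \<and> length u \<le> M \<and> 2 powr (- c * length u) \<le> p u"
    and M: "1 \<le> M" and c: "0 \<le> c" and \<kappa>: "0 < \<kappa>" "\<kappa> \<le> 1" and single: "\<And>i. \<kappa> \<le> p [\<omega> i]"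
    and j: "j \<le> n"
  shows "\<exists>us. n \<le> j + length (concat us) \<and> j + length (concat us) \<le> n + M \<and>
    concat us = map \<omega> [j..<j + length (concat us)] \<and> [] \<notin> set us \<and>
    2 powr (- c * length (concat us)) * \<kappa> ^ card {i \<in> {j..<n}. \<forall>m. map \<omega> [i..<i + m] \<notin> G}
      \<le> prod_list (map p us)"
  using j
proof (induction "n - j" arbitrary: j rule: less_induct)
  case less
  let ?bad = "\<lambda>j. {i \<in> {j..<n}. \<forall>m. map \<omega> [i..<i + m] \<notin> G}"
  show ?case
  proof (cases "j = n")
    case True
    then show ?thesis by (intro exI[of _ "[]"]) simp
  next
    case False
    then have jn: "j < n" using less.prems by simp
    \<comment> \<open>One step of the parse. The bound is kept for every total length
      \<open>b\<close>, because the length of the remaining parse is known only after the induction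
      hypothesis has been applied.\<close>
    have "\<exists>m u. u = map \<omega> [j..<j + m] \<and> 0 < m \<and> m \<le> M \<and>
        (\<forall>b\<ge>0. 2 powr (- c * b) * \<kappa> ^ card (?bad j) \<le> p u * (2 powr (- c * (b - m)) * \<kappa> ^ card (?bad (j + m))))"
    proof (cases "\<exists>m. map \<omega> [j..<j + m] \<in> G")
      case True
      then obtain m where m: "map \<omega> [j..<j + m] \<in> G" by blast
      let ?u = "map \<omega> [j..<j + m]"
      have m': "0 < m" "m \<le> M" "2 powr (- c * m) \<le> p ?u" using G[OF m] by auto
      have "2 powr (- c * b) * \<kappa> ^ card (?bad j) \<le> p ?u * (2 powr (- c * (b - m)) * \<kappa> ^ card (?bad (j + m)))"
        if "0 \<le> b" for b :: real
      proof -
        have "card (?bad (j + m)) \<le> card (?bad j)" by (intro card_mono) auto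
        then have "\<kappa> ^ card (?bad j) \<le> \<kappa> ^ card (?bad (j + m))"
          using \<kappa> by (intro power_decreasing) auto
        moreover have "2 powr (- c * b) = 2 powr (- c * m) * 2 powr (- c * (b - m))"
          by (simp add: powr_add[symmetric] algebra_simps)
        ultimately have "2 powr (- c * b) * \<kappa> ^ card (?bad j) \<le>
          2 powr (- c * m) * 2 powr (- c * (b - m)) * \<kappa> ^ card (?bad (j + m))"
          by (simp add: mult_left_mono)
        also have "\<dots> = 2 powr (- c * m) * (2 powr (- c * (b - m)) * \<kappa> ^ card (?bad (j + m)))"
          by (simp only: mult.assoc)
        also have "\<dots> \<le> p ?u * (2 powr (- c * (b - m)) * \<kappa> ^ card (?bad (j + m)))"
          using m'(3) \<kappa> by (intro mult_right_mono) auto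
        finally show ?thesis .
      qed
      then show ?thesis using m' by blast
    next
      case False
      \<comment> \<open>No word of \<open>G\<close> starts at \<open>j\<close>, so the single letter
        is charged to \<open>j\<close> itself and one factor \<kappa> leaves the count.\<close>
      have "?bad j = insert j (?bad (j + 1))" using jn False by (auto simp: Suc_le_eq le_less)
      then have card: "card (?bad j) = Suc (card (?bad (j + 1)))" by simp
      have "2 powr (- c * b) * \<kappa> ^ card (?bad j) \<le> p [\<omega> j] * (2 powr (- c * (b - real 1)) * \<kappa> ^ card (?bad (j + 1)))"
        if "0 \<le> b" for b :: real
      proof -
        have "2 powr (- c * b) * \<kappa> ^ card (?bad j) = \<kappa> * (2 powr (- c * b) * \<kappa> ^ card (?bad (j + 1)))"
          unfolding card by simp
        also have "\<dots> \<le> p [\<omega> j] * (2 powr (- c * (b - real 1)) * \<kappa> ^ card (?bad (j + 1)))"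
          using single[of j] \<kappa> c by (intro mult_mono) (auto simp: algebra_simps)
        finally show ?thesis .
      qed
      then show ?thesis using M by (intro exI[of _ 1] exI[of _ "[\<omega> j]"]) simp
    qed
    then obtain m u where mu: "u = map \<omega> [j..<j + m]" "0 < m" "m \<le> M"
      "\<And>b. 0 \<le> b \<Longrightarrow> 2 powr (- c * b) * \<kappa> ^ card (?bad j) \<le> p u * (2 powr (- c * (b - m)) * \<kappa> ^ card (?bad (j + m)))"
      by blast
    have lu: "length u = m" using mu(1) by simp
    have pu: "0 \<le> p u"
    proof -
      have "0 < p u * (2 powr (- c * (0 - real m)) * \<kappa> ^ card (?bad (j + m)))"
        by (rule less_le_trans[OF _ mu(4)[of 0]]) (use \<kappa> in auto)
      moreover have "0 < 2 powr (- c * (0 - real m)) * \<kappa> ^ card (?bad (j + m))"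
        using \<kappa> by (intro mult_pos_pos zero_less_power) auto
      ultimately show ?thesis by (rule less_imp_le[OF zero_less_mult_pos2])
    qed
    show ?thesis
    proof (cases "j + m \<le> n")
      case True
      have lt: "n - (j + m) < n - j" using mu(2) jn by linarith
      obtain us where us: "n \<le> j + m + length (concat us)" "j + m + length (concat us) \<le> n + M"
        "concat us = map \<omega> [j + m..<j + m + length (concat us)]" "[] \<notin> set us"
        "2 powr (- c * length (concat us)) * \<kappa> ^ card (?bad (j + m)) \<le> prod_list (map p us)"
        using less.hyps[OF lt True] by blast
      show ?thesis
      proof (intro exI[of _ "u # us"] conjI)
        have "concat (u # us) = map \<omega> [j..<j + m] @ map \<omega> [j + m..<j + m + length (concat us)]"
          using us(3) mu(1) by simp
        also have "\<dots> = map \<omega> [j..<j + length (concat (u # us))]"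
          unfolding map_append[symmetric] by (subst upt_add_eq_append[symmetric]) (auto simp: lu add.assoc)
        finally show "concat (u # us) = map \<omega> [j..<j + length (concat (u # us))]" .
        have "2 powr (- c * length (concat (u # us))) * \<kappa> ^ card (?bad j) \<le>
            p u * (2 powr (- c * (length (concat (u # us)) - real m)) * \<kappa> ^ card (?bad (j + m)))"
          by (rule mu(4)) simp
        also have "\<dots> = p u * (2 powr (- c * length (concat us)) * \<kappa> ^ card (?bad (j + m)))"
          by (simp add: lu)
        also have "\<dots> \<le> p u * prod_list (map p us)"
          using pu us(5) by (intro mult_left_mono)
        finally show "2 powr (- c * length (concat (u # us))) * \<kappa> ^ card (?bad j) \<le> prod_list (map p (u # us))"
          by simp
      qed (use us mu(2) lu in auto)
    next
      case False
      \<comment> \<open>The block reaches past \<open>n\<close>: the parse stops, no bad position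
        remains, and the overshoot is at most the block length, hence at most
        \<open>M\<close>.\<close>
      have empty: "?bad (j + m) = {}" using False by auto
      have "2 powr (- c * m) * \<kappa> ^ card (?bad j) \<le> p u"
        using mu(4)[of m] unfolding empty by simp
      then show ?thesis
        using False mu lu jn by (intro exI[of _ "[u]"]) auto
    qed
  qed
qed

lemma length_le_length_concat: "[] \<notin> set us \<Longrightarrow> length us \<le> length (concat us)"
proof (induction us)
  case (Cons u us)
  then show ?case by (cases u) auto
qed simp

text \<open>A parse is turned into an atom of the universal measure. Blocks are nonempty, so there
  are at most \<open>n + M\<close> of them, which makes the geometric weight exponential in
  \<open>n\<close> with a rate at the disposal of \<open>N\<close>.\<close>

lemma universal_measure_ge:
  fixes G :: "'i list set" and c :: real
  assumes A: "finite A" "A \<noteq> {}"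
    and G: "\<And>u. u \<in> G \<Longrightarrow> u \<noteq> [] \<and> length u \<le> M \<and>
      2 powr (- c * length u) \<le> pmf (pmf_of_multiset (mset us)) (map (to_nat_on A) u)"
    and M: "1 \<le> M" and c: "0 \<le> c" and \<kappa>: "0 < \<kappa>" "\<kappa> \<le> 1"
    and single: "\<And>a. a \<in> A \<Longrightarrow> \<kappa> \<le> pmf (pmf_of_multiset (mset us)) [to_nat_on A a]"
  shows "\<exists>C>0. \<forall>\<omega>\<in>space (code_space A). \<forall>n.
    C * (1 - 1 / (real N + 2)) ^ n * 2 powr (- c * n) * \<kappa> ^ card {i \<in> {..<n}. \<forall>m. map \<omega> [i..<i + m] \<notin> G}
      \<le> measure (universal_measure A) (cylinder A (prefix_word n \<omega>))"
proof -
  define q where "q = 1 - 1 / (real N + 2)"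
  have q: "0 < q" "q \<le> 1" by (auto simp: q_def)
  define p where "p = pmf (pmf_of_multiset (mset us))"
  obtain C where C: "C > 0" "\<And>vs. C * q ^ length vs * prod_list (map p vs) \<le> pmf universal_pmf (concat vs)"
    using pmf_universal_ge[of N us] unfolding q_def p_def by blast
  show ?thesis
    unfolding q_def[symmetric]
  proof (intro exI conjI ballI allI)
    \<comment> \<open>The factors besides \<open>C\<close> pay for the at most \<open>M\<close>
      letters by which a parse overshoots \<open>n\<close>.\<close>
    show "0 < C * q ^ M * 2 powr (- c * M)" using C q by simp
    fix \<omega> n assume \<omega>: "\<omega> \<in> space (code_space A)"
    let ?bad = "{i \<in> {0..<n}. \<forall>m. map \<omega> [i..<i + m] \<notin> G}"
    have "\<exists>vs. n \<le> 0 + length (concat vs) \<and> 0 + length (concat vs) \<le> n + M \<and>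
      concat vs = map \<omega> [0..<0 + length (concat vs)] \<and> [] \<notin> set vs \<and>
      2 powr (- c * length (concat vs)) * \<kappa> ^ card ?bad \<le> prod_list (map (p \<circ> map (to_nat_on A)) vs)"
      by (rule parsing[OF _ M c \<kappa>]) (use G single \<omega> in \<open>simp_all add: p_def space_code_space\<close>)
    then obtain vs where vs: "n \<le> length (concat vs)" "length (concat vs) \<le> n + M"
      "concat vs = map \<omega> [0..<length (concat vs)]" "[] \<notin> set vs"
      "2 powr (- c * length (concat vs)) * \<kappa> ^ card ?bad \<le> prod_list (map (p \<circ> map (to_nat_on A)) vs)"
      unfolding add_0 by blast
    let ?vs = "map (map (to_nat_on A)) vs"
    have q1: "q ^ (n + M) \<le> q ^ length vs"
      using q length_le_length_concat[OF vs(4)] vs(2) by (intro power_decreasing) auto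
    have p1: "2 powr (- c * (n + M)) \<le> 2 powr (- c * length (concat vs))"
    proof -
      have "real (length (concat vs)) \<le> real n + real M" using vs(2) by linarith
      then have "c * length (concat vs) \<le> c * (n + M)" using c by (intro mult_left_mono) auto
      then show ?thesis by simp
    qed
    have "C * q ^ M * 2 powr (- c * M) * q ^ n * 2 powr (- c * n) * \<kappa> ^ card ?bad =
        C * q ^ (n + M) * (2 powr (- c * (n + M)) * \<kappa> ^ card ?bad)"
      by (simp add: power_add powr_add[symmetric] algebra_simps)
    also have "\<dots> \<le> C * q ^ length vs * (2 powr (- c * length (concat vs)) * \<kappa> ^ card ?bad)"
      by (intro mult_mono q1 p1 order_refl mult_nonneg_nonneg) (use C q \<kappa> in auto)
    also have "\<dots> \<le> C * q ^ length vs * prod_list (map (p \<circ> map (to_nat_on A)) vs)"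
      using vs(5) C q by (intro mult_left_mono) auto
    also have "\<dots> = C * q ^ length ?vs * prod_list (map p ?vs)" by simp
    also have "\<dots> \<le> pmf universal_pmf (concat ?vs)" by (rule C)
    also have "\<dots> \<le> measure (universal_measure A) (cylinder A (prefix_word n \<omega>))"
    proof (rule universal_cylinder_ge[OF A \<omega>])
      have "concat ?vs = map (to_nat_on A) (concat vs)" by (rule map_concat[symmetric])
      then show "concat ?vs = map (to_nat_on A) (map \<omega> [0..<length (concat ?vs)])"
        using vs(3) by (metis length_map)
      show "n \<le> length (concat ?vs)" using vs(1) by (simp add: map_concat[symmetric])
    qed
    finally show "C * q ^ M * 2 powr (- c * M) * q ^ n * 2 powr (- c * n) *
        \<kappa> ^ card {i \<in> {..<n}. \<forall>m. map \<omega> [i..<i + m] \<notin> G}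
      \<le> measure (universal_measure A) (cylinder A (prefix_word n \<omega>))"
      by (simp add: atLeast0LessThan)
  qed
qed

lemma eventually_const_powr:
  fixes C :: real
  assumes "0 < C" "0 < \<epsilon>"
  shows "eventually (\<lambda>n::nat. 2 powr (- \<epsilon> * n) \<le> C) sequentially"
proof -
  have "(\<lambda>n. (2 powr (- \<epsilon>)) ^ n) \<longlonglongrightarrow> (0::real)"
    using assms by (intro LIMSEQ_realpow_zero) (auto simp: powr_minus inverse_less_1_iff)
  then have "eventually (\<lambda>n. (2 powr (- \<epsilon>)) ^ n < C) sequentially"
    using assms(1) by (rule order_tendstoD)
  then show ?thesis
    by eventually_elim (simp add: powr_realpow[symmetric] powr_powr)
qed

section \<open>The Shannon--McMillan--Breiman theorem by block coding\<close>

context ergodic_code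
begin

lemma finite_words: "finite (words A n)"
  by (rule finite_lists_length_eq[OF finite_alphabet])

lemma sum_cylinder_le: "S \<subseteq> words A n \<Longrightarrow> (\<Sum>u\<in>S. measure \<mu> (cylinder A u)) \<le> 1"
proof -
  assume S: "S \<subseteq> words A n"
  then have "(\<Sum>u\<in>S. measure \<mu> (cylinder A u)) = measure \<mu> (\<Union>u\<in>S. cylinder A u)"
    by (intro finite_measure_finite_Union[symmetric])
      (auto intro: finite_subset[OF _ finite_words] disjoint_family_on_mono[OF _ disjoint_cylinders])
  also have "\<dots> \<le> 1" by simp
  finally show ?thesis .
qed

text \<open>A Shannon code realized by multiplicities. The weights \<open>w u\<close> have bounded
  sum because words of one length have total mass at most 1 and an extra \<epsilon> per letter makes
  the sum over lengths geometric. Of the \<open>3 * \<epsilon>\<close>, one is the slack in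
  \<open>G\<close>, one buys this summability, and one pays for the normalization, since the words
  have length at least \<open>L\<close>.\<close>

lemma block_code:
  fixes h \<epsilon> :: real and L M :: nat
  assumes \<epsilon>: "0 < \<epsilon>" and L: "(1 / (1 - 2 powr (- \<epsilon>)) + 1 + card A) \<le> 2 powr (\<epsilon> * L)"
    and W: "\<And>u. u \<in> G \<Longrightarrow> set u \<subseteq> A \<and> L \<le> length u \<and> length u \<le> M \<and> 2 powr (- (h + \<epsilon>) * length u) \<le> measure \<mu> (cylinder A u)"
  obtains us :: "nat list list" where
    "\<And>u. u \<in> G \<Longrightarrow> 2 powr (- (h + 3 * \<epsilon>) * length u) \<le> pmf (pmf_of_multiset (mset us)) (map (to_nat_on A) u)"
    "\<And>a. a \<in> A \<Longrightarrow> 1 / (1 / (1 - 2 powr (- \<epsilon>)) + 1 + card A) \<le> pmf (pmf_of_multiset (mset us)) [to_nat_on A a]"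
proof -
  define B where "B = 1 / (1 - 2 powr (- \<epsilon>)) + 1 + card A"
  have e1: "2 powr (- \<epsilon>) < 1" using \<epsilon> by (simp add: powr_minus inverse_less_1_iff)
  have B1: "1 \<le> B" using e1 by (simp add: B_def)
  have G_UN: "G = (\<Union>m\<in>{..M}. {u \<in> G. length u = m})" using W by auto
  have finG: "finite {u \<in> G. length u = m}" for m
    by (rule finite_subset[OF _ finite_words[of m]]) (use W in auto)
  then have finite_G: "finite G" by (subst G_UN) blast
  define w where "w u = 2 powr (- (h + 2 * \<epsilon>) * length u)" for u :: "'i list"
  have sum_w: "(\<Sum>u\<in>G. w u) \<le> 1 / (1 - 2 powr (- \<epsilon>))"
  proof -
    have "(\<Sum>u\<in>G. w u) \<le> (\<Sum>u\<in>G. 2 powr (- \<epsilon> * length u) * measure \<mu> (cylinder A u))"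
    proof (rule sum_mono)
      fix u assume "u \<in> G"
      have "w u = 2 powr (- \<epsilon> * length u) * 2 powr (- (h + \<epsilon>) * length u)"
        unfolding w_def powr_add[symmetric] by (rule arg_cong[where f = "\<lambda>x. 2 powr x"]) (simp add: algebra_simps)
      also have "\<dots> \<le> 2 powr (- \<epsilon> * length u) * measure \<mu> (cylinder A u)"
        using W[OF \<open>u \<in> G\<close>] by (intro mult_left_mono) auto
      finally show "w u \<le> 2 powr (- \<epsilon> * length u) * measure \<mu> (cylinder A u)" .
    qed
    also have "\<dots> = (\<Sum>m\<le>M. \<Sum>u\<in>{u \<in> G. length u = m}. 2 powr (- \<epsilon> * length u) * measure \<mu> (cylinder A u))"
      by (subst G_UN, rule sum.UNION_disjoint) (use finG in auto)
    also have "\<dots> = (\<Sum>m\<le>M. 2 powr (- \<epsilon> * m) * (\<Sum>u\<in>{u \<in> G. length u = m}. measure \<mu> (cylinder A u)))"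
      by (intro sum.cong refl) (simp add: sum_distrib_left)
    also have "\<dots> \<le> (\<Sum>m\<le>M. (2 powr (- \<epsilon>)) ^ m)"
    proof (rule sum_mono)
      fix m
      have "(\<Sum>u\<in>{u \<in> G. length u = m}. measure \<mu> (cylinder A u)) \<le> 1"
        by (rule sum_cylinder_le[of _ m]) (use W in auto)
      then have "2 powr (- \<epsilon> * m) * (\<Sum>u\<in>{u \<in> G. length u = m}. measure \<mu> (cylinder A u)) \<le> 2 powr (- \<epsilon> * m) * 1"
        by (intro mult_left_mono) auto
      then show "2 powr (- \<epsilon> * m) * (\<Sum>u\<in>{u \<in> G. length u = m}. measure \<mu> (cylinder A u)) \<le> (2 powr (- \<epsilon>)) ^ m"
        by (simp add: powr_realpow[symmetric] powr_powr)
    qed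
    also have "\<dots> \<le> (\<Sum>m. (2 powr (- \<epsilon>)) ^ m)"
      using e1 by (intro sum_le_suminf summable_geometric) auto
    also have "\<dots> = 1 / (1 - 2 powr (- \<epsilon>))"
      using e1 by (intro suminf_geometric) auto
    finally show ?thesis .
  qed
  \<comment> \<open>Rounding up adds at most one copy per word of \<open>G\<close>, hence at most
    \<open>N\<close> copies in all; this is the middle summand 1 of \<open>B\<close>. The letters
    with \<open>N\<close> copies each contribute \<open>card A\<close>.\<close>
  define N where "N = card G + 1"
  define a where "a u = nat \<lceil>N * w u\<rceil>" for u
  have w_nonneg: "0 \<le> w u" for u by (simp add: w_def)
  have a_ge: "N * w u \<le> a u" for u unfolding a_def by (rule real_nat_ceiling_ge)
  have a_le: "a u \<le> N * w u + 1" for u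
  proof -
    have "0 \<le> N * w u" using w_nonneg by simp
    then show ?thesis unfolding a_def by linarith
  qed
  define X where "X = (\<Sum>u\<in>G. replicate_mset (a u) (map (to_nat_on A) u)) + (\<Sum>b\<in>A. replicate_mset N [to_nat_on A b])"
  obtain us where us: "mset us = X" using ex_mset by blast
  have size_le: "size X \<le> N * B"
  proof -
    have "size X = (\<Sum>u\<in>G. a u) + (\<Sum>b\<in>A. N)"
      by (simp add: X_def size_multiset_sum)
    then have "real (size X) = (\<Sum>u\<in>G. real (a u)) + card A * N" by simp
    also have "\<dots> \<le> (\<Sum>u\<in>G. N * w u + 1) + card A * N"
      by (intro add_mono sum_mono a_le order_refl)
    also have "\<dots> = N * (\<Sum>u\<in>G. w u) + card G + card A * N"
      by (simp add: sum.distrib sum_distrib_left)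
    also have "\<dots> \<le> N * (1 / (1 - 2 powr (- \<epsilon>))) + N + card A * N"
      by (intro add_mono mult_left_mono sum_w order_refl) (auto simp: N_def)
    also have "\<dots> = N * B" by (simp add: B_def algebra_simps)
    finally show ?thesis .
  qed
  have count_G: "a u \<le> count X (map (to_nat_on A) u)" if "u \<in> G" for u
  proof -
    have "a u = count (replicate_mset (a u) (map (to_nat_on A) u)) (map (to_nat_on A) u)" by simp
    also have "\<dots> \<le> (\<Sum>v\<in>G. count (replicate_mset (a v) (map (to_nat_on A) v)) (map (to_nat_on A) u))"
      by (rule member_le_sum[OF that _ finite_G]) simp
    finally show ?thesis by (simp add: X_def count_sum)
  qed
  have count_A: "N \<le> count X [to_nat_on A b]" if "b \<in> A" for b
  proof -
    have "N = count (replicate_mset N [to_nat_on A b]) [to_nat_on A b]" by simp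
    also have "\<dots> \<le> (\<Sum>v\<in>A. count (replicate_mset N [to_nat_on A v]) [to_nat_on A b])"
      by (rule member_le_sum[OF that _ finite_alphabet]) simp
    finally show ?thesis by (simp add: X_def count_sum)
  qed
  have X_ne: "X \<noteq> {#}"
  proof -
    obtain b where "b \<in> A" using alphabet_nonempty by blast
    then show ?thesis using count_A[of b] by (auto simp: N_def)
  qed
  then have size_pos: "0 < size X" by (simp add: nonempty_has_size)
  have pmf_ge: "q / B \<le> pmf (pmf_of_multiset (mset us)) x" if "N * q \<le> count X x" "0 \<le> q" for x and q :: real
  proof -
    have "q / B * size X \<le> q / B * (N * B)"
      using that B1 size_le by (intro mult_left_mono) auto
    also have "\<dots> = N * q" using B1 by simp
    also have "\<dots> \<le> count X x" by fact
    finally have "q / B \<le> count X x / size X" using size_pos by (simp add: pos_le_divide_eq)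
    then show ?thesis using X_ne us by simp
  qed
  show ?thesis
  proof (rule that[of us])
    fix u assume u: "u \<in> G"
    have "real L \<le> length u" using W[OF u] by simp
    then have "\<epsilon> * L \<le> \<epsilon> * length u" using \<epsilon> by simp
    then have "2 powr (\<epsilon> * L) \<le> 2 powr (\<epsilon> * length u)" by simp
    with L have "B \<le> 2 powr (\<epsilon> * length u)" unfolding B_def by linarith
    then have "w u / 2 powr (\<epsilon> * length u) \<le> w u / B"
      using B1 w_nonneg[of u] by (intro divide_left_mono mult_pos_pos) auto
    moreover have "w u / 2 powr (\<epsilon> * length u) = 2 powr (- (h + 3 * \<epsilon>) * length u)"
      unfolding w_def powr_diff[symmetric] by (rule arg_cong[where f = "\<lambda>x. 2 powr x"]) (simp add: algebra_simps)
    moreover have "w u / B \<le> pmf (pmf_of_multiset (mset us)) (map (to_nat_on A) u)"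
      using a_ge[of u] count_G[OF u] w_nonneg by (intro pmf_ge) auto
    ultimately show "2 powr (- (h + 3 * \<epsilon>) * length u) \<le> pmf (pmf_of_multiset (mset us)) (map (to_nat_on A) u)"
      by linarith
  next
    fix b assume "b \<in> A"
    then show "1 / (1 / (1 - 2 powr (- \<epsilon>)) + 1 + card A) \<le> pmf (pmf_of_multiset (mset us)) [to_nat_on A b]"
      using count_A[of b] unfolding B_def[symmetric] by (intro pmf_ge) auto
  qed
qed

text \<open>It is enough that heavy words start infinitely often at typical points: a finite range
  of lengths from \<open>L\<close> to \<open>M\<close> then serves all but a small frequency of
  starting positions, and long prefixes are parsed into such words. The six units of \<epsilon> are
  three from \<open>block_code\<close>, one for the geometric weight, one for the badly parsed
  letters and one for the constant.\<close>

lemma universal_measure_lower_bound: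
  fixes h \<epsilon> :: real
  assumes h: "0 \<le> h" and \<epsilon>: "0 < \<epsilon>"
    and freq: "AE \<omega> in \<mu>. frequently (\<lambda>n. 2 powr (- (h + \<epsilon>) * n) < measure \<mu> (cylinder A (prefix_word n \<omega>))) sequentially"
  shows "AE \<omega> in \<mu>. eventually (\<lambda>n. 2 powr (- (h + 6 * \<epsilon>) * n) \<le> measure (universal_measure A) (cylinder A (prefix_word n \<omega>))) sequentially"
proof -
  define B where "B = 1 / (1 - 2 powr (- \<epsilon>)) + 1 + card A"
  have e1: "2 powr (- \<epsilon>) < 1" using \<epsilon> by (simp add: powr_minus inverse_less_1_iff)
  have "0 < 1 / (1 - 2 powr (- \<epsilon>))" using e1 by simp
  then have B1: "1 < B" unfolding B_def by linarith
  obtain L :: nat where L: "B \<le> 2 powr (\<epsilon> * L)" "1 \<le> L"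
  proof -
    have "eventually (\<lambda>n::nat. 2 powr (- \<epsilon> * n) \<le> 1 / B \<and> (1::nat) \<le> n) sequentially"
      using B1 \<epsilon> by (intro eventually_conj eventually_const_powr eventually_ge_at_top) auto
    then have "\<exists>n::nat. 2 powr (- \<epsilon> * n) \<le> 1 / B \<and> (1::nat) \<le> n"
      by (rule eventually_happens'[OF sequentially_bot])
    then obtain n :: nat where n: "2 powr (- \<epsilon> * n) \<le> 1 / B" "1 \<le> n"
      by (elim exE conjE)
    have "inverse (2 powr (\<epsilon> * n)) \<le> inverse B"
      using n(1) by (simp only: mult_minus_left powr_minus inverse_eq_divide)
    then have "B \<le> 2 powr (\<epsilon> * n)" by (rule inverse_le_imp_le) (use B1 in simp)
    then show ?thesis using that n(2) by blast
  qed
  \<comment> \<open>A badly parsed letter costs \<open>log 2 B\<close> bits, so a fraction \<delta>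
    of them costs \<open>\<epsilon> * n\<close> bits.\<close>
  define \<delta> where "\<delta> = \<epsilon> / log 2 B"
  have logB: "0 < log 2 B" using B1 by simp
  have \<delta>: "0 < \<delta>" using \<epsilon> logB by (simp add: \<delta>_def)
  define W where "W = {u. set u \<subseteq> A \<and> 2 powr (- (h + \<epsilon>) * length u) \<le> measure \<mu> (cylinder A u)}"
  \<comment> \<open>The points at which no word of the code \<open>G\<close> chosen below starts.
    Since heavy cylinders almost surely occur at arbitrarily large lengths, these sets decrease to a
    null set as \<open>M\<close> grows.\<close>
  define Z where "Z M = {\<omega> \<in> space \<mu>. \<forall>m\<in>{L..M}. measure \<mu> (cylinder A (prefix_word m \<omega>)) < 2 powr (- (h + \<epsilon>) * m)}" for M
  have Zm: "Z M \<in> sets \<mu>" for M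
  proof -
    have "{\<omega> \<in> space \<mu>. measure \<mu> (cylinder A (prefix_word m \<omega>)) < a} \<in> sets \<mu>" for m a
      using borel_prefix_word[of "\<lambda>u. measure \<mu> (cylinder A u)" m] by (simp add: borel_measurable_iff_less)
    then show ?thesis unfolding Z_def by (intro sets.sets_Collect_finite_All) auto
  qed
  have "decseq Z" by (rule decseq_SucI) (auto simp: Z_def)
  then have "(\<lambda>M. measure \<mu> (Z M)) \<longlonglongrightarrow> measure \<mu> (\<Inter>M. Z M)"
    using Zm by (intro finite_Lim_measure_decseq) auto
  moreover have "measure \<mu> (\<Inter>M. Z M) = 0"
  proof (subst prob_eq_0)
    show "AE \<omega> in \<mu>. \<omega> \<notin> (\<Inter>M. Z M)"
      using freq
    proof eventually_elim
      case (elim \<omega>)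
      then obtain n where "n \<ge> L" "2 powr (- (h + \<epsilon>) * n) < measure \<mu> (cylinder A (prefix_word n \<omega>))"
        unfolding frequently_sequentially by blast
      then have "\<omega> \<notin> Z n" unfolding Z_def by (auto intro!: bexI[of _ n])
      then show ?case by blast
    qed
  qed (use Zm in blast)
  ultimately have "eventually (\<lambda>M. measure \<mu> (Z M) < \<delta>) sequentially"
    using \<delta> by (intro order_tendstoD) auto
  then have "eventually (\<lambda>M. measure \<mu> (Z M) < \<delta> \<and> (1::nat) \<le> M) sequentially"
    by (intro eventually_conj eventually_ge_at_top)
  then have "\<exists>M. measure \<mu> (Z M) < \<delta> \<and> (1::nat) \<le> M"
    by (rule eventually_happens'[OF sequentially_bot])
  then obtain M where M: "measure \<mu> (Z M) < \<delta>" "1 \<le> M" by (elim exE conjE)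
  define G where "G = {u \<in> W. length u \<in> {L..M}}"
  obtain us :: "nat list list" where us:
    "\<And>u. u \<in> G \<Longrightarrow> 2 powr (- (h + 3 * \<epsilon>) * length u) \<le> pmf (pmf_of_multiset (mset us)) (map (to_nat_on A) u)"
    "\<And>a. a \<in> A \<Longrightarrow> 1 / B \<le> pmf (pmf_of_multiset (mset us)) [to_nat_on A a]"
    by (rule block_code[OF \<epsilon> L(1)[unfolded B_def], of G M h])
      (auto simp: G_def W_def B_def)
  \<comment> \<open>Large \<open>N\<close> makes long concatenations cheap: each block loses at most
    the factor \<open>2 powr (- \<epsilon>)\<close>.\<close>
  obtain N :: nat where N: "2 powr (- \<epsilon>) \<le> 1 - 1 / (real N + 2)"
  proof -
    obtain N :: nat where "1 / (real N + 1) < 1 - 2 powr (- \<epsilon>)"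
      using reals_Archimedean[of "1 - 2 powr (- \<epsilon>)"] e1 by (auto simp: inverse_eq_divide add.commute)
    moreover have "1 / (real N + 2) \<le> 1 / (real N + 1)" by (simp add: frac_le)
    ultimately show ?thesis by (intro that[of N]) linarith
  qed
  have "\<exists>C>0. \<forall>\<omega>\<in>space (code_space A). \<forall>n.
    C * (1 - 1 / (real N + 2)) ^ n * 2 powr (- (h + 3 * \<epsilon>) * n) * (1 / B) ^ card {i \<in> {..<n}. \<forall>m. map \<omega> [i..<i + m] \<notin> G}
      \<le> measure (universal_measure A) (cylinder A (prefix_word n \<omega>))"
    by (rule universal_measure_ge[OF finite_alphabet alphabet_nonempty, where us = us and M = M])
      (use us M(2) B1 L h \<epsilon> in \<open>auto simp: G_def\<close>)
  then obtain C where C: "C > 0" "\<And>\<omega> n. \<omega> \<in> space \<mu> \<Longrightarrow>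
    C * (1 - 1 / (real N + 2)) ^ n * 2 powr (- (h + 3 * \<epsilon>) * n) * (1 / B) ^ card {i \<in> {..<n}. \<forall>m. map \<omega> [i..<i + m] \<notin> G}
      \<le> measure (universal_measure A) (cylinder A (prefix_word n \<omega>))"
    unfolding space_eq by blast
  have "eventually (\<lambda>n::nat. 2 powr (- \<epsilon> * n) \<le> C) sequentially"
    using C(1) \<epsilon> by (rule eventually_const_powr)
  note evC = this
  show ?thesis
    using eventually_visits_le[OF Zm M(1)] AE_space
  proof eventually_elim
    case (elim \<omega>)
    have in_space: "(left_shift ^^ i) \<omega> \<in> space \<mu>" for i
      using elim(2) by (simp add: space_eq space_code_space funpow_left_shift)
    have bad: "(left_shift ^^ i) \<omega> \<in> Z M" if i: "\<forall>m. map \<omega> [i..<i + m] \<notin> G" for i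
    proof -
      have "measure \<mu> (cylinder A (prefix_word m ((left_shift ^^ i) \<omega>))) < 2 powr (- (h + \<epsilon>) * m)"
        if m: "m \<in> {L..M}" for m
      proof -
        have eq: "prefix_word m ((left_shift ^^ i) \<omega>) = map \<omega> [i..<i + m]"
          by (auto simp: prefix_word_def funpow_left_shift intro!: nth_equalityI)
        have "set (prefix_word m ((left_shift ^^ i) \<omega>)) \<subseteq> A"
          using prefix_word_in_words[of "(left_shift ^^ i) \<omega>" A m] in_space by (simp add: space_eq)
        moreover have "prefix_word m ((left_shift ^^ i) \<omega>) \<notin> G" using i eq by simp
        ultimately show ?thesis using m by (auto simp: G_def W_def not_le)
      qed
      then show ?thesis using in_space by (simp add: Z_def)
    qed
    show ?case
      using elim(1) evC
    proof eventually_elim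
      case (elim n)
      let ?bad = "{i \<in> {..<n}. \<forall>m. map \<omega> [i..<i + m] \<notin> G}"
      have "real (card ?bad) = (\<Sum>i\<in>?bad. 1)" by simp
      also have "\<dots> \<le> (\<Sum>i\<in>?bad. indicator (Z M) ((left_shift ^^ i) \<omega>))"
        using bad by (intro sum_mono) auto
      also have "\<dots> \<le> (\<Sum>i<n. indicator (Z M) ((left_shift ^^ i) \<omega>))"
        by (intro sum_mono2) auto
      also have "\<dots> \<le> \<delta> * n" by fact
      finally have card: "real (card ?bad) \<le> \<delta> * n" .
      have "2 powr (- \<epsilon> * n) \<le> (1 / B) ^ card ?bad"
      proof -
        have "(1 / B) ^ card ?bad = 2 powr (- log 2 B * card ?bad)"
          using B1 by (simp add: powr_realpow[symmetric] powr_powr[symmetric] powr_minus power_divide inverse_eq_divide powr_divide)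
        moreover have "log 2 B * card ?bad \<le> log 2 B * (\<delta> * n)"
          using card logB by (intro mult_left_mono) auto
        moreover have "log 2 B * (\<delta> * n) = \<epsilon> * n" using logB by (simp add: \<delta>_def)
        ultimately show ?thesis by simp
      qed
      note p1 = this
      have p2: "2 powr (- \<epsilon> * n) \<le> (1 - 1 / (real N + 2)) ^ n"
        using power_mono[OF N, of n] by (simp add: powr_realpow[symmetric] powr_powr)
      have "2 powr (- (h + 6 * \<epsilon>) * n) =
          2 powr (- \<epsilon> * n) * 2 powr (- \<epsilon> * n) * 2 powr (- (h + 3 * \<epsilon>) * n) * 2 powr (- \<epsilon> * n)"
        unfolding powr_add[symmetric] by (rule arg_cong[where f = "\<lambda>x. 2 powr x"]) (simp add: algebra_simps)
      also have "\<dots> \<le> C * (1 - 1 / (real N + 2)) ^ n * 2 powr (- (h + 3 * \<epsilon>) * n) * (1 / B) ^ card ?bad"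
        using B1 C(1) by (intro mult_mono elim(2) p1 p2 order_refl mult_nonneg_nonneg) auto
      also have "\<dots> \<le> measure (universal_measure A) (cylinder A (prefix_word n \<omega>))"
        by (rule C(2)) fact
      finally show ?case .
    qed
  qed
qed

text \<open>The code consists of single letters, and with an empty set of good words every position
  counts as bad. The resulting crude bound serves to exclude infinite entropy.\<close>

lemma universal_measure_ge_exponential:
  obtains C r where "0 < C" "0 < r" "r \<le> 1"
    "\<And>\<omega> n. \<omega> \<in> space \<mu> \<Longrightarrow> C * r ^ n \<le> measure (universal_measure A) (cylinder A (prefix_word n \<omega>))"
proof -
  obtain us where us: "mset us = mset_set ((\<lambda>a. [to_nat_on A a]) ` A)"
    using ex_mset by blast
  define c where "c = card ((\<lambda>a. [to_nat_on A a]) ` A)"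
  have c: "0 < c" unfolding c_def using finite_alphabet alphabet_nonempty by (simp add: card_gt_0_iff)
  have ne: "mset us \<noteq> {#}" using us finite_alphabet alphabet_nonempty by (simp add: mset_set_empty_iff)
  have "1 / c \<le> pmf (pmf_of_multiset (mset us)) [to_nat_on A a]" if "a \<in> A" for a
    using that ne finite_alphabet by (simp add: us c_def)
  then have "\<exists>C>0. \<forall>\<omega>\<in>space (code_space A). \<forall>n.
    C * (1 - 1 / (real 0 + 2)) ^ n * 2 powr (- 0 * n) * (1 / c) ^ card {i \<in> {..<n}. \<forall>m. map \<omega> [i..<i + m] \<notin> {}}
      \<le> measure (universal_measure A) (cylinder A (prefix_word n \<omega>))"
    using c by (intro universal_measure_ge[OF finite_alphabet alphabet_nonempty, where us = us and M = 1]) auto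
  then obtain C where "0 < C" and C: "\<And>\<omega> n. \<omega> \<in> space \<mu> \<Longrightarrow> C * (1 - 1 / (real 0 + 2)) ^ n * 2 powr (- 0 * n) * (1 / c) ^ card {i \<in> {..<n}. \<forall>m. map \<omega> [i..<i + m] \<notin> {}}
      \<le> measure (universal_measure A) (cylinder A (prefix_word n \<omega>))"
    unfolding space_eq by blast
  have "C * (1 / (2 * c)) ^ n \<le> measure (universal_measure A) (cylinder A (prefix_word n \<omega>))" if "\<omega> \<in> space \<mu>" for \<omega> n
    using C[OF that, of n] by (simp add: power_divide power_mult_distrib)
  then show ?thesis using that[of C "1 / (2 * c)"] \<open>0 < C\<close> c by (simp add: divide_le_eq)
qed

text \<open>The Shannon--McMillan--Breiman theorem, following Ornstein and Weiss, simultaneously for \<open>\<mu>\<close> and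
  the universal measure.\<close>

lemma entropy:
  obtains h :: real where "0 \<le> h"
    and "\<And>\<epsilon>::real. 0 < \<epsilon> \<Longrightarrow> AE \<omega> in \<mu>. eventually (\<lambda>n.
      measure \<mu> (cylinder A (prefix_word n \<omega>)) \<in> {2 powr (- (h + \<epsilon>) * n) .. 2 powr (- (h - \<epsilon>) * n)} \<and>
      measure (universal_measure A) (cylinder A (prefix_word n \<omega>)) \<in> {2 powr (- (h + \<epsilon>) * n) .. 2 powr (- (h - \<epsilon>) * n)})
      sequentially"
proof -
  let ?\<nu> = "universal_measure A"
  let ?m = "\<lambda>\<omega> n. measure \<mu> (cylinder A (prefix_word n \<omega>))"
  let ?n = "\<lambda>\<omega> n. measure ?\<nu> (cylinder A (prefix_word n \<omega>))"
  \<comment> \<open>The shift maps a cylinder of length \<open>n + 1\<close> into one of length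
    \<open>n\<close>, and \<mu> is invariant; this is the monotonicity asked for by
    \<open>decay_exponent\<close>, with delay 1.\<close>
  have le: "?m \<omega> (n + 1) \<le> ?m (left_shift \<omega>) n" if "\<omega> \<in> space \<mu>" for \<omega> n
  proof -
    have "cylinder A (prefix_word (n + 1) \<omega>) \<subseteq> left_shift -` cylinder A (prefix_word n (left_shift \<omega>)) \<inter> space \<mu>"
      by (auto simp: cylinder_prefix_word left_shift_def space_eq space_code_space)
    then have "?m \<omega> (n + 1) \<le> measure \<mu> (left_shift -` cylinder A (prefix_word n (left_shift \<omega>)) \<inter> space \<mu>)"
      by (rule finite_measure_mono) (rule measurable_sets[OF shift_measurable sets_cylinder_\<mu>])
    also have "\<dots> = ?m (left_shift \<omega>) n"
      by (rule measure_shift_vimage[OF sets_cylinder_\<mu>])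
    finally show ?thesis .
  qed
  obtain s :: ereal where s: "0 \<le> s"
    "\<And>t::real. ereal t < s \<Longrightarrow> AE \<omega> in \<mu>. eventually (\<lambda>k. ?m \<omega> k \<le> 2 powr (- t * k)) sequentially"
    "\<And>t::real. s < ereal t \<Longrightarrow> AE \<omega> in \<mu>. frequently (\<lambda>k. 2 powr (- t * k) < ?m \<omega> k) sequentially"
    by (rule decay_exponent[of ?m 1]) (use le borel_prefix_word in auto)
  have upper: "AE \<omega> in \<mu>. eventually (\<lambda>n. ?n \<omega> n \<le> 2 powr (\<epsilon> * n) * ?m \<omega> n) sequentially" if "0 < \<epsilon>" for \<epsilon> :: real
    by (rule finite_measure_cylinder_le[OF finite_universal_measure[OF alphabet_nonempty] sets_universal_measure that])
  have "s \<noteq> \<infinity>"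
  proof
    assume inf: "s = \<infinity>"
    obtain C r where Cr: "0 < C" "0 < r" "r \<le> 1" "\<And>\<omega> n. \<omega> \<in> space \<mu> \<Longrightarrow> C * r ^ n \<le> ?n \<omega> n"
      by (rule universal_measure_ge_exponential) blast
    \<comment> \<open>One unit for the constant \<open>C\<close>, one for the factor between the two
      measures, and one to make the contradiction strict.\<close>
    define t where "t = 3 - log 2 r"
    have "AE \<omega> in \<mu>. eventually (\<lambda>k. ?m \<omega> k \<le> 2 powr (- t * k)) sequentially"
      by (rule s(2)) (simp add: inf)
    moreover have "AE \<omega> in \<mu>. eventually (\<lambda>n. ?n \<omega> n \<le> 2 powr (1 * real n) * ?m \<omega> n) sequentially"
      by (rule upper) simp
    ultimately have "AE \<omega> in \<mu>. False"
      using AE_space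
    proof eventually_elim
      case (elim \<omega>)
      have "eventually (\<lambda>n::nat. 2 powr (- 1 * real n) \<le> C) sequentially"
        using Cr by (intro eventually_const_powr) auto
      with elim(1,2) eventually_gt_at_top[of 0]
      have "eventually (\<lambda>n::nat. False) sequentially"
      proof eventually_elim
        case (elim n)
        have r: "r ^ n = 2 powr (log 2 r * n)"
          using Cr by (simp add: powr_powr[symmetric] powr_realpow)
        have "2 powr (- 1 * real n + log 2 r * n) = 2 powr (- 1 * real n) * r ^ n"
          unfolding r powr_add ..
        also have "\<dots> \<le> C * r ^ n" using elim(4) Cr by (intro mult_right_mono) auto
        also have "\<dots> \<le> ?n \<omega> n" by (rule Cr(4)) fact
        also have "\<dots> \<le> 2 powr (1 * real n) * ?m \<omega> n" by fact
        also have "\<dots> \<le> 2 powr (1 * real n) * 2 powr (- t * n)" by (rule mult_left_mono) (use elim in auto)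
        also have "\<dots> = 2 powr (1 * real n + - t * n)" unfolding powr_add ..
        finally have "- 1 * real n + log 2 r * n \<le> 1 * real n + - t * n" by simp
        then show False using elim(3) by (simp add: t_def algebra_simps)
      qed
      then show False by simp
    qed
    then show False by (simp add: AE_False)
  qed
  then obtain h where h: "s = ereal h" using s(1) by (cases s) auto
  show ?thesis
  proof (rule that[of h])
    show "0 \<le> h" using s(1) h by simp
    fix \<epsilon> :: real assume \<epsilon>: "0 < \<epsilon>"
    \<comment> \<open>Only two of the four bounds have a direct source: the upper one for \<mu> and
      the lower one for the universal measure. The almost inequality between the two measures
      carries each of them over to the other side.\<close>
    have 1: "AE \<omega> in \<mu>. eventually (\<lambda>n. ?m \<omega> n \<le> 2 powr (- (h - \<epsilon> / 2) * n)) sequentially"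
      by (rule s(2)) (use \<epsilon> h in simp)
    have 2: "AE \<omega> in \<mu>. eventually (\<lambda>n. ?n \<omega> n \<le> 2 powr ((\<epsilon> / 2) * n) * ?m \<omega> n) sequentially"
      using upper[of "\<epsilon> / 2"] \<epsilon> by simp
    have 3: "AE \<omega> in \<mu>. eventually (\<lambda>n. 2 powr (- (h + 6 * (\<epsilon> / 12)) * n) \<le> ?n \<omega> n) sequentially"
    proof (rule universal_measure_lower_bound[OF \<open>0 \<le> h\<close>])
      show "AE \<omega> in \<mu>. frequently (\<lambda>n. 2 powr (- (h + \<epsilon> / 12) * n) < ?m \<omega> n) sequentially"
        by (rule s(3)) (use h \<epsilon> in simp)
    qed (use \<epsilon> in simp)
    from 1 2 3 show "AE \<omega> in \<mu>. eventually (\<lambda>n.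
      ?m \<omega> n \<in> {2 powr (- (h + \<epsilon>) * n) .. 2 powr (- (h - \<epsilon>) * n)} \<and>
      ?n \<omega> n \<in> {2 powr (- (h + \<epsilon>) * n) .. 2 powr (- (h - \<epsilon>) * n)}) sequentially"
    proof eventually_elim
      case (elim \<omega>)
      then show ?case
      proof eventually_elim
        case (elim n)
        have a: "2 powr ((\<epsilon> / 2) * n) * 2 powr (- (h - \<epsilon> / 2) * n) = 2 powr (- (h - \<epsilon>) * n)"
          unfolding powr_add[symmetric] by (rule arg_cong[where f = "\<lambda>x. 2 powr x"]) (simp add: algebra_simps)
        have b: "2 powr (- (h + \<epsilon>) * n) = 2 powr (- (\<epsilon> / 2) * n) * 2 powr (- (h + 6 * (\<epsilon> / 12)) * n)"
          unfolding powr_add[symmetric] by (rule arg_cong[where f = "\<lambda>x. 2 powr x"]) (simp add: algebra_simps)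
        have le1: "2 powr (- (\<epsilon> / 2) * n) \<le> 1" using \<epsilon> powr_mono[of "- (\<epsilon> / 2) * n" 0 2] by simp
        have "?m \<omega> n \<le> 2 powr (- (h - \<epsilon>) * n)"
        proof -
          have "- (h - \<epsilon> / 2) * n \<le> - (h - \<epsilon>) * n" using \<epsilon> by (intro mult_right_mono) auto
          then have "2 powr (- (h - \<epsilon> / 2) * n) \<le> 2 powr (- (h - \<epsilon>) * n)" by simp
          then show ?thesis using elim(1) by linarith
        qed
        moreover have "?n \<omega> n \<le> 2 powr (- (h - \<epsilon>) * n)"
        proof -
          have "2 powr ((\<epsilon> / 2) * n) * ?m \<omega> n \<le> 2 powr ((\<epsilon> / 2) * n) * 2 powr (- (h - \<epsilon> / 2) * n)"
            using elim(1) by (intro mult_left_mono) auto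
          then show ?thesis using elim(2) a by linarith
        qed
        moreover have "2 powr (- (h + \<epsilon>) * n) \<le> ?n \<omega> n"
        proof -
          have "2 powr (- (h + \<epsilon>) * n) \<le> 1 * 2 powr (- (h + 6 * (\<epsilon> / 12)) * n)"
            unfolding b by (intro mult_right_mono le1) simp
          then show ?thesis using elim(3) by linarith
        qed
        moreover have "2 powr (- (h + \<epsilon>) * n) \<le> ?m \<omega> n"
        proof -
          have "2 powr (- (\<epsilon> / 2) * n) * 2 powr (- (h + 6 * (\<epsilon> / 12)) * n) \<le> 2 powr (- (\<epsilon> / 2) * n) * (2 powr ((\<epsilon> / 2) * n) * ?m \<omega> n)"
            using elim(2,3) by (intro mult_left_mono) auto
          also have "\<dots> = ?m \<omega> n"
            by (simp add: mult.assoc[symmetric] powr_add[symmetric])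
          finally show ?thesis unfolding b .
        qed
        ultimately show ?case by simp
      qed
    qed
  qed
qed

end

section \<open>Conformal iterated function systems\<close>

lemma norm_similitude:
  fixes L :: "(real^'n) \<Rightarrow>\<^sub>L (real^'n)"
  assumes "nonsingular_similitude L"
  shows "norm (blinfun_apply L v) = norm L * norm v"
proof -
  obtain c where c: "c > 0" "\<And>v. norm (blinfun_apply L v) = c * norm v"
    using assms unfolding nonsingular_similitude_def by blast
  obtain b :: "real^'n" where b: "b \<in> Basis" using nonempty_Basis by blast
  have "norm L \<le> c" using c by (intro norm_blinfun_bound) auto
  moreover have "c \<le> norm L" using norm_blinfun[of L b] c(2)[of b] b by simp
  ultimately show ?thesis using c(2) by simp
qed

text \<open>Segments between nearby points of \<open>V0\<close> may leave \<open>V0\<close>, so the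
  mean value estimate uses the derivative \<open>D'\<close> of the extension, which is continuous on
  the open set \<open>W\<close> and equals \<open>D\<close> on \<open>V0\<close>. Since
  \<open>D x\<close> is a similitude, the linear part has norm exactly
  \<open>norm (D x) * dist x y\<close>, which gives the lower estimate as well as the upper
  one.\<close>

lemma conformal_map_linearization:
  fixes f :: "real^'n \<Rightarrow> real^'n"
  assumes V0: "compact V0" and f: "conformal_map \<theta> V0 f D"
  shows "continuous_on V0 (\<lambda>x. norm (D x))"
    and "inj_on f V0"
    and "0 < \<tau> \<Longrightarrow> \<exists>\<delta>>0. \<forall>x\<in>V0. \<forall>y\<in>V0. dist x y < \<delta> \<longrightarrow>
      (norm (D x) - \<tau>) * dist x y \<le> dist (f x) (f y) \<and> dist (f x) (f y) \<le> (norm (D x) + \<tau>) * dist x y"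
proof -
  obtain W g where Wg: "open W" "V0 \<subseteq> W" "C1_diffeomorphism_of W g"
    "\<forall>x\<in>V0. g x = f x \<and> (g has_derivative blinfun_apply (D x)) (at x)"
    using f unfolding conformal_map_def by blast
  have sim: "nonsingular_similitude (D x)" if "x \<in> V0" for x
    using f that unfolding conformal_map_def by blast
  obtain D' where D': "\<And>x. x \<in> W \<Longrightarrow> (g has_derivative blinfun_apply (D' x)) (at x)" "continuous_on W D'"
    using Wg(3) unfolding C1_diffeomorphism_of_def C1_on_def by blast
  have DD': "D' x = D x" if "x \<in> V0" for x
  proof -
    have "blinfun_apply (D' x) = blinfun_apply (D x)"
      using D'(1) Wg(2,4) that by (intro has_derivative_unique[of g _ x]) auto
    then show ?thesis by (simp add: blinfun_apply_inject)
  qed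
  have "continuous_on V0 D'" using D'(2) Wg(2) by (rule continuous_on_subset)
  then have "continuous_on V0 D" using DD' continuous_on_cong[of V0 V0 D' D] by simp
  then show "continuous_on V0 (\<lambda>x. norm (D x))" by (rule continuous_on_norm)
  have "inj_on g W" using Wg(3) unfolding C1_diffeomorphism_of_def bij_betw_def by blast
  then have "inj_on g V0" using Wg(2) by (rule inj_on_subset)
  then show "inj_on f V0" using Wg(4) by (simp cong: inj_on_cong)
  assume \<tau>: "0 < \<tau>"
  \<comment> \<open>Balls on which \<open>D'\<close> stays within \<open>\<tau> / 2\<close> of its
    value at the centre; a Lebesgue number of this cover is a \<delta> that works for all of
    \<open>V0\<close>.\<close>
  define \<G> where "\<G> = {ball x e | x e. x \<in> V0 \<and> ball x e \<subseteq> W \<and> (\<forall>z\<in>ball x e. norm (D' z - D' x) < \<tau> / 2)}"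
  have "V0 \<subseteq> \<Union>\<G>"
  proof
    fix x assume x: "x \<in> V0"
    then have "x \<in> W" using Wg(2) by blast
    then obtain e1 where e1: "e1 > 0" "ball x e1 \<subseteq> W" using Wg(1) open_contains_ball by blast
    have "isCont D' x" using D'(2) Wg(1) \<open>x \<in> W\<close> by (simp add: continuous_on_eq_continuous_at)
    then obtain e2 where e2: "e2 > 0" "\<And>z. dist z x < e2 \<Longrightarrow> dist (D' z) (D' x) < \<tau> / 2"
      using \<tau> unfolding continuous_at_eps_delta by (metis half_gt_zero)
    have "ball x (min e1 e2) \<in> \<G>"
      unfolding \<G>_def using x e1 e2 by (intro CollectI exI[of _ x] exI[of _ "min e1 e2"]) (auto simp: dist_commute dist_norm)
    then show "x \<in> \<Union>\<G>" using e1 e2 by (auto intro!: bexI[of _ "ball x (min e1 e2)"])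
  qed
  moreover have "open G" if "G \<in> \<G>" for G using that unfolding \<G>_def by auto
  ultimately obtain \<delta> where \<delta>: "0 < \<delta>" "\<And>x. x \<in> V0 \<Longrightarrow> \<exists>G\<in>\<G>. ball x \<delta> \<subseteq> G"
    by (rule Heine_Borel_lemma[OF V0]) (assumption, rule that)
  have "(norm (D x) - \<tau>) * dist x y \<le> dist (f x) (f y) \<and> dist (f x) (f y) \<le> (norm (D x) + \<tau>) * dist x y"
    if x: "x \<in> V0" and y: "y \<in> V0" and d: "dist x y < \<delta>" for x y
  proof -
    obtain c e where ce: "ball x \<delta> \<subseteq> ball c e" "ball c e \<subseteq> W" "\<And>z. z \<in> ball c e \<Longrightarrow> norm (D' z - D' c) < \<tau> / 2"
      using \<delta>(2)[OF x] unfolding \<G>_def by blast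
    have "norm (g y - g x - blinfun_apply (D' x) (y - x)) \<le> norm (y - x) * \<tau>"
    proof (rule differentiable_bound_linearization[where S = "ball x \<delta>" and f' = "\<lambda>z. blinfun_apply (D' z)"])
      have xy: "x \<in> ball x \<delta>" "y \<in> ball x \<delta>" using \<delta>(1) d by auto
      show "x + t *\<^sub>R (y - x) \<in> ball x \<delta>" if t: "t \<in> {0..1}" for t
      proof -
        have "x + t *\<^sub>R (y - x) = (1 - t) *\<^sub>R x + t *\<^sub>R y" by (simp add: algebra_simps)
        then show ?thesis using convexD_alt[OF convex_ball xy] t by (simp only: atLeastAtMost_iff)
      qed
      show "(g has_derivative blinfun_apply (D' z)) (at z within ball x \<delta>)" if "z \<in> ball x \<delta>" for z
        by (rule has_derivative_at_withinI[OF D'(1)[OF subsetD[OF ce(2) subsetD[OF ce(1) that]]]])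
      show "onorm (blinfun_apply (D' z) - blinfun_apply (D' x)) \<le> \<tau>" if z: "z \<in> ball x \<delta>" for z
      proof -
        have "norm (D' z - D' x) \<le> norm (D' z - D' c) + norm (D' x - D' c)"
          using norm_triangle_ineq4[of "D' z - D' c" "D' x - D' c"] by simp
        also have "\<dots> \<le> \<tau>"
          using ce(3)[OF subsetD[OF ce(1) z]] ce(3)[OF subsetD[OF ce(1) xy(1)]] by linarith
        finally show ?thesis by (simp add: norm_blinfun.rep_eq minus_blinfun.rep_eq fun_diff_def)
      qed
    qed (use \<delta>(1) in simp)
    then have 1: "norm (f y - f x - blinfun_apply (D x) (y - x)) \<le> \<tau> * dist x y"
      using Wg(4) x y DD' by (simp add: dist_norm norm_minus_commute mult.commute)
    have 2: "norm (blinfun_apply (D x) (y - x)) = norm (D x) * dist x y"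
      using norm_similitude[OF sim[OF x]] by (simp add: dist_norm norm_minus_commute)
    have "\<bar>norm (f y - f x) - norm (blinfun_apply (D x) (y - x))\<bar> \<le> norm (f y - f x - blinfun_apply (D x) (y - x))"
      by (rule norm_triangle_ineq3)
    then have "\<bar>dist (f x) (f y) - norm (D x) * dist x y\<bar> \<le> \<tau> * dist x y"
      using 1 2 by (simp add: dist_norm norm_minus_commute)
    then show ?thesis by (simp add: algebra_simps abs_le_iff)
  qed
  then show "\<exists>\<delta>>0. \<forall>x\<in>V0. \<forall>y\<in>V0. dist x y < \<delta> \<longrightarrow>
      (norm (D x) - \<tau>) * dist x y \<le> dist (f x) (f y) \<and> dist (f x) (f y) \<le> (norm (D x) + \<tau>) * dist x y"
    using \<delta>(1) by blast
qed

text \<open>Here \<open>scale i x\<close> stands for the norm of the differential. By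
  \<open>near\<close> the maps are similarities up to a factor \<open>2 powr \<eta>\<close> at short
  range. At long range only the bound \<open>bilipschitz\<close> is available, which does not force
  contraction, because segments may leave \<open>V0\<close>.\<close>

locale separated_IFS =
  fixes V0 :: "(real^'n) set" and A :: "'i set" and f :: "'i \<Rightarrow> real^'n \<Rightarrow> real^'n"
    and scale :: "'i \<Rightarrow> real^'n \<Rightarrow> real" and a b \<kappa> :: real
  assumes compact_V0: "compact V0" and connected_V0: "connected V0" and V0_ne: "V0 \<noteq> {}"
    and finite_A: "finite A" and A_ne: "A \<noteq> {}"
    and maps: "\<And>i x. i \<in> A \<Longrightarrow> x \<in> V0 \<Longrightarrow> f i x \<in> V0"
    and ab: "0 < a" "b < 1" "a \<le> 1" "0 < b"
    and scale: "\<And>i x. i \<in> A \<Longrightarrow> x \<in> V0 \<Longrightarrow> a \<le> scale i x \<and> scale i x \<le> b"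
    and \<kappa>: "1 \<le> \<kappa>"
    and bilipschitz: "\<And>i x y. i \<in> A \<Longrightarrow> x \<in> V0 \<Longrightarrow> y \<in> V0 \<Longrightarrow>
      dist x y / \<kappa> \<le> dist (f i x) (f i y) \<and> dist (f i x) (f i y) \<le> \<kappa> * dist x y"
    and near: "\<And>\<eta>. 0 < \<eta> \<Longrightarrow> \<exists>\<delta>>0. \<forall>i\<in>A. \<forall>x\<in>V0. \<forall>y\<in>V0. dist x y < \<delta> \<longrightarrow>
      2 powr (- \<eta>) * scale i x * dist x y \<le> dist (f i x) (f i y) \<and>
      dist (f i x) (f i y) \<le> 2 powr \<eta> * scale i x * dist x y"
    and separated: "strong_separation V0 A f"

text \<open>Compactness makes the infinitesimal data uniform: the derivative norms attain their
  extreme values and so stay away from 0 and 1, and injectivity keeps the images of far pairs at a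
  positive distance.\<close>

lemma conformal_IFS_imp_separated:
  fixes V0 :: "(real^'n) set"
  assumes ifs: "conformal_IFS \<theta> V0 A f" and ssc: "strong_separation V0 A f" and A_ne: "A \<noteq> {}"
  shows "\<exists>scale a b \<kappa>. separated_IFS V0 A f scale a b \<kappa>"
proof -
  have V0: "V0 \<noteq> {}" "compact V0" "connected V0" and A: "finite A"
    using ifs unfolding conformal_IFS_def by auto
  obtain D where D: "\<And>i. i \<in> A \<Longrightarrow> conformal_map \<theta> V0 (f i) (D i)"
    "\<And>i x. i \<in> A \<Longrightarrow> x \<in> V0 \<Longrightarrow> 0 < norm (D i x) \<and> norm (D i x) < 1"
    using ifs unfolding conformal_IFS_def by metis
  note lin = conformal_map_linearization[OF V0(2) D(1)]
  define s where "s i x = norm (D i x)" for i x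
  have cont: "continuous_on V0 (s i)" if "i \<in> A" for i
    unfolding s_def by (rule lin(1)[OF that])
  have "\<exists>a>0. \<forall>x\<in>V0. a \<le> s i x" if i: "i \<in> A" for i
  proof -
    obtain x where "x \<in> V0" "\<forall>y\<in>V0. s i x \<le> s i y"
      using continuous_attains_inf[OF V0(2,1) cont[OF i]] by blast
    then show ?thesis using D(2)[OF i] by (intro exI[of _ "s i x"]) (simp add: s_def)
  qed
  then obtain a' where a': "\<And>i. i \<in> A \<Longrightarrow> 0 < a' i" "\<And>i x. i \<in> A \<Longrightarrow> x \<in> V0 \<Longrightarrow> a' i \<le> s i x" by metis
  have "\<exists>b. 0 < b \<and> b < 1 \<and> (\<forall>x\<in>V0. s i x \<le> b)" if i: "i \<in> A" for i
  proof -
    obtain x where "x \<in> V0" "\<forall>y\<in>V0. s i y \<le> s i x"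
      using continuous_attains_sup[OF V0(2,1) cont[OF i]] by blast
    then show ?thesis using D(2)[OF i] by (intro exI[of _ "s i x"]) (simp add: s_def)
  qed
  then obtain b' where b': "\<And>i. i \<in> A \<Longrightarrow> 0 < b' i \<and> b' i < 1" "\<And>i x. i \<in> A \<Longrightarrow> x \<in> V0 \<Longrightarrow> s i x \<le> b' i" by metis
  define a where "a = Min (a' ` A)"
  define b where "b = Max (b' ` A)"
  have a: "0 < a" using A A_ne a' by (simp add: a_def)
  have b: "0 < b" "b < 1" using A A_ne b' by (auto simp: b_def Max_gr_iff)
  have sab: "a \<le> s i x \<and> s i x \<le> b" if "i \<in> A" "x \<in> V0" for i x
  proof -
    have "a \<le> a' i" "b' i \<le> b" using A that by (auto simp: a_def b_def)
    then show ?thesis using a'(2) b'(2) that by (meson order_trans)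
  qed
  have "a \<le> 1" using sab A_ne V0(1) b by (meson all_not_in_conv less_imp_le order_trans)
  have close: "\<exists>\<delta>>0. \<forall>i\<in>A. \<forall>x\<in>V0. \<forall>y\<in>V0. dist x y < \<delta> \<longrightarrow>
      (s i x - \<tau>) * dist x y \<le> dist (f i x) (f i y) \<and> dist (f i x) (f i y) \<le> (s i x + \<tau>) * dist x y"
    if \<tau>: "0 < \<tau>" for \<tau>
  proof -
    obtain \<delta> where \<delta>: "\<And>i. i \<in> A \<Longrightarrow> 0 < \<delta> i" "\<And>i x y. i \<in> A \<Longrightarrow> x \<in> V0 \<Longrightarrow> y \<in> V0 \<Longrightarrow> dist x y < \<delta> i \<Longrightarrow>
      (s i x - \<tau>) * dist x y \<le> dist (f i x) (f i y) \<and> dist (f i x) (f i y) \<le> (s i x + \<tau>) * dist x y"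
      using lin(3)[OF _ \<tau>] unfolding s_def by metis
    show ?thesis
      using A A_ne \<delta> by (intro exI[of _ "Min (\<delta> ` A)"]) auto
  qed
  have near: "\<exists>\<delta>>0. \<forall>i\<in>A. \<forall>x\<in>V0. \<forall>y\<in>V0. dist x y < \<delta> \<longrightarrow>
      2 powr (- \<eta>) * s i x * dist x y \<le> dist (f i x) (f i y) \<and>
      dist (f i x) (f i y) \<le> 2 powr \<eta> * s i x * dist x y" if "0 < \<eta>" for \<eta> :: real
  proof -
    \<comment> \<open>An additive error of this size is a multiplicative error of at most
      \<open>2 powr \<eta>\<close>, because every \<open>s i x\<close> is at least
      \<open>a\<close>.\<close>
    define \<tau> where "\<tau> = a * min (1 - 2 powr (- \<eta>)) (2 powr \<eta> - 1)"
    have "2 powr (- \<eta>) < 1" "1 < 2 powr \<eta>"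
      using that by (auto simp: powr_minus inverse_less_1_iff)
    then have \<tau>: "0 < \<tau>" using a by (simp add: \<tau>_def)
    have "2 powr (- \<eta>) * s i x * dist x y \<le> (s i x - \<tau>) * dist x y \<and> (s i x + \<tau>) * dist x y \<le> 2 powr \<eta> * s i x * dist x y"
      if "i \<in> A" "x \<in> V0" for i x y
    proof -
      have "\<tau> \<le> s i x * (1 - 2 powr (- \<eta>))"
        unfolding \<tau>_def using sab[OF that] a \<open>2 powr (- \<eta>) < 1\<close> \<open>1 < 2 powr \<eta>\<close> by (intro mult_mono) auto
      moreover have "\<tau> \<le> s i x * (2 powr \<eta> - 1)"
        unfolding \<tau>_def using sab[OF that] a \<open>2 powr (- \<eta>) < 1\<close> \<open>1 < 2 powr \<eta>\<close> by (intro mult_mono) auto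
      ultimately show ?thesis
        by (intro conjI mult_right_mono) (auto simp: algebra_simps)
    qed
    then show ?thesis using close[OF \<tau>] by (meson order_trans)
  qed
  obtain \<delta> where \<delta>: "0 < \<delta>" "\<And>i x y. i \<in> A \<Longrightarrow> x \<in> V0 \<Longrightarrow> y \<in> V0 \<Longrightarrow> dist x y < \<delta> \<Longrightarrow>
      2 powr (- 1) * s i x * dist x y \<le> dist (f i x) (f i y) \<and>
      dist (f i x) (f i y) \<le> 2 powr 1 * s i x * dist x y"
    using near[of 1] by auto
  obtain d where d: "0 < d" "\<And>x y. x \<in> V0 \<Longrightarrow> y \<in> V0 \<Longrightarrow> dist x y \<le> d"
  proof -
    have "dist x y \<le> diameter V0 + 1" if "x \<in> V0" "y \<in> V0" for x y
      using diameter_bounded_bound[OF compact_imp_bounded[OF V0(2)] that] by simp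
    then show ?thesis
      using that[of "diameter V0 + 1"] diameter_ge_0[OF compact_imp_bounded[OF V0(2)]] by auto
  qed
  have fV: "f i x \<in> V0" if "i \<in> A" "x \<in> V0" for i x
    using D(1)[OF that(1)] that(2) unfolding conformal_map_def by blast
  have fcont: "continuous_on V0 (f i)" if "i \<in> A" for i
  proof (unfold continuous_on_iff, intro ballI allI impI)
    fix x e assume x: "x \<in> V0" and e: "(0::real) < e"
    have "dist (f i y) (f i x) < e" if y: "y \<in> V0" "dist y x < min \<delta> (e / 2)" for y
    proof -
      have "dist (f i y) (f i x) \<le> 2 * s i y * dist y x" using \<delta>(2)[OF \<open>i \<in> A\<close> y(1) x] y(2) by simp
      also have "\<dots> \<le> 2 * 1 * dist y x" using sab[OF \<open>i \<in> A\<close> y(1)] b by (intro mult_right_mono mult_left_mono) auto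
      finally show ?thesis using y(2) by simp
    qed
    then show "\<exists>d>0. \<forall>y\<in>V0. dist y x < d \<longrightarrow> dist (f i y) (f i x) < e"
      using \<delta>(1) e by (intro exI[of _ "min \<delta> (e / 2)"]) auto
  qed
  have "\<exists>c>0. \<forall>x\<in>V0. \<forall>y\<in>V0. \<delta> \<le> dist x y \<longrightarrow> c \<le> dist (f i x) (f i y)" if i: "i \<in> A" for i
  proof -
    \<comment> \<open>Pairs at distance at least \<delta> form a compact set without diagonal
      points, on which the distance of the images attains a positive minimum.\<close>
    define K where "K = (V0 \<times> V0) \<inter> {p. \<delta> \<le> dist (fst p) (snd p)}"
    have K: "compact K"
      unfolding K_def by (intro compact_Int_closed compact_Times V0 closed_Collect_le continuous_intros)
    have contK: "continuous_on K (\<lambda>p. dist (f i (fst p)) (f i (snd p)))"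
      by (intro continuous_on_dist continuous_on_compose2[OF fcont[OF i]] continuous_intros) (auto simp: K_def)
    show ?thesis
    proof (cases "K = {}")
      case True
      then show ?thesis by (intro exI[of _ 1]) (auto simp: K_def)
    next
      case False
      then obtain p where p: "p \<in> K" "\<And>q. q \<in> K \<Longrightarrow> dist (f i (fst p)) (f i (snd p)) \<le> dist (f i (fst q)) (f i (snd q))"
        using continuous_attains_inf[OF K _ contK] by blast
      have "fst p \<in> V0" "snd p \<in> V0" "fst p \<noteq> snd p" using p(1) \<delta>(1) by (auto simp: K_def)
      then have "0 < dist (f i (fst p)) (f i (snd p))" using inj_onD[OF lin(2)[OF i]] by auto
      then show ?thesis using p(2) by (intro exI[of _ "dist (f i (fst p)) (f i (snd p))"]) (auto simp: K_def)
    qed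
  qed
  then obtain c' where c': "\<And>i. i \<in> A \<Longrightarrow> 0 < c' i" "\<And>i x y. i \<in> A \<Longrightarrow> x \<in> V0 \<Longrightarrow> y \<in> V0 \<Longrightarrow> \<delta> \<le> dist x y \<Longrightarrow> c' i \<le> dist (f i x) (f i y)"
    by metis
  define c where "c = Min (c' ` A)"
  have c: "0 < c" "\<And>i x y. i \<in> A \<Longrightarrow> x \<in> V0 \<Longrightarrow> y \<in> V0 \<Longrightarrow> \<delta> \<le> dist x y \<Longrightarrow> c \<le> dist (f i x) (f i y)"
  proof -
    show "0 < c" using A A_ne c' by (simp add: c_def)
    fix i x y assume "i \<in> A" "x \<in> V0" "y \<in> V0" "\<delta> \<le> dist x y"
    then show "c \<le> dist (f i x) (f i y)" using c'(2)[of i x y] A by (auto simp: c_def intro: order_trans[OF Min_le])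
  qed
  \<comment> \<open>The entries \<open>2\<close> and \<open>2 / a\<close> serve pairs closer than
    \<delta>, where \<open>near\<close> with \<eta> equal to 1 applies; \<open>d / \<delta>\<close>
    and \<open>d / c\<close> serve the other pairs, whose images are at most \<open>d\<close> and at
    least \<open>c\<close> apart.\<close>
  define \<kappa> where "\<kappa> = max (max 2 (2 / a)) (max (d / \<delta>) (d / c))"
  have \<kappa>: "2 \<le> \<kappa>" "2 / a \<le> \<kappa>" "d / \<delta> \<le> \<kappa>" "d / c \<le> \<kappa>" by (simp_all add: \<kappa>_def)
  have bil: "dist x y / \<kappa> \<le> dist (f i x) (f i y) \<and> dist (f i x) (f i y) \<le> \<kappa> * dist x y"
    if i: "i \<in> A" and x: "x \<in> V0" and y: "y \<in> V0" for i x y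
  proof (cases "dist x y < \<delta>")
    case True
    note n = \<delta>(2)[OF i x y True]
    have "dist x y / \<kappa> \<le> dist x y / (2 / a)"
      using \<kappa>(1,2) a by (intro divide_left_mono) auto
    also have "\<dots> = 2 powr (- 1) * a * dist x y" by (simp add: powr_minus)
    also have "\<dots> \<le> 2 powr (- 1) * s i x * dist x y"
      using sab[OF i x] by (intro mult_right_mono mult_left_mono) auto
    finally have 1: "dist x y / \<kappa> \<le> dist (f i x) (f i y)" using n by linarith
    have "2 powr 1 * s i x * dist x y \<le> \<kappa> * dist x y"
    proof (rule mult_right_mono)
      have "2 powr 1 * s i x \<le> 2 * 1" using sab[OF i x] a b by (intro mult_mono) auto
      then show "2 powr 1 * s i x \<le> \<kappa>" using \<kappa>(1) by linarith
    qed simp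
    then show ?thesis using 1 n by linarith
  next
    case False
    then have fd: "\<delta> \<le> dist x y" by simp
    have "dist x y / \<kappa> \<le> d / (d / c)"
      using d c(1) \<kappa> x y by (intro frac_le) auto
    also have "\<dots> = c" using d(1) by simp
    also have "\<dots> \<le> dist (f i x) (f i y)" using c(2) i x y fd by blast
    finally have 1: "dist x y / \<kappa> \<le> dist (f i x) (f i y)" .
    have "dist (f i x) (f i y) \<le> d" using d fV i x y by blast
    also have "\<dots> = d / \<delta> * \<delta>" using \<delta>(1) by simp
    also have "\<dots> \<le> \<kappa> * dist x y" using \<kappa> fd \<delta>(1) by (intro mult_mono) auto
    finally show ?thesis using 1 by blast
  qed
  have "separated_IFS V0 A f s a b \<kappa>"
    by unfold_locales (use V0 A A_ne fV a b \<open>a \<le> 1\<close> sab \<kappa> bil near ssc in auto)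
  then show ?thesis by blast
qed

section \<open>Symbolic coding of the attractor\<close>

lemma compose_along_Suc_shift:
  "compose_along f \<omega> (Suc k) x = f (\<omega> 0) (compose_along f (left_shift \<omega>) k x)"
  by (induction k arbitrary: x) (simp_all add: left_shift_def)

lemma compose_along_add:
  "compose_along f \<omega> (k + m) x = compose_along f \<omega> k (compose_along f ((left_shift ^^ k) \<omega>) m x)"
  by (induction m arbitrary: x) (simp_all add: funpow_left_shift)

lemma compose_along_cong:
  "(\<And>i. i < k \<Longrightarrow> \<omega> i = \<omega>' i) \<Longrightarrow> compose_along f \<omega> k = compose_along f \<omega>' k"
  by (induction k) simp_all

lemma left_shift_in_code_space: "\<omega> \<in> space (code_space A) \<Longrightarrow> left_shift \<omega> \<in> space (code_space A)"
  by (simp add: space_code_space left_shift_def)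

lemma funpow_left_shift_in_code_space:
  "\<omega> \<in> space (code_space A) \<Longrightarrow> (left_shift ^^ n) \<omega> \<in> space (code_space A)"
  by (simp add: space_code_space funpow_left_shift)

context separated_IFS
begin

abbreviation "\<pi> \<equiv> natural_projection V0 f"

abbreviation "\<Omega> \<equiv> space (code_space A)"

lemma compose_along_in: "\<omega> \<in> \<Omega> \<Longrightarrow> x \<in> V0 \<Longrightarrow> compose_along f \<omega> k x \<in> V0"
  by (induction k arbitrary: x) (simp_all add: maps space_code_space)

text \<open>Since \<open>V0\<close> need not be convex, nor even path connected, the contraction is only local;
  it propagates along chains of small steps.\<close>

lemma contraction:
  "\<exists>K c. 0 < K \<and> 0 < c \<and> c < 1 \<and> (\<forall>\<omega>\<in>\<Omega>. \<forall>x\<in>V0. \<forall>y\<in>V0. \<forall>k.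
      dist (compose_along f \<omega> k x) (compose_along f \<omega> k y) \<le> K * c ^ k)"
proof -
  \<comment> \<open>Half of the contraction exponent is given up to the linearization error: for the
    \<eta> below, \<open>2 powr \<eta> * b\<close> is the square root of \<open>b\<close>.\<close>
  define c where "c = b powr (1 / 2)"
  have c: "0 < c" "c < 1" using ab by (auto simp: c_def powr_half_sqrt)
  define \<eta> where "\<eta> = - log 2 b / 2"
  have "0 < \<eta>" using ab by (simp add: \<eta>_def)
  have \<eta>c: "2 powr \<eta> * b = c"
  proof -
    have "2 powr \<eta> = b powr (- (1 / 2))"
      using ab powr_powr[of 2 "log 2 b" "- (1 / 2)"] by (simp add: \<eta>_def)
    then show ?thesis using ab powr_add[of b "- (1 / 2)" 1] by (simp add: c_def)
  qed
  obtain \<delta> where \<delta>: "0 < \<delta>" "\<And>i x y. i \<in> A \<Longrightarrow> x \<in> V0 \<Longrightarrow> y \<in> V0 \<Longrightarrow> dist x y < \<delta> \<Longrightarrow>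
      dist (f i x) (f i y) \<le> 2 powr \<eta> * scale i x * dist x y"
    using near[OF \<open>0 < \<eta>\<close>] by blast
  have step: "dist (f i x) (f i y) \<le> c * dist x y"
    if "i \<in> A" "x \<in> V0" "y \<in> V0" "dist x y < \<delta>" for i x y
  proof -
    have "2 powr \<eta> * scale i x * dist x y \<le> 2 powr \<eta> * b * dist x y"
      using scale[OF that(1,2)] by (intro mult_right_mono mult_left_mono) auto
    then show ?thesis using \<delta>(2)[OF that] \<eta>c by simp
  qed
  have local: "dist (compose_along f \<omega> k x) (compose_along f \<omega> k y) \<le> c ^ k * dist x y"
    if "\<omega> \<in> \<Omega>" and xy: "x \<in> V0" "y \<in> V0" "dist x y < \<delta>" for \<omega> x y k
    using that(1)
  proof (induction k arbitrary: \<omega>)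
    case (Suc k)
    let ?X = "compose_along f (left_shift \<omega>) k x" and ?Y = "compose_along f (left_shift \<omega>) k y"
    have s: "left_shift \<omega> \<in> \<Omega>" using Suc.prems by (rule left_shift_in_code_space)
    have XY: "?X \<in> V0" "?Y \<in> V0" using s xy by (auto intro: compose_along_in)
    have d: "dist ?X ?Y \<le> c ^ k * dist x y" by (rule Suc.IH[OF s])
    also have "\<dots> \<le> 1 * dist x y" using c by (intro mult_right_mono power_le_one) auto
    finally have "dist ?X ?Y < \<delta>" using xy(3) by simp
    then have "dist (f (\<omega> 0) ?X) (f (\<omega> 0) ?Y) \<le> c * dist ?X ?Y"
      using Suc.prems by (intro step XY) (auto simp: space_code_space)
    also have "\<dots> \<le> c * (c ^ k * dist x y)" using d c by (intro mult_left_mono) auto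
    finally show ?case by (simp only: compose_along_Suc_shift power_Suc mult.assoc)
  qed simp
  \<comment> \<open>An equivalence relation that holds between close points, so its classes are open
    and connectedness of \<open>V0\<close> leaves only one. The constant may still depend on the
    pair.\<close>
  define R where "R x y \<longleftrightarrow> (\<exists>K. \<forall>\<omega>\<in>\<Omega>. \<forall>k. dist (compose_along f \<omega> k x) (compose_along f \<omega> k y) \<le> K * c ^ k)" for x y
  have local_R: "R x y" if "x \<in> V0" "y \<in> V0" "dist x y < \<delta>" for x y
    unfolding R_def using local[OF _ that] by (intro exI[of _ "dist x y"]) (auto simp: mult.commute)
  have R_trans: "R x z" if R: "R x y" "R y z" for x y z
  proof -
    obtain K K' where K: "\<And>\<omega> k. \<omega> \<in> \<Omega> \<Longrightarrow> dist (compose_along f \<omega> k x) (compose_along f \<omega> k y) \<le> K * c ^ k"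
      and K': "\<And>\<omega> k. \<omega> \<in> \<Omega> \<Longrightarrow> dist (compose_along f \<omega> k y) (compose_along f \<omega> k z) \<le> K' * c ^ k"
      using R unfolding R_def by blast
    have "dist (compose_along f \<omega> k x) (compose_along f \<omega> k z) \<le> (K + K') * c ^ k" if "\<omega> \<in> \<Omega>" for \<omega> k
      using dist_triangle[of "compose_along f \<omega> k x" "compose_along f \<omega> k z" "compose_along f \<omega> k y"]
        K[OF that, of k] K'[OF that, of k] by (simp add: distrib_right)
    then show ?thesis unfolding R_def by blast
  qed
  have R_sym: "R y x" if "R x y" for x y
    using that by (simp add: R_def dist_commute)
  have R_all: "R x y" if "x \<in> V0" "y \<in> V0" for x y
  proof (rule connected_equivalence_relation[OF connected_V0 that])
    show "\<exists>T. openin (top_of_set V0) T \<and> a \<in> T \<and> (\<forall>x\<in>T. R a x)" if "a \<in> V0" for a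
    proof (intro exI conjI ballI)
      show "openin (top_of_set V0) (V0 \<inter> ball a \<delta>)" by (rule openin_open_Int) simp
      show "a \<in> V0 \<inter> ball a \<delta>" using that \<delta>(1) by simp
      show "R a x" if "x \<in> V0 \<inter> ball a \<delta>" for x using that \<open>a \<in> V0\<close> by (intro local_R) auto
    qed
  qed (blast intro: R_trans R_sym)+
  obtain x0 where x0: "x0 \<in> V0" using V0_ne by blast
  \<comment> \<open>A finite net of mesh \<delta> makes the constant uniform: first a local step to
    the net, then one of finitely many constants.\<close>
  have "V0 \<subseteq> (\<Union>x\<in>V0. ball x \<delta>)" using \<delta>(1) by auto
  then obtain F where F: "F \<subseteq> V0" "finite F" "V0 \<subseteq> (\<Union>x\<in>F. ball x \<delta>)"
    using compactE_image[OF compact_V0, of V0 "\<lambda>x. ball x \<delta>"] by (metis open_ball)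
  obtain L where L: "\<And>x \<omega> k. x \<in> F \<Longrightarrow> \<omega> \<in> \<Omega> \<Longrightarrow> dist (compose_along f \<omega> k x) (compose_along f \<omega> k x0) \<le> L x * c ^ k"
    using R_all[OF _ x0] F(1) unfolding R_def by (metis subsetD)
  define M where "M = \<delta> + (\<Sum>x\<in>F. \<bar>L x\<bar>)"
  have M: "dist (compose_along f \<omega> k x) (compose_along f \<omega> k x0) \<le> M * c ^ k" if w: "\<omega> \<in> \<Omega>" and x: "x \<in> V0" for \<omega> k x
  proof -
    obtain z where z: "z \<in> F" "dist z x < \<delta>" using F(3) x by auto
    have "dist (compose_along f \<omega> k x) (compose_along f \<omega> k x0) \<le>
        dist (compose_along f \<omega> k z) (compose_along f \<omega> k x) + dist (compose_along f \<omega> k z) (compose_along f \<omega> k x0)"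
      by (rule dist_triangle3)
    also have "\<dots> \<le> c ^ k * dist z x + L z * c ^ k"
      using z F(1) w x by (intro add_mono local L) auto
    also have "\<dots> \<le> c ^ k * \<delta> + (\<Sum>x\<in>F. \<bar>L x\<bar>) * c ^ k"
    proof (intro add_mono mult_left_mono mult_right_mono)
      have "L z \<le> \<bar>L z\<bar>" by simp
      also have "\<dots> \<le> (\<Sum>x\<in>F. \<bar>L x\<bar>)" by (rule member_le_sum[OF z(1) _ F(2)]) auto
      finally show "L z \<le> (\<Sum>x\<in>F. \<bar>L x\<bar>)" .
    qed (use z c in auto)
    finally show ?thesis by (simp add: M_def algebra_simps)
  qed
  have "0 < M" using \<delta>(1) by (simp add: M_def add_pos_nonneg sum_nonneg)
  show ?thesis
  proof (rule exI[of _ "2 * M"], rule exI[of _ c], intro conjI ballI allI)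
    fix \<omega> x y k assume "\<omega> \<in> \<Omega>" "x \<in> V0" "y \<in> V0"
    then show "dist (compose_along f \<omega> k x) (compose_along f \<omega> k y) \<le> 2 * M * c ^ k"
      using M[of \<omega> x k] M[of \<omega> y k] dist_triangle2[of "compose_along f \<omega> k x" "compose_along f \<omega> k y" "compose_along f \<omega> k x0"]
      by simp
  qed (use c \<open>0 < M\<close> in auto)
qed

text \<open>Later compositions share the first \<open>M\<close> outer maps and apply them to points
  of \<open>V0\<close>, so \<open>contraction\<close> makes the sequence Cauchy with a limit
  independent of \<open>x\<close>. This discharges the definite description in
  \<open>natural_projection\<close>.\<close>

lemma projection_limit:
  assumes \<omega>: "\<omega> \<in> \<Omega>"
  shows "\<pi> \<omega> \<in> V0" and "x \<in> V0 \<Longrightarrow> (\<lambda>k. compose_along f \<omega> k x) \<longlonglongrightarrow> \<pi> \<omega>"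
proof -
  obtain K c where Kc: "0 < K" "0 < c" "c < 1" and
    con: "\<And>\<omega> x y k. \<omega> \<in> \<Omega> \<Longrightarrow> x \<in> V0 \<Longrightarrow> y \<in> V0 \<Longrightarrow>
      dist (compose_along f \<omega> k x) (compose_along f \<omega> k y) \<le> K * c ^ k"
    using contraction by blast
  have Kc0: "(\<lambda>k. K * c ^ k) \<longlonglongrightarrow> 0"
    using Kc LIMSEQ_realpow_zero[of c] tendsto_mult_right_zero by auto
  obtain x0 where x0: "x0 \<in> V0" using V0_ne by blast
  let ?F = "\<lambda>k. compose_along f \<omega> k x0"
  have FV: "?F k \<in> V0" for k using \<omega> x0 by (rule compose_along_in)
  have "Cauchy ?F"
  proof (rule metric_CauchyI)
    fix e :: real assume "0 < e"
    then have "eventually (\<lambda>k. K * c ^ k < e / 2) sequentially"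
      using Kc0 by (intro order_tendstoD) auto
    then obtain M where M: "K * c ^ M < e / 2" unfolding eventually_sequentially by blast
    have "dist (?F M) (?F m) < e / 2" if "m \<ge> M" for m
    proof -
      have "?F m = compose_along f \<omega> M (compose_along f ((left_shift ^^ M) \<omega>) (m - M) x0)"
        using compose_along_add[of f \<omega> M "m - M" x0] that by simp
      then have "dist (?F M) (?F m) \<le> K * c ^ M"
        using con[OF \<omega> x0] compose_along_in[OF funpow_left_shift_in_code_space[OF \<omega>] x0] by simp
      then show ?thesis using M by simp
    qed
    then show "\<exists>M. \<forall>m\<ge>M. \<forall>n\<ge>M. dist (?F m) (?F n) < e"
      by (intro exI[of _ M]) (metis dist_commute dist_triangle_half_r)
  qed
  then obtain y where y: "?F \<longlonglongrightarrow> y" using Cauchy_convergent convergent_def by blast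
  have yV: "y \<in> V0"
    by (rule closed_sequentially[OF compact_imp_closed[OF compact_V0] FV y])
  have all: "(\<lambda>k. compose_along f \<omega> k x) \<longlonglongrightarrow> y" if x: "x \<in> V0" for x
  proof -
    have "(\<lambda>k. dist (compose_along f \<omega> k x) (?F k)) \<longlonglongrightarrow> 0"
      by (rule tendsto_sandwich[OF _ _ tendsto_const Kc0]) (use con[OF \<omega> x x0] in auto)
    moreover have "(\<lambda>k. dist (?F k) y) \<longlonglongrightarrow> 0"
      by (rule iffD1[OF tendsto_dist_iff y])
    ultimately have "(\<lambda>k. dist (compose_along f \<omega> k x) (?F k) + dist (?F k) y) \<longlonglongrightarrow> 0 + 0"
      by (rule tendsto_add)
    then have sum: "(\<lambda>k. dist (compose_along f \<omega> k x) (?F k) + dist (?F k) y) \<longlonglongrightarrow> 0"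
      unfolding add_0_right .
    have "(\<lambda>k. dist (compose_along f \<omega> k x) y) \<longlonglongrightarrow> 0"
      by (rule tendsto_sandwich[OF _ _ tendsto_const sum]) (auto simp: dist_triangle)
    then show ?thesis by (rule iffD2[OF tendsto_dist_iff])
  qed
  have "\<pi> \<omega> = y"
    unfolding natural_projection_def
  proof (rule the_equality)
    show "\<forall>x\<in>V0. (\<lambda>k. compose_along f \<omega> k x) \<longlonglongrightarrow> y" using all by blast
    fix z assume "\<forall>x\<in>V0. (\<lambda>k. compose_along f \<omega> k x) \<longlonglongrightarrow> z"
    then show "z = y" using x0 y LIMSEQ_unique by blast
  qed
  then show "\<pi> \<omega> \<in> V0" "x \<in> V0 \<Longrightarrow> (\<lambda>k. compose_along f \<omega> k x) \<longlonglongrightarrow> \<pi> \<omega>"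
    using yV all by auto
qed

lemma projection_step:
  assumes \<omega>: "\<omega> \<in> \<Omega>"
  shows "\<pi> \<omega> = f (\<omega> 0) (\<pi> (left_shift \<omega>))"
proof -
  obtain x0 where x0: "x0 \<in> V0" using V0_ne by blast
  have s: "left_shift \<omega> \<in> \<Omega>" using \<omega> by (rule left_shift_in_code_space)
  have i: "\<omega> 0 \<in> A" using \<omega> by (simp add: space_code_space)
  let ?X = "\<lambda>k. compose_along f (left_shift \<omega>) k x0"
  have "(\<lambda>k. dist (?X k) (\<pi> (left_shift \<omega>))) \<longlonglongrightarrow> 0"
    by (rule iffD1[OF tendsto_dist_iff projection_limit(2)[OF s x0]])
  then have 0: "(\<lambda>k. \<kappa> * dist (?X k) (\<pi> (left_shift \<omega>))) \<longlonglongrightarrow> 0"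
    by (rule tendsto_mult_right_zero)
  have "(\<lambda>k. dist (f (\<omega> 0) (?X k)) (f (\<omega> 0) (\<pi> (left_shift \<omega>)))) \<longlonglongrightarrow> 0"
    by (rule tendsto_sandwich[OF _ _ tendsto_const 0])
      (use bilipschitz[OF i compose_along_in[OF s x0] projection_limit(1)[OF s]] in auto)
  then have "(\<lambda>k. f (\<omega> 0) (?X k)) \<longlonglongrightarrow> f (\<omega> 0) (\<pi> (left_shift \<omega>))"
    by (rule iffD2[OF tendsto_dist_iff])
  moreover have "(\<lambda>k. f (\<omega> 0) (?X k)) \<longlonglongrightarrow> \<pi> \<omega>"
    using LIMSEQ_Suc[OF projection_limit(2)[OF \<omega> x0]] by (simp only: compose_along_Suc_shift)
  ultimately show ?thesis by (rule LIMSEQ_unique[symmetric])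
qed

lemma projection_compose:
  assumes \<omega>: "\<omega> \<in> \<Omega>"
  shows "\<pi> \<omega> = compose_along f \<omega> n (\<pi> ((left_shift ^^ n) \<omega>))"
proof (induction n)
  case (Suc n)
  have "\<pi> ((left_shift ^^ n) \<omega>) = f (\<omega> n) (\<pi> ((left_shift ^^ Suc n) \<omega>))"
    using projection_step[OF funpow_left_shift_in_code_space[OF \<omega>], of n]
    by (simp add: funpow_left_shift)
  then show ?case using Suc by simp
qed simp

lemma projection_close:
  "\<exists>K c. 0 < K \<and> 0 < c \<and> c < 1 \<and>
    (\<forall>\<omega>\<in>\<Omega>. \<forall>\<omega>'\<in>\<Omega>. \<forall>n. (\<forall>i<n. \<omega> i = \<omega>' i) \<longrightarrow> dist (\<pi> \<omega>) (\<pi> \<omega>') \<le> K * c ^ n)"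
proof -
  obtain K c where Kc: "0 < K" "0 < c" "c < 1" and
    con: "\<And>\<omega> x y k. \<omega> \<in> \<Omega> \<Longrightarrow> x \<in> V0 \<Longrightarrow> y \<in> V0 \<Longrightarrow>
      dist (compose_along f \<omega> k x) (compose_along f \<omega> k y) \<le> K * c ^ k"
    using contraction by blast
  show ?thesis
  proof (rule exI[of _ K], rule exI[of _ c], intro conjI ballI allI impI Kc)
    fix \<omega> \<omega>' n assume w: "\<omega> \<in> \<Omega>" "\<omega>' \<in> \<Omega>" "\<forall>i<n. \<omega> i = \<omega>' i"
    have "\<pi> \<omega>' = compose_along f \<omega> n (\<pi> ((left_shift ^^ n) \<omega>'))"
      using projection_compose[OF w(2), of n] compose_along_cong[of n \<omega> \<omega>'] w(3) by metis
    moreover have "\<pi> \<omega> = compose_along f \<omega> n (\<pi> ((left_shift ^^ n) \<omega>))"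
      by (rule projection_compose[OF w(1)])
    moreover have "dist (compose_along f \<omega> n (\<pi> ((left_shift ^^ n) \<omega>))) (compose_along f \<omega> n (\<pi> ((left_shift ^^ n) \<omega>'))) \<le> K * c ^ n"
      using w by (intro con projection_limit(1) funpow_left_shift_in_code_space)
    ultimately show "dist (\<pi> \<omega>) (\<pi> \<omega>') \<le> K * c ^ n" by metis
  qed
qed

text \<open>The projection is a pointwise limit of functions that depend on finitely many
  letters.\<close>

lemma projection_measurable: "\<pi> \<in> borel_measurable (code_space A)"
proof -
  obtain x0 where x0: "x0 \<in> V0" using V0_ne by blast
  define G where "G u = compose_along f (\<lambda>i. u ! i) (length u) x0" for u
  have G: "compose_along f \<omega> k x0 = G (prefix_word k \<omega>)" for \<omega> k
    unfolding G_def length_prefix_word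
    by (rule fun_cong[where x = x0], rule compose_along_cong) (simp add: prefix_word_def)
  show ?thesis
  proof (rule borel_measurable_LIMSEQ_metric)
    show "(\<lambda>\<omega>. G (prefix_word k \<omega>)) \<in> borel_measurable (code_space A)" for k
      using measurable_prefix_word[OF finite_A] by (rule measurable_compose) simp
    show "(\<lambda>k. G (prefix_word k \<omega>)) \<longlonglongrightarrow> \<pi> \<omega>" if "\<omega> \<in> \<Omega>" for \<omega>
      using projection_limit(2)[OF that x0] unfolding G .
  qed
qed

lemma projection_in_attractor: "\<omega> \<in> \<Omega> \<Longrightarrow> \<pi> \<omega> \<in> attractor V0 A f"
  by (simp add: attractor_def)

lemma attractor_subset: "attractor V0 A f \<subseteq> V0"
  by (auto simp: attractor_def projection_limit(1))

text \<open>Cylinders are basic open sets of a compact product of finite discrete spaces, and by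
  \<open>projection_close\<close> long ones have images of small diameter; so the attractor is a
  continuous image of a compact space.\<close>

lemma compact_attractor: "compact (attractor V0 A f)"
proof -
  define T where "T = product_topology (\<lambda>k::nat. discrete_topology A) UNIV"
  have top: "topspace T = \<Omega>" by (auto simp: T_def space_code_space PiE_def Pi_def extensional_def)
  have "compact_space T"
    unfolding T_def compact_space_product_topology using finite_A by (simp add: compact_space_discrete_topology)
  moreover have "continuous_map T euclidean \<pi>"
  proof -
    obtain K c where Kc: "0 < K" "0 < c" "c < 1" and
      close: "\<And>\<omega> \<omega>' n. \<omega> \<in> \<Omega> \<Longrightarrow> \<omega>' \<in> \<Omega> \<Longrightarrow> \<forall>i<n. \<omega> i = \<omega>' i \<Longrightarrow> dist (\<pi> \<omega>) (\<pi> \<omega>') \<le> K * c ^ n"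
      using projection_close by blast
    have "openin T {\<omega> \<in> \<Omega>. \<pi> \<omega> \<in> U}" if "open U" for U
      unfolding T_def openin_product_topology_alt
    proof
      fix \<omega> assume w: "\<omega> \<in> {\<omega> \<in> \<Omega>. \<pi> \<omega> \<in> U}"
      then obtain e where e: "0 < e" "ball (\<pi> \<omega>) e \<subseteq> U" using \<open>open U\<close> open_contains_ball by blast
      have "(\<lambda>k. K * c ^ k) \<longlonglongrightarrow> 0"
        using Kc LIMSEQ_realpow_zero[of c] tendsto_mult_right_zero by auto
      then have "eventually (\<lambda>k. K * c ^ k < e) sequentially" using e by (intro order_tendstoD)
      then obtain n where n: "K * c ^ n < e" unfolding eventually_sequentially by blast
      let ?B = "\<lambda>i. if i < n then {\<omega> i} else A"
      have "PiE UNIV ?B \<subseteq> {\<omega> \<in> \<Omega>. \<pi> \<omega> \<in> U}"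
      proof
        fix \<omega>' assume "\<omega>' \<in> PiE UNIV ?B"
        then have *: "\<omega>' i \<in> ?B i" for i by (auto simp: PiE_def Pi_def)
        have "\<omega>' \<in> \<Omega>"
          unfolding space_code_space
        proof (intro CollectI allI)
          show "\<omega>' k \<in> A" for k using *[of k] w by (auto simp: space_code_space split: if_splits)
        qed
        moreover have "\<omega> i = \<omega>' i" if "i < n" for i using *[of i] that by simp
        ultimately have "dist (\<pi> \<omega>) (\<pi> \<omega>') \<le> K * c ^ n" using w by (intro close) auto
        then show "\<omega>' \<in> {\<omega> \<in> \<Omega>. \<pi> \<omega> \<in> U}" using n e \<open>\<omega>' \<in> \<Omega>\<close> by auto
      qed
      moreover have "\<omega> \<in> PiE UNIV ?B" using w by (auto simp: space_code_space)
      moreover have "finite {i \<in> UNIV. ?B i \<noteq> topspace (discrete_topology A)}"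
        by (rule finite_subset[of _ "{..<n}"]) auto
      moreover have "\<forall>i\<in>UNIV. openin (discrete_topology A) (?B i)" using w by (auto simp: space_code_space)
      ultimately show "\<exists>U'. finite {i \<in> UNIV. U' i \<noteq> topspace (discrete_topology A)} \<and>
          (\<forall>i\<in>UNIV. openin (discrete_topology A) (U' i)) \<and> \<omega> \<in> PiE UNIV U' \<and> PiE UNIV U' \<subseteq> {\<omega> \<in> \<Omega>. \<pi> \<omega> \<in> U}"
        by (intro exI[of _ ?B]) simp
    qed
    then show ?thesis by (simp add: continuous_map_def top)
  qed
  ultimately have "compactin euclidean (\<pi> ` topspace T)"
    unfolding compact_space_def by (rule image_compactin)
  then show ?thesis by (simp add: top attractor_def)
qed

text \<open>Finitely many pairwise disjoint compact pieces keep a positive distance. Strong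
  separation enters the argument through this bound.\<close>

lemma gap:
  "\<exists>\<rho>>0. \<rho> \<le> 1 \<and> (\<forall>\<omega>\<in>\<Omega>. \<forall>\<omega>'\<in>\<Omega>. \<omega> 0 \<noteq> \<omega>' 0 \<longrightarrow> \<rho> \<le> dist (\<pi> \<omega>) (\<pi> \<omega>'))"
proof -
  let ?\<Lambda> = "attractor V0 A f"
  have cont: "continuous_on ?\<Lambda> (f i)" if "i \<in> A" for i
  proof (rule continuous_on_subset[OF _ attractor_subset], unfold continuous_on_iff, intro ballI allI impI)
    fix x e assume x: "x \<in> V0" and e: "(0::real) < e"
    have "dist (f i y) (f i x) < e" if y: "y \<in> V0" "dist y x < e / \<kappa>" for y
    proof -
      have "dist (f i y) (f i x) \<le> \<kappa> * dist y x" using bilipschitz[OF \<open>i \<in> A\<close> y(1) x] by blast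
      also have "\<dots> < \<kappa> * (e / \<kappa>)" using y(2) \<kappa> by (intro mult_strict_left_mono) auto
      also have "\<dots> = e" using \<kappa> by simp
      finally show ?thesis .
    qed
    then show "\<exists>d>0. \<forall>y\<in>V0. dist y x < d \<longrightarrow> dist (f i y) (f i x) < e"
      using e \<kappa> by (intro exI[of _ "e / \<kappa>"]) auto
  qed
  have "\<exists>d>0. \<forall>x\<in>f i ` ?\<Lambda>. \<forall>y\<in>f j ` ?\<Lambda>. d \<le> dist x y" if "i \<in> A" "j \<in> A" "i \<noteq> j" for i j
  proof (rule separate_compact_closed)
    show "compact (f i ` ?\<Lambda>)" by (rule compact_continuous_image[OF cont[OF that(1)] compact_attractor])
    show "closed (f j ` ?\<Lambda>)"
      by (rule compact_imp_closed[OF compact_continuous_image[OF cont[OF that(2)] compact_attractor]])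
    show "f i ` ?\<Lambda> \<inter> f j ` ?\<Lambda> = {}"
      using separated that unfolding strong_separation_def by (rule disjoint_family_onD)
  qed
  then obtain d where d: "\<And>i j. i \<in> A \<Longrightarrow> j \<in> A \<Longrightarrow> i \<noteq> j \<Longrightarrow> 0 < d i j"
    "\<And>i j x y. i \<in> A \<Longrightarrow> j \<in> A \<Longrightarrow> i \<noteq> j \<Longrightarrow> x \<in> f i ` ?\<Lambda> \<Longrightarrow> y \<in> f j ` ?\<Lambda> \<Longrightarrow> d i j \<le> dist x y"
    by metis
  \<comment> \<open>The extra element 1 keeps the minimum meaningful for a single letter and yields
    the bound by 1.\<close>
  define S where "S = insert 1 ((\<lambda>(i, j). d i j) ` {(i, j). i \<in> A \<and> j \<in> A \<and> i \<noteq> j})"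
  have "finite {(i, j). i \<in> A \<and> j \<in> A \<and> i \<noteq> j}"
    by (rule finite_subset[of _ "A \<times> A"]) (auto simp: finite_A)
  then have fin: "finite S" by (simp add: S_def)
  show ?thesis
  proof (intro exI[of _ "Min S"] conjI ballI impI)
    have "\<forall>s\<in>S. 0 < s" using d(1) by (auto simp: S_def)
    then show "0 < Min S" using fin by (subst Min_gr_iff) (auto simp: S_def)
    show "Min S \<le> 1" using fin by (simp add: S_def)
    fix \<omega> \<omega>' assume w: "\<omega> \<in> \<Omega>" "\<omega>' \<in> \<Omega>" "\<omega> 0 \<noteq> \<omega>' 0"
    have A: "\<omega> 0 \<in> A" "\<omega>' 0 \<in> A" using w by (auto simp: space_code_space)
    have "Min S \<le> d (\<omega> 0) (\<omega>' 0)" using fin A w(3) by (intro Min_le) (auto simp: S_def)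
    also have "\<dots> \<le> dist (\<pi> \<omega>) (\<pi> \<omega>')"
      using projection_step[OF w(1)] projection_step[OF w(2)] projection_in_attractor left_shift_in_code_space w
      by (intro d(2) A) auto
    finally show "Min S \<le> dist (\<pi> \<omega>) (\<pi> \<omega>')" .
  qed
qed

end

section \<open>Distortion, and cylinders versus balls\<close>

context separated_IFS
begin

text \<open>By the chain rule for similitudes this is the norm of the differential of
  \<open>compose_along f \<omega> n\<close> at the projection of the \<open>n\<close>-fold shift of
  \<omega>, when \<open>scale\<close> is the norm of the differentials.\<close>

definition derivative_product :: "nat \<Rightarrow> (nat \<Rightarrow> 'i) \<Rightarrow> real" where
  "derivative_product n \<omega> = (\<Prod>j<n. scale (\<omega> j) (\<pi> ((left_shift ^^ Suc j) \<omega>)))"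

lemma derivative_product_Suc_shift:
  "derivative_product (Suc n) \<omega> = scale (\<omega> 0) (\<pi> (left_shift \<omega>)) * derivative_product n (left_shift \<omega>)"
  unfolding derivative_product_def
  by (subst prod.lessThan_Suc_shift) (simp add: left_shift_def[of \<omega>, symmetric] funpow_swap1 o_def)

lemma derivative_product_Suc:
  "derivative_product (Suc n) \<omega> = derivative_product n \<omega> * scale (\<omega> n) (\<pi> ((left_shift ^^ Suc n) \<omega>))"
  by (simp add: derivative_product_def)

lemma scale_projection:
  "\<omega> \<in> \<Omega> \<Longrightarrow> a \<le> scale (\<omega> n) (\<pi> ((left_shift ^^ m) \<omega>)) \<and> scale (\<omega> n) (\<pi> ((left_shift ^^ m) \<omega>)) \<le> b"
  by (rule scale[OF _ projection_limit(1)[OF funpow_left_shift_in_code_space]]) (simp_all add: space_code_space)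

lemma derivative_product_bounds:
  assumes "\<omega> \<in> \<Omega>"
  shows "a ^ n \<le> derivative_product n \<omega>" "0 < derivative_product n \<omega>"
    "derivative_product (n + m) \<omega> \<le> derivative_product n \<omega> * b ^ m"
proof -
  show *: "a ^ n \<le> derivative_product n \<omega>" for n
  proof (induction n)
    case (Suc n)
    then show ?case using ab scale_projection[OF assms, of n "Suc n"]
      unfolding derivative_product_Suc power_Suc2 by (intro mult_mono) (auto intro: order_trans[of 0 "a ^ n"])
  qed (simp add: derivative_product_def)
  show pos: "0 < derivative_product n \<omega>" for n
    using less_le_trans[OF zero_less_power[OF ab(1)] *] .
  show "derivative_product (n + m) \<omega> \<le> derivative_product n \<omega> * b ^ m"
  proof (induction m)
    case (Suc m)
    have "derivative_product (n + Suc m) \<omega> = derivative_product (n + m) \<omega> * scale (\<omega> (n + m)) (\<pi> ((left_shift ^^ Suc (n + m)) \<omega>))"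
      unfolding add_Suc_right by (rule derivative_product_Suc)
    also have "\<dots> \<le> derivative_product (n + m) \<omega> * b"
      using scale_projection[OF assms, of "n + m" "Suc (n + m)"] pos[of "n + m"] by (intro mult_left_mono) auto
    also have "\<dots> \<le> derivative_product n \<omega> * b ^ m * b"
      using Suc ab by (intro mult_right_mono) auto
    finally show ?case by (simp add: ac_simps)
  qed simp
qed

text \<open>The extension of \<open>f i\<close> is not assumed to be \<open>C\<^sup>1\<^sup>+\<^sup>\<theta>\<close> off \<open>V0\<close>, so the distortion is only
  bounded up to a subexponential factor; this does not affect dimensions.\<close>

lemma distortion:
  assumes \<eta>: "0 < \<eta>"
  shows "\<exists>K\<ge>1. \<forall>n. \<forall>\<omega>\<in>\<Omega>. \<forall>\<omega>'\<in>\<Omega>. (\<forall>i<n. \<omega> i = \<omega>' i) \<longrightarrow>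
    dist (\<pi> \<omega>) (\<pi> \<omega>') \<le> K * 2 powr (\<eta> * n) * (derivative_product n \<omega> *
      dist (\<pi> ((left_shift ^^ n) \<omega>)) (\<pi> ((left_shift ^^ n) \<omega>'))) \<and>
    derivative_product n \<omega> * dist (\<pi> ((left_shift ^^ n) \<omega>)) (\<pi> ((left_shift ^^ n) \<omega>')) \<le>
      K * 2 powr (\<eta> * n) * dist (\<pi> \<omega>) (\<pi> \<omega>')"
proof -
  obtain \<delta> where \<delta>: "0 < \<delta>" "\<And>i x y. i \<in> A \<Longrightarrow> x \<in> V0 \<Longrightarrow> y \<in> V0 \<Longrightarrow> dist x y < \<delta> \<Longrightarrow>
      2 powr (- \<eta>) * scale i x * dist x y \<le> dist (f i x) (f i y) \<and>
      dist (f i x) (f i y) \<le> 2 powr \<eta> * scale i x * dist x y"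
    using near[OF \<eta>] by blast
  obtain K c where Kc: "0 < K" "0 < c" "c < 1" and
    close: "\<And>\<omega> \<omega>' n. \<omega> \<in> \<Omega> \<Longrightarrow> \<omega>' \<in> \<Omega> \<Longrightarrow> \<forall>i<n. \<omega> i = \<omega>' i \<Longrightarrow> dist (\<pi> \<omega>) (\<pi> \<omega>') \<le> K * c ^ n"
    using projection_close by blast
  have "(\<lambda>k. K * c ^ k) \<longlonglongrightarrow> 0"
    using Kc LIMSEQ_realpow_zero[of c] tendsto_mult_right_zero by auto
  then have "eventually (\<lambda>k. K * c ^ k < \<delta>) sequentially" using \<delta>(1) by (intro order_tendstoD)
  then obtain J where J: "\<And>n. n \<ge> J \<Longrightarrow> K * c ^ n < \<delta>" unfolding eventually_sequentially by blast
  \<comment> \<open>The bilipschitz constant measured against \<open>scale\<close>, which lies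
    between \<open>a\<close> and 1; it bounds the ratio of \<open>dist (f i x) (f i y)\<close> and
    \<open>scale i x * dist x y\<close> in both directions.\<close>
  define B where "B = \<kappa> / a"
  have B: "1 \<le> B" "\<kappa> \<le> B * a" using \<kappa> ab by (auto simp: B_def pos_le_divide_eq)
  define E where "E n = B ^ min n J * 2 powr (\<eta> * n)" for n
  \<comment> \<open>Here \<open>n\<close> counts the letters on which the shifted sequences are
    still known to agree. Only below \<open>J\<close> can the points be too far apart for
    \<open>near\<close>, so the crude factor \<open>B\<close> is paid at most \<open>J\<close>
    times.\<close>
  define e where "e n = (if n < J then B else 1) * 2 powr \<eta>" for n
  have E_Suc: "E (Suc n) = e n * E n" for n
  proof -
    have "2 powr (\<eta> * Suc n) = 2 powr \<eta> * 2 powr (\<eta> * n)" by (simp add: powr_add[symmetric] algebra_simps)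
    then show ?thesis by (auto simp: E_def e_def min_def not_less le_Suc_eq)
  qed
  have e_pos: "0 < e n" for n using B by (simp add: e_def)
  have E_pos: "0 < E n" for n using B by (simp add: E_def)
  have step: "dist (f i x) (f i y) \<le> e n * (scale i x * dist x y) \<and> scale i x * dist x y \<le> e n * dist (f i x) (f i y)"
    if i: "i \<in> A" and x: "x \<in> V0" and y: "y \<in> V0" and d: "dist x y \<le> K * c ^ n" for i x y n
  proof (cases "n < J")
    case True
    have s: "a \<le> scale i x" "scale i x \<le> 1" using scale[OF i x] ab by auto
    have e: "B \<le> e n" using True B \<eta> by (simp add: e_def ge_one_powr_ge_zero)
    have "dist (f i x) (f i y) \<le> \<kappa> * dist x y" using bilipschitz[OF i x y] by blast
    also have "\<dots> \<le> (B * scale i x) * dist x y"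
      using B s by (intro mult_right_mono) (auto intro: order_trans[OF B(2)] mult_left_mono)
    also have "\<dots> \<le> (e n * scale i x) * dist x y"
      using e s ab by (intro mult_right_mono) auto
    finally have 1: "dist (f i x) (f i y) \<le> e n * (scale i x * dist x y)" by (simp only: mult.assoc)
    have "scale i x * dist x y \<le> 1 * dist x y" using s by (intro mult_right_mono) auto
    also have "\<dots> \<le> \<kappa> * dist (f i x) (f i y)"
      using bilipschitz[OF i x y] \<kappa> by (simp add: pos_divide_le_eq mult.commute)
    also have "\<dots> \<le> e n * dist (f i x) (f i y)"
    proof (rule mult_right_mono)
      have "B * a \<le> B * 1" using B ab by (intro mult_left_mono) auto
      then show "\<kappa> \<le> e n" using B(2) e by linarith
    qed simp
    finally show ?thesis using 1 by blast
  next
    case False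
    then have "dist x y < \<delta>" using d J[of n] by simp
    note n = \<delta>(2)[OF i x y this]
    have e: "e n = 2 powr \<eta>" using False by (simp add: e_def)
    have "scale i x * dist x y = 2 powr \<eta> * (2 powr (- \<eta>) * scale i x * dist x y)"
      by (simp add: mult.assoc[symmetric] powr_add[symmetric])
    also have "\<dots> \<le> 2 powr \<eta> * dist (f i x) (f i y)" using n by (intro mult_left_mono) auto
    finally show ?thesis using n by (simp add: e mult.assoc)
  qed
  have main: "dist (\<pi> \<omega>) (\<pi> \<omega>') \<le> E n * (derivative_product n \<omega> * dist (\<pi> ((left_shift ^^ n) \<omega>)) (\<pi> ((left_shift ^^ n) \<omega>'))) \<and>
    derivative_product n \<omega> * dist (\<pi> ((left_shift ^^ n) \<omega>)) (\<pi> ((left_shift ^^ n) \<omega>')) \<le> E n * dist (\<pi> \<omega>) (\<pi> \<omega>')"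
    if "\<omega> \<in> \<Omega>" "\<omega>' \<in> \<Omega>" "\<forall>i<n. \<omega> i = \<omega>' i" for n \<omega> \<omega>'
    using that
  proof (induction n arbitrary: \<omega> \<omega>')
    case 0
    then show ?case by (simp add: E_def derivative_product_def)
  next
    case (Suc n)
    let ?u = "left_shift \<omega>" and ?v = "left_shift \<omega>'"
    let ?d = "dist (\<pi> ((left_shift ^^ Suc n) \<omega>)) (\<pi> ((left_shift ^^ Suc n) \<omega>'))"
    let ?s = "scale (\<omega> 0) (\<pi> ?u)"
    have uv: "?u \<in> \<Omega>" "?v \<in> \<Omega>" using Suc.prems by (auto intro: left_shift_in_code_space)
    have agree: "\<forall>i<n. ?u i = ?v i" using Suc.prems(3) by (simp add: left_shift_def)
    have w0: "\<omega> 0 = \<omega>' 0" using Suc.prems(3) by simp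
    have eqs: "\<pi> \<omega> = f (\<omega> 0) (\<pi> ?u)" "\<pi> \<omega>' = f (\<omega> 0) (\<pi> ?v)"
      using projection_step[OF Suc.prems(1)] projection_step[OF Suc.prems(2)] w0 by auto
    have st: "dist (\<pi> \<omega>) (\<pi> \<omega>') \<le> e n * (?s * dist (\<pi> ?u) (\<pi> ?v)) \<and> ?s * dist (\<pi> ?u) (\<pi> ?v) \<le> e n * dist (\<pi> \<omega>) (\<pi> \<omega>')"
      unfolding eqs using Suc.prems(1) uv close[OF uv agree]
      by (intro step) (auto simp: space_code_space[of A] intro: projection_limit(1))
    have s: "0 \<le> ?s" using scale_projection[OF Suc.prems(1), of 0 1] ab by simp
    have d': "dist (\<pi> ((left_shift ^^ n) ?u)) (\<pi> ((left_shift ^^ n) ?v)) = ?d"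
      by (simp add: funpow_swap1)
    have IH': "dist (\<pi> ?u) (\<pi> ?v) \<le> E n * (derivative_product n ?u * ?d)"
      "derivative_product n ?u * ?d \<le> E n * dist (\<pi> ?u) (\<pi> ?v)"
      using Suc.IH[OF uv agree] unfolding d' by auto
    have "dist (\<pi> \<omega>) (\<pi> \<omega>') \<le> e n * (?s * dist (\<pi> ?u) (\<pi> ?v))" using st by blast
    also have "\<dots> \<le> e n * (?s * (E n * (derivative_product n ?u * ?d)))"
      using e_pos[of n] s IH'(1) by (intro mult_left_mono) auto
    also have "\<dots> = E (Suc n) * (derivative_product (Suc n) \<omega> * ?d)"
      unfolding E_Suc derivative_product_Suc_shift by (simp only: ac_simps)
    finally have 1: "dist (\<pi> \<omega>) (\<pi> \<omega>') \<le> E (Suc n) * (derivative_product (Suc n) \<omega> * ?d)" .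
    have "derivative_product (Suc n) \<omega> * ?d = ?s * (derivative_product n ?u * ?d)"
      unfolding derivative_product_Suc_shift by (simp only: ac_simps)
    also have "\<dots> \<le> ?s * (E n * dist (\<pi> ?u) (\<pi> ?v))" using s IH'(2) by (intro mult_left_mono)
    also have "\<dots> = E n * (?s * dist (\<pi> ?u) (\<pi> ?v))" by (simp only: ac_simps)
    also have "\<dots> \<le> E n * (e n * dist (\<pi> \<omega>) (\<pi> \<omega>'))" using st E_pos[of n] by (intro mult_left_mono) auto
    also have "\<dots> = E (Suc n) * dist (\<pi> \<omega>) (\<pi> \<omega>')" unfolding E_Suc by (simp only: ac_simps)
    finally show ?case using 1 by blast
  qed
  have E_le: "E n \<le> B ^ J * 2 powr (\<eta> * n)" for n
    unfolding E_def using B by (intro mult_right_mono power_increasing) auto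
  show ?thesis
  proof (intro exI[of _ "B ^ J"] conjI allI ballI impI)
    show "1 \<le> B ^ J" using B by (intro one_le_power)
    fix n \<omega> \<omega>' assume w: "\<omega> \<in> \<Omega>" "\<omega>' \<in> \<Omega>" "\<forall>i<n. \<omega> i = \<omega>' i"
    let ?q = "derivative_product n \<omega> * dist (\<pi> ((left_shift ^^ n) \<omega>)) (\<pi> ((left_shift ^^ n) \<omega>'))"
    have "0 \<le> ?q" using derivative_product_bounds(2)[OF w(1), of n] by simp
    then have "E n * ?q \<le> B ^ J * 2 powr (\<eta> * n) * ?q" by (intro mult_right_mono E_le)
    then show "dist (\<pi> \<omega>) (\<pi> \<omega>') \<le> B ^ J * 2 powr (\<eta> * n) * ?q" using main[OF w] by linarith
    have "E n * dist (\<pi> \<omega>) (\<pi> \<omega>') \<le> B ^ J * 2 powr (\<eta> * n) * dist (\<pi> \<omega>) (\<pi> \<omega>')"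
      by (intro mult_right_mono E_le) simp
    then show "?q \<le> B ^ J * 2 powr (\<eta> * n) * dist (\<pi> \<omega>) (\<pi> \<omega>')" using main[OF w] by linarith
  qed
qed

text \<open>The reference length is the first one at which the derivative product falls to the
  radius. Changing it by a small multiple of \<open>k\<close> letters compensates the distortion in
  both directions. The inner radius is one eighth of the outer one because this is the ratio in the
  Vitali covering argument.\<close>

lemma ball_cylinder:
  "\<exists>B>0. \<forall>\<epsilon>>0. \<exists>k0. \<forall>k\<ge>k0. \<forall>\<omega>\<in>\<Omega>. \<exists>n m. real m \<le> n + \<epsilon> * k \<and> real n \<le> m \<and> real k \<le> B * n \<and> real n \<le> B * k \<and>
    (\<forall>\<omega>'\<in>\<Omega>. dist (\<pi> \<omega>) (\<pi> \<omega>') < (1 / 2) ^ k \<longrightarrow> (\<forall>i<n. \<omega> i = \<omega>' i)) \<and>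
    (\<forall>\<omega>'\<in>\<Omega>. (\<forall>i<m. \<omega> i = \<omega>' i) \<longrightarrow> dist (\<pi> \<omega>) (\<pi> \<omega>') < (1 / 2) ^ (k + 3))"
proof -
  obtain K0 c where Kc: "0 < K0" "0 < c" "c < 1" and
    close: "\<And>\<omega> \<omega>' n. \<omega> \<in> \<Omega> \<Longrightarrow> \<omega>' \<in> \<Omega> \<Longrightarrow> \<forall>i<n. \<omega> i = \<omega>' i \<Longrightarrow> dist (\<pi> \<omega>) (\<pi> \<omega>') \<le> K0 * c ^ n"
    using projection_close by blast
  have diam: "dist (\<pi> \<omega>) (\<pi> \<omega>') \<le> K0" if "\<omega> \<in> \<Omega>" "\<omega>' \<in> \<Omega>" for \<omega> \<omega>'
    using close[OF that, of 0] by simp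
  obtain \<rho> where \<rho>: "0 < \<rho>" "\<rho> \<le> 1" "\<And>\<omega> \<omega>'. \<omega> \<in> \<Omega> \<Longrightarrow> \<omega>' \<in> \<Omega> \<Longrightarrow> \<omega> 0 \<noteq> \<omega>' 0 \<Longrightarrow> \<rho> \<le> dist (\<pi> \<omega>) (\<pi> \<omega>')"
    using gap by blast
  have "a \<le> b"
  proof -
    obtain i x where "i \<in> A" "x \<in> V0" using A_ne V0_ne by blast
    then show ?thesis using scale[of i x] by simp
  qed
  define la where "la = - log 2 a"
  define lb where "lb = - log 2 b"
  have la: "0 < la" using ab \<open>a \<le> b\<close> by (simp add: la_def)
  have lb: "0 < lb" using ab by (simp add: lb_def)
  have apow: "a ^ n = 2 powr (- la * n)" and bpow: "b ^ n = 2 powr (- lb * n)" for n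
    using ab by (simp_all add: la_def lb_def powr_powr[symmetric] powr_realpow)
  have half: "(1 / 2 :: real) ^ k = 2 powr (- real k)" for k
    by (simp add: powr_minus powr_realpow power_one_over inverse_eq_divide)
  define B0 where "B0 = 1 / lb + 1"
  have B0: "0 < B0" using lb by (simp add: B0_def add_pos_pos)
  show ?thesis
  proof (intro exI[of _ "max (2 * la) B0"] conjI allI impI)
    show "0 < max (2 * la) B0" using B0 by simp
    fix \<epsilon>' :: real assume \<epsilon>': "0 < \<epsilon>'"
    \<comment> \<open>The cap \<open>1 / la\<close> keeps the sacrificed letters below half of
      \<open>n\<close>, so that \<open>n - P\<close> is still comparable to
      \<open>k\<close>.\<close>
    define \<epsilon> where "\<epsilon> = min \<epsilon>' (1 / la)"
    have \<epsilon>: "0 < \<epsilon>" "\<epsilon> \<le> \<epsilon>'" "\<epsilon> * la \<le> 1" using \<epsilon>' la by (auto simp: \<epsilon>_def min_def field_simps)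
    \<comment> \<open>The bound \<open>lb / 2\<close> lets the contraction over the \<open>P\<close>
      extra letters win against the distortion over them. The other bound keeps \<open>P\<close>
      small: it has to outweigh the distortion over up to \<open>B0 * k\<close> letters.\<close>
    define \<eta> where "\<eta> = min (lb / 2) (\<epsilon> * lb / (8 * B0))"
    have \<eta>: "0 < \<eta>" "\<eta> \<le> lb / 2" "\<eta> * B0 \<le> \<epsilon> * lb / 8"
    proof -
      show "0 < \<eta>" "\<eta> \<le> lb / 2" using \<epsilon> lb B0 by (auto simp: \<eta>_def)
      have "\<eta> * B0 \<le> \<epsilon> * lb / (8 * B0) * B0" using B0 by (intro mult_right_mono) (auto simp: \<eta>_def)
      then show "\<eta> * B0 \<le> \<epsilon> * lb / 8" using B0 by simp
    qed
    obtain K where K: "1 \<le> K"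
      "\<And>n \<omega> \<omega>'. \<omega> \<in> \<Omega> \<Longrightarrow> \<omega>' \<in> \<Omega> \<Longrightarrow> \<forall>i<n. \<omega> i = \<omega>' i \<Longrightarrow>
        dist (\<pi> \<omega>) (\<pi> \<omega>') \<le> K * 2 powr (\<eta> * n) * (derivative_product n \<omega> * dist (\<pi> ((left_shift ^^ n) \<omega>)) (\<pi> ((left_shift ^^ n) \<omega>')))"
      "\<And>n \<omega> \<omega>'. \<omega> \<in> \<Omega> \<Longrightarrow> \<omega>' \<in> \<Omega> \<Longrightarrow> \<forall>i<n. \<omega> i = \<omega>' i \<Longrightarrow>
        derivative_product n \<omega> * dist (\<pi> ((left_shift ^^ n) \<omega>)) (\<pi> ((left_shift ^^ n) \<omega>')) \<le> K * 2 powr (\<eta> * n) * dist (\<pi> \<omega>) (\<pi> \<omega>')"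
      using distortion[OF \<eta>(1)] by blast
    \<comment> \<open>Collects the constants: distortion against the gap \<rho>, distortion against
      the diameter bound \<open>K0\<close>, and three binary digits for the smaller radius.\<close>
    define C where "C = max 0 (max (log 2 (K / \<rho>)) (log 2 (K * K0) + 3))"
    have C: "0 \<le> C" "log 2 (K / \<rho>) \<le> C" "log 2 (K * K0) + 3 \<le> C" by (simp_all add: C_def)
    have KC: "K / \<rho> \<le> 2 powr C"
      using C(2) K(1) \<rho>(1) by (subst (asm) log_le_iff) auto
    have KC': "K * K0 \<le> 2 powr (C - 3)"
    proof -
      have "log 2 (K * K0) \<le> C - 3" using C(3) by simp
      then show ?thesis using K(1) Kc by (subst (asm) log_le_iff) auto
    qed
    define k0 where "k0 = nat \<lceil>4 * (2 * C / lb + 2) / \<epsilon>\<rceil> + 1"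
    show "\<exists>k0. \<forall>k\<ge>k0. \<forall>\<omega>\<in>\<Omega>. \<exists>n m. real m \<le> n + \<epsilon>' * k \<and> real n \<le> m \<and> real k \<le> max (2 * la) B0 * n \<and> real n \<le> max (2 * la) B0 * k \<and>
      (\<forall>\<omega>'\<in>\<Omega>. dist (\<pi> \<omega>) (\<pi> \<omega>') < (1 / 2) ^ k \<longrightarrow> (\<forall>i<n. \<omega> i = \<omega>' i)) \<and>
      (\<forall>\<omega>'\<in>\<Omega>. (\<forall>i<m. \<omega> i = \<omega>' i) \<longrightarrow> dist (\<pi> \<omega>) (\<pi> \<omega>') < (1 / 2) ^ (k + 3))"
    proof (rule exI[of _ k0], intro allI impI ballI)
      fix k \<omega> assume k: "k0 \<le> k" and \<omega>: "\<omega> \<in> \<Omega>"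
      have k1: "1 \<le> real k" using k by (simp add: k0_def)
      have "4 * (2 * C / lb + 2) / \<epsilon> \<le> real k" using k unfolding k0_def by linarith
      then have kC: "2 * C / lb + 2 \<le> \<epsilon> * k / 4"
        using \<epsilon>(1) by (simp add: pos_divide_le_eq mult.commute)
      \<comment> \<open>Enough letters for \<open>lb * P\<close> to exceed twice the accumulated
        loss; in the second inclusion one half is used up by the distortion over the
        \<open>P\<close> letters themselves.\<close>
      define P where "P = nat \<lceil>2 * (\<eta> * (B0 * k) + C) / lb\<rceil> + 1"
      have "0 \<le> 2 * (\<eta> * (B0 * k) + C) / lb" using \<eta>(1) B0 C(1) lb by simp
      then have P1: "2 * (\<eta> * (B0 * k) + C) / lb < P" "P \<le> 2 * (\<eta> * (B0 * k) + C) / lb + 2"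
        unfolding P_def by linarith+
      have P_lb: "2 * (\<eta> * (B0 * k) + C) < lb * P"
        using P1(1) lb by (simp add: pos_divide_less_eq mult.commute)
      have P_le: "P \<le> \<epsilon> * k / 2"
      proof -
        have "\<eta> * (B0 * k) \<le> \<epsilon> * lb / 8 * k" using mult_right_mono[OF \<eta>(3), of k] by (simp add: mult.assoc)
        then have "2 * (\<eta> * (B0 * k) + C) / lb \<le> 2 * (\<epsilon> * lb / 8 * k + C) / lb"
          using lb by (intro divide_right_mono) auto
        also have "\<dots> = \<epsilon> * k / 4 + 2 * C / lb" using lb by (simp add: field_simps)
        finally show ?thesis using P1(2) kC by linarith
      qed
      let ?L = "\<lambda>n. derivative_product n \<omega>"
      have L_upper: "?L n \<le> 2 powr (- lb * n)" for n
        using derivative_product_bounds(3)[OF \<omega>, of 0 n] by (simp add: derivative_product_def bpow)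
      have L_lower: "2 powr (- la * n) \<le> ?L n" for n
        using derivative_product_bounds(1)[OF \<omega>, of n] by (simp add: apow)
      have L_pos: "0 < ?L n" for n using \<omega> by (rule derivative_product_bounds)
      have ex: "\<exists>n. ?L n \<le> (1 / 2) ^ k"
      proof -
        have "real k / lb \<le> nat \<lceil>k / lb\<rceil>" by (rule real_nat_ceiling_ge)
        then have "real k \<le> lb * nat \<lceil>k / lb\<rceil>" unfolding pos_divide_le_eq[OF lb] by (simp only: mult.commute)
        then have "2 powr (- lb * nat \<lceil>k / lb\<rceil>) \<le> 2 powr (- real k)" by simp
        then show ?thesis using L_upper[of "nat \<lceil>k / lb\<rceil>"] unfolding half by (meson order_trans)
      qed
      define n where "n = (LEAST n. ?L n \<le> (1 / 2) ^ k)"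
      have Ln: "?L n \<le> (1 / 2) ^ k" unfolding n_def using ex by (rule LeastI_ex)
      have Lless: "(1 / 2) ^ k < ?L j" if "j < n" for j
        using not_less_Least[of j "\<lambda>n. ?L n \<le> (1 / 2) ^ k"] that unfolding n_def by (simp add: not_le)
      have n_ge: "k \<le> la * n"
      proof -
        have "2 powr (- la * n) \<le> 2 powr (- real k)" using L_lower[of n] Ln unfolding half by linarith
        then show ?thesis by simp
      qed
      have n_le: "n \<le> B0 * k"
      proof (cases n)
        case 0
        then show ?thesis using B0 by simp
      next
        case (Suc j)
        then have "2 powr (- real k) < 2 powr (- lb * j)" using less_le_trans[OF Lless[of j] L_upper[of j]] unfolding half by simp
        then have "lb * j < k" by simp
        then have "real j < k / lb" using lb by (simp add: pos_less_divide_eq mult.commute)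
        then have "real n \<le> k / lb + 1" using Suc by simp
        also have "\<dots> \<le> B0 * k" using k1 by (simp add: B0_def algebra_simps)
        finally show ?thesis .
      qed
      have \<eta>n: "\<eta> * n \<le> \<eta> * (B0 * k)" using n_le \<eta>(1) by (intro mult_left_mono) auto
      show "\<exists>n m. real m \<le> n + \<epsilon>' * k \<and> real n \<le> m \<and> real k \<le> max (2 * la) B0 * n \<and> real n \<le> max (2 * la) B0 * k \<and>
        (\<forall>\<omega>'\<in>\<Omega>. dist (\<pi> \<omega>) (\<pi> \<omega>') < (1 / 2) ^ k \<longrightarrow> (\<forall>i<n. \<omega> i = \<omega>' i)) \<and>
        (\<forall>\<omega>'\<in>\<Omega>. (\<forall>i<m. \<omega> i = \<omega>' i) \<longrightarrow> dist (\<pi> \<omega>) (\<pi> \<omega>') < (1 / 2) ^ (k + 3))"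
      proof (rule exI[of _ "n - P"], rule exI[of _ "n + P"], intro conjI ballI impI)
        have "\<epsilon> * k \<le> \<epsilon>' * k" using \<epsilon> by (intro mult_right_mono) auto
        then show "real (n + P) \<le> real (n - P) + \<epsilon>' * k" using P_le by linarith
        show "real (n - P) \<le> real (n + P)" by simp
        have "n - P \<ge> real n - \<epsilon> * k / 2" using P_le by linarith
        then have "la * (real n - \<epsilon> * k / 2) \<le> la * (n - P)" using la by (intro mult_left_mono) auto
        moreover have "la * (\<epsilon> * k / 2) \<le> k / 2" using mult_right_mono[OF \<epsilon>(3), of k] by (simp add: ac_simps)
        ultimately have "real k \<le> 2 * la * (n - P)" using n_ge by (simp add: right_diff_distrib)
        also have "\<dots> \<le> max (2 * la) B0 * (n - P)" by (intro mult_right_mono) auto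
        finally show "real k \<le> max (2 * la) B0 * (n - P)" .
        have "real (n - P) \<le> B0 * k" using n_le by linarith
        also have "\<dots> \<le> max (2 * la) B0 * k" by (intro mult_right_mono) auto
        finally show "real (n - P) \<le> max (2 * la) B0 * k" .
      next
        fix \<omega>' assume \<omega>': "\<omega>' \<in> \<Omega>" and d: "dist (\<pi> \<omega>) (\<pi> \<omega>') < (1 / 2) ^ k"
        \<comment> \<open>At the first disagreement \<open>j\<close> the shifted points are at least
          \<rho> apart, so closeness of the projections forces the derivative product at
          \<open>j\<close> to be almost \<open>(1 / 2) ^ k\<close> already; \<open>P\<close> more
          letters would push it below, against the minimality of \<open>n\<close>.\<close>
        show "\<forall>i<n - P. \<omega> i = \<omega>' i"
        proof (rule ccontr)
          assume "\<not> (\<forall>i<n - P. \<omega> i = \<omega>' i)"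
          then obtain i where i: "i < n - P" "\<omega> i \<noteq> \<omega>' i" by blast
          define j where "j = (LEAST j. \<omega> j \<noteq> \<omega>' j)"
          have j: "\<omega> j \<noteq> \<omega>' j" "j \<le> i" "\<forall>i<j. \<omega> i = \<omega>' i"
            unfolding j_def using LeastI[of "\<lambda>j. \<omega> j \<noteq> \<omega>' j", OF i(2)]
              Least_le[of "\<lambda>j. \<omega> j \<noteq> \<omega>' j", OF i(2)] not_less_Least[of _ "\<lambda>j. \<omega> j \<noteq> \<omega>' j"] by blast+
          have jP: "j + P < n" using j(2) i(1) by simp
          have "\<rho> \<le> dist (\<pi> ((left_shift ^^ j) \<omega>)) (\<pi> ((left_shift ^^ j) \<omega>'))"
            using \<omega> \<omega>' j(1) by (intro \<rho>(3) funpow_left_shift_in_code_space) (simp_all add: funpow_left_shift)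
          then have "?L j * \<rho> \<le> ?L j * dist (\<pi> ((left_shift ^^ j) \<omega>)) (\<pi> ((left_shift ^^ j) \<omega>'))"
            using L_pos[of j] by (intro mult_left_mono) auto
          also have "\<dots> \<le> K * 2 powr (\<eta> * j) * dist (\<pi> \<omega>) (\<pi> \<omega>')" using \<omega> \<omega>' j(3) by (rule K(3))
          also have "\<dots> \<le> K * 2 powr (\<eta> * j) * (1 / 2) ^ k" using d K(1) by (intro mult_left_mono) auto
          finally have "?L j \<le> K / \<rho> * 2 powr (\<eta> * j) * (1 / 2) ^ k"
            using \<rho>(1) by (simp add: pos_le_divide_eq)
          also have "\<dots> \<le> 2 powr C * 2 powr (\<eta> * j) * (1 / 2) ^ k"
            using KC by (intro mult_right_mono) auto
          finally have Lj: "?L j \<le> 2 powr (C + \<eta> * j - k)"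
            unfolding half by (simp add: powr_add powr_diff powr_minus field_simps)
          have "2 powr (- real k) < ?L (j + P)" using Lless[OF jP] unfolding half .
          also have "\<dots> \<le> ?L j * 2 powr (- lb * P)"
            using derivative_product_bounds(3)[OF \<omega>, of j P] unfolding bpow .
          also have "\<dots> \<le> 2 powr (C + \<eta> * j - k) * 2 powr (- lb * P)" using Lj by (intro mult_right_mono) auto
          also have "\<dots> = 2 powr (C + \<eta> * j - k - lb * P)" by (simp add: powr_add[symmetric])
          finally have "lb * P < C + \<eta> * j" by simp
          moreover have "\<eta> * j \<le> \<eta> * (B0 * k)"
          proof -
            have "\<eta> * j \<le> \<eta> * n" using jP \<eta>(1) by (intro mult_left_mono) auto
            then show ?thesis using \<eta>n by linarith
          qed
          moreover have "0 \<le> \<eta> * (B0 * k)" using \<eta>(1) B0 by simp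
          moreover have "2 * (\<eta> * (B0 * k)) + 2 * C < lb * P" using P_lb by (simp only: distrib_left)
          ultimately show False using C(1) by linarith
        qed
      next
        fix \<omega>' assume \<omega>': "\<omega>' \<in> \<Omega>" and agree: "\<forall>i<n + P. \<omega> i = \<omega>' i"
        \<comment> \<open>Beyond the common prefix nothing is known except the diameter bound
          \<open>K0\<close>; the contraction over \<open>P\<close> letters pays for it and for the
          distortion.\<close>
        let ?d = "dist (\<pi> ((left_shift ^^ (n + P)) \<omega>)) (\<pi> ((left_shift ^^ (n + P)) \<omega>'))"
        have "dist (\<pi> \<omega>) (\<pi> \<omega>') \<le> K * 2 powr (\<eta> * (n + P)) * (?L (n + P) * ?d)" using \<omega> \<omega>' agree by (rule K(2))
        also have "\<dots> \<le> K * 2 powr (\<eta> * (n + P)) * (((1 / 2) ^ k * 2 powr (- lb * P)) * K0)"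
        proof (intro mult_left_mono mult_mono)
          have "?L (n + P) \<le> ?L n * 2 powr (- lb * P)"
            using derivative_product_bounds(3)[OF \<omega>, of n P] unfolding bpow .
          also have "\<dots> \<le> (1 / 2) ^ k * 2 powr (- lb * P)" using Ln by (intro mult_right_mono) auto
          finally show "?L (n + P) \<le> (1 / 2) ^ k * 2 powr (- lb * P)" .
          show "?d \<le> K0" using \<omega> \<omega>' by (intro diam funpow_left_shift_in_code_space)
        qed (use K(1) in auto)
        also have "\<dots> = K * K0 * (2 powr (\<eta> * (n + P)) * 2 powr (- real k) * 2 powr (- lb * P))"
          unfolding half by (simp only: ac_simps)
        also have "\<dots> = K * K0 * 2 powr (\<eta> * (n + P) - k - lb * P)"
          by (simp add: powr_add[symmetric])
        also have "\<dots> \<le> 2 powr (C - 3) * 2 powr (\<eta> * (n + P) - k - lb * P)"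
          using KC' by (intro mult_right_mono) auto
        also have "\<dots> = 2 powr (C - 3 + (\<eta> * (n + P) - k - lb * P))" by (simp add: powr_add)
        also have "\<dots> < 2 powr (- real (k + 3))"
        proof -
          have "\<eta> * P \<le> lb / 2 * P" using \<eta>(2) by (intro mult_right_mono) auto
          then have "\<eta> * (n + P) \<le> \<eta> * (B0 * k) + lb * P / 2" using \<eta>n by (simp add: distrib_left)
          then have "C - 3 + (\<eta> * (n + P) - k - lb * P) < - real (k + 3)" using P_lb by (simp add: of_nat_add)
          then show ?thesis by simp
        qed
        finally show "dist (\<pi> \<omega>) (\<pi> \<omega>') < (1 / 2) ^ (k + 3)" unfolding half .
      qed
    qed
  qed
qed

end

section \<open>Measures of balls\<close>

text \<open>The balls are the sections of one open set in the product, so this is the measurability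
  of section masses.\<close>

lemma borel_measurable_measure_ball:
  fixes M :: "'a::euclidean_space measure"
  assumes "finite_measure M" and sets: "sets M = sets borel"
  shows "(\<lambda>x. measure M (ball x r)) \<in> borel_measurable borel"
proof -
  interpret finite_measure M by fact
  let ?Q = "{p :: 'a \<times> 'a. dist (fst p) (snd p) < r}"
  have "open ?Q" by (intro open_Collect_less continuous_intros)
  then have "?Q \<in> sets (borel \<Otimes>\<^sub>M (borel :: 'a measure))" unfolding borel_prod by (rule borel_open)
  moreover have "sets ((borel :: 'a measure) \<Otimes>\<^sub>M M) = sets (borel \<Otimes>\<^sub>M (borel :: 'a measure))"
    by (rule sets_pair_measure_cong[OF refl sets])
  ultimately have "?Q \<in> sets (borel \<Otimes>\<^sub>M M)" by simp
  then have "(\<lambda>x. emeasure M (Pair x -` ?Q)) \<in> borel_measurable borel" by (rule measurable_emeasure_Pair)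
  moreover have "Pair x -` ?Q = ball x r" for x by (auto simp: ball_def)
  ultimately show ?thesis by (simp add: measure_def)
qed

lemma finite_measure_distr_borel:
  "finite_measure M \<Longrightarrow> g \<in> borel_measurable M \<Longrightarrow> finite_measure (distr M borel g)"
  by (rule finite_measure.finite_measure_distr)

lemma AE_distr_eventually:
  assumes g: "g \<in> borel_measurable M"
    and P: "\<And>k::nat. {x. P x k} \<in> sets borel"
  shows "(AE x in distr M borel g. eventually (P x) sequentially) \<longleftrightarrow> (AE x in M. eventually (P (g x)) sequentially)"
proof (rule AE_distr_iff[OF g])
  have "{x \<in> space borel. \<exists>N. \<forall>n. N \<le> n \<longrightarrow> P x n} \<in> sets borel"
    using P by (intro sets.sets_Collect_countable_Ex sets.sets_Collect_countable_All
        sets.sets_Collect_imp sets.sets_Collect_const) simp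
  then show "{x \<in> space borel. eventually (P x) sequentially} \<in> sets borel"
    unfolding eventually_sequentially .
qed

lemma AE_distr_frequently:
  assumes g: "g \<in> borel_measurable M"
    and P: "\<And>k::nat. {x. P x k} \<in> sets borel"
  shows "(AE x in distr M borel g. frequently (P x) sequentially) \<longleftrightarrow> (AE x in M. frequently (P (g x)) sequentially)"
proof (rule AE_distr_iff[OF g])
  have "{x \<in> space borel. \<forall>N. \<exists>n. N \<le> n \<and> P x n} \<in> sets borel"
    using P by (intro sets.sets_Collect_countable_Ex sets.sets_Collect_countable_All
        sets.sets_Collect_conj sets.sets_Collect_const) simp
  then show "{x \<in> space borel. frequently (P x) sequentially} \<in> sets borel"
    unfolding frequently_sequentially .
qed

text \<open>With only countably many radii, asymptotic conditions on balls are Borel conditions on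
  the centre.\<close>

definition ball_measure :: "'a::metric_space measure \<Rightarrow> 'a \<Rightarrow> nat \<Rightarrow> real" where
  "ball_measure M x k = measure M (ball x ((1 / 2) ^ k))"

lemma sets_ball_measure_le:
  fixes M N :: "'a::euclidean_space measure"
  assumes "finite_measure M" "sets M = sets borel" "finite_measure N" "sets N = sets borel"
  shows "{x. ball_measure M x i \<le> c * ball_measure N x j} \<in> sets borel"
proof -
  have "{x \<in> space borel. ball_measure M x i \<le> c * ball_measure N x j} \<in> sets borel"
    using borel_measurable_measure_ball[OF assms(1,2)] borel_measurable_measure_ball[OF assms(3,4)]
    unfolding ball_measure_def by (intro borel_measurable_le borel_measurable_times borel_measurable_const)
  then show ?thesis by simp
qed

lemma sets_ball_measure:
  fixes M :: "'a::euclidean_space measure"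
  assumes "finite_measure M" "sets M = sets borel"
  shows "{x. ball_measure M x i \<le> c} \<in> sets borel" "{x. c < ball_measure M x i} \<in> sets borel"
proof -
  have *: "(\<lambda>x. ball_measure M x i) \<in> borel_measurable borel"
    using borel_measurable_measure_ball[OF assms] unfolding ball_measure_def .
  show "{x. ball_measure M x i \<le> c} \<in> sets borel" "{x. c < ball_measure M x i} \<in> sets borel"
    using borel_measurable_le[OF * borel_measurable_const[of c]]
      borel_measurable_less[OF borel_measurable_const[of c] *] by simp_all
qed

section \<open>Ball masses of ergodic measures and of the universal measure\<close>

context separated_IFS
begin

abbreviation "universal \<equiv> distr (universal_measure A) borel \<pi>"

lemma universal_finite: "finite_measure universal"
  using finite_universal_measure[OF A_ne] projection_measurable
    measurable_cong_sets[OF sets_universal_measure refl]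
  by (intro finite_measure_distr_borel) blast+

text \<open>A ball is caught between cylinders of lengths \<open>n\<close> and \<open>m\<close>. By
  \<open>entropy\<close> both measures charge them with the same exponent \<open>h\<close>, so the
  comparison works in either direction and loses only \<open>h * (m - n)\<close> and the entropy
  error. Positivity is recorded because \<open>ball_ratio\<close> is infinite where the second
  measure vanishes.\<close>

lemma ball_comparison:
  assumes \<mu>: "ergodic_shift_measure A \<mu>" and \<epsilon>: "0 < (\<epsilon> :: real)"
  shows "AE x in distr \<mu> borel \<pi>. eventually (\<lambda>k.
    ball_measure (distr \<mu> borel \<pi>) x k \<le> 2 powr (\<epsilon> * k) * ball_measure universal x (k + 3) \<and>
    ball_measure universal x k \<le> 2 powr (\<epsilon> * k) * ball_measure (distr \<mu> borel \<pi>) x (k + 3) \<and>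
    0 < ball_measure universal x (k + 3)) sequentially"
proof -
  interpret ergodic_code A \<mu> using \<mu> finite_A by unfold_locales
  let ?\<nu> = "universal_measure A"
  interpret \<nu>: finite_measure ?\<nu> by (rule finite_universal_measure[OF A_ne])
  have pm: "\<pi> \<in> borel_measurable \<mu>" "\<pi> \<in> borel_measurable ?\<nu>"
    using projection_measurable measurable_cong_sets[OF sets_eq refl]
      measurable_cong_sets[OF sets_universal_measure refl] by blast+
  have sp: "space ?\<nu> = \<Omega>" using sets_universal_measure by (rule sets_eq_imp_space_eq)
  let ?M = "distr \<mu> borel \<pi>"
  have ball_M: "ball_measure ?M x k = measure \<mu> {\<omega>' \<in> \<Omega>. dist x (\<pi> \<omega>') < (1 / 2) ^ k}" for x k
    unfolding ball_measure_def by (subst measure_distr[OF pm(1)]) (auto simp: space_eq intro!: arg_cong[where f = "measure \<mu>"])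
  have ball_N: "ball_measure universal x k = measure ?\<nu> {\<omega>' \<in> \<Omega>. dist x (\<pi> \<omega>') < (1 / 2) ^ k}" for x k
    unfolding ball_measure_def by (subst measure_distr[OF pm(2)]) (auto simp: sp intro!: arg_cong[where f = "measure ?\<nu>"])
  have bm: "{\<omega>' \<in> \<Omega>. dist x (\<pi> \<omega>') < r} \<in> sets (code_space A)" for x r
    using projection_measurable by measurable
  have fin: "finite_measure ?M" by (intro finite_measure_distr_borel pm) unfold_locales
  obtain B where B: "0 < B" "\<And>\<epsilon>::real. 0 < \<epsilon> \<Longrightarrow> \<exists>k0. \<forall>k\<ge>k0. \<forall>\<omega>\<in>\<Omega>. \<exists>n m. real m \<le> n + \<epsilon> * k \<and> real n \<le> m \<and> real k \<le> B * n \<and> real n \<le> B * k \<and>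
    (\<forall>\<omega>'\<in>\<Omega>. dist (\<pi> \<omega>) (\<pi> \<omega>') < (1 / 2) ^ k \<longrightarrow> (\<forall>i<n. \<omega> i = \<omega>' i)) \<and>
    (\<forall>\<omega>'\<in>\<Omega>. (\<forall>i<m. \<omega> i = \<omega>' i) \<longrightarrow> dist (\<pi> \<omega>) (\<pi> \<omega>') < (1 / 2) ^ (k + 3))"
    using ball_cylinder by blast
  obtain h where h: "0 \<le> h" "\<And>\<epsilon>::real. 0 < \<epsilon> \<Longrightarrow> AE \<omega> in \<mu>. eventually (\<lambda>n.
      measure \<mu> (cylinder A (prefix_word n \<omega>)) \<in> {2 powr (- (h + \<epsilon>) * n) .. 2 powr (- (h - \<epsilon>) * n)} \<and>
      measure ?\<nu> (cylinder A (prefix_word n \<omega>)) \<in> {2 powr (- (h + \<epsilon>) * n) .. 2 powr (- (h - \<epsilon>) * n)})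
      sequentially"
    by (rule entropy) blast
  \<comment> \<open>The loss in the exponent is at most \<open>h * \<epsilon>2 * k + \<epsilon>1 *
    (\<epsilon>2 * k + 2 * B * k)\<close>. Since \<open>\<epsilon>1 \<le> 1\<close>, the mixed term
    joins the first one, and each of the two parts is at most
    \<open>\<epsilon> / 3 * k\<close>.\<close>
  define \<epsilon>1 where "\<epsilon>1 = min 1 (\<epsilon> / (6 * B))"
  define \<epsilon>2 where "\<epsilon>2 = \<epsilon> / (3 * (h + 1))"
  have e: "0 < \<epsilon>1" "\<epsilon>1 \<le> 1" "0 < \<epsilon>2" "2 * B * \<epsilon>1 \<le> \<epsilon> / 3" "(h + 1) * \<epsilon>2 = \<epsilon> / 3"
  proof -
    show "0 < \<epsilon>1" "\<epsilon>1 \<le> 1" "0 < \<epsilon>2" using \<epsilon> B(1) h(1) by (auto simp: \<epsilon>1_def \<epsilon>2_def)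
    have "2 * B * \<epsilon>1 \<le> 2 * B * (\<epsilon> / (6 * B))" using B(1) by (intro mult_left_mono) (auto simp: \<epsilon>1_def)
    then show "2 * B * \<epsilon>1 \<le> \<epsilon> / 3" using B(1) by simp
    have q: "q * (\<epsilon> / (3 * q)) = \<epsilon> / 3" if "q \<noteq> 0" for q :: real using that by simp
    show "(h + 1) * \<epsilon>2 = \<epsilon> / 3" unfolding \<epsilon>2_def by (rule q) (use h(1) in simp)
  qed
  obtain k0 where k0: "\<And>k \<omega>. k \<ge> k0 \<Longrightarrow> \<omega> \<in> \<Omega> \<Longrightarrow> \<exists>n m. real m \<le> n + \<epsilon>2 * k \<and> real n \<le> m \<and> real k \<le> B * n \<and> real n \<le> B * k \<and>
    (\<forall>\<omega>'\<in>\<Omega>. dist (\<pi> \<omega>) (\<pi> \<omega>') < (1 / 2) ^ k \<longrightarrow> (\<forall>i<n. \<omega> i = \<omega>' i)) \<and>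
    (\<forall>\<omega>'\<in>\<Omega>. (\<forall>i<m. \<omega> i = \<omega>' i) \<longrightarrow> dist (\<pi> \<omega>) (\<pi> \<omega>') < (1 / 2) ^ (k + 3))"
    using B(2)[OF e(3)] by blast
  have "AE \<omega> in \<mu>. eventually (\<lambda>k.
    ball_measure ?M (\<pi> \<omega>) k \<le> 2 powr (\<epsilon> * k) * ball_measure universal (\<pi> \<omega>) (k + 3) \<and>
    ball_measure universal (\<pi> \<omega>) k \<le> 2 powr (\<epsilon> * k) * ball_measure ?M (\<pi> \<omega>) (k + 3) \<and>
    0 < ball_measure universal (\<pi> \<omega>) (k + 3)) sequentially"
    using h(2)[OF e(1)] AE_space
  proof eventually_elim
    case (elim \<omega>)
    have \<omega>: "\<omega> \<in> \<Omega>" using elim(2) space_eq by simp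
    let ?C = "\<lambda>n. cylinder A (prefix_word n \<omega>)"
    obtain n0 where n0: "\<And>n. n \<ge> n0 \<Longrightarrow>
      measure \<mu> (?C n) \<in> {2 powr (- (h + \<epsilon>1) * n) .. 2 powr (- (h - \<epsilon>1) * n)} \<and>
      measure ?\<nu> (?C n) \<in> {2 powr (- (h + \<epsilon>1) * n) .. 2 powr (- (h - \<epsilon>1) * n)}"
      using elim(1) unfolding eventually_sequentially by blast
    show ?case
      unfolding eventually_sequentially
    \<comment> \<open>The cutoff \<open>B * n0\<close> guarantees \<open>n0 \<le> n\<close> through
      \<open>real k \<le> B * n\<close>.\<close>
    proof (intro exI[of _ "max k0 (nat \<lceil>B * n0\<rceil>)"] allI impI)
      fix k assume k: "max k0 (nat \<lceil>B * n0\<rceil>) \<le> k"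
      obtain n m where nm: "real m \<le> n + \<epsilon>2 * k" "real n \<le> m" "real k \<le> B * n" "real n \<le> B * k"
        "\<And>\<omega>'. \<omega>' \<in> \<Omega> \<Longrightarrow> dist (\<pi> \<omega>) (\<pi> \<omega>') < (1 / 2) ^ k \<Longrightarrow> (\<forall>i<n. \<omega> i = \<omega>' i)"
        "\<And>\<omega>'. \<omega>' \<in> \<Omega> \<Longrightarrow> (\<forall>i<m. \<omega> i = \<omega>' i) \<Longrightarrow> dist (\<pi> \<omega>) (\<pi> \<omega>') < (1 / 2) ^ (k + 3)"
        using k0[of k \<omega>] k \<omega> by auto
      have "B * n0 \<le> k" using k by linarith
      then have "B * n0 \<le> B * n" using nm(3) by linarith
      then have n: "n0 \<le> n" using B(1) by simp
      have m: "n0 \<le> m" using n nm(2) by linarith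
      have sub1: "{\<omega>' \<in> \<Omega>. dist (\<pi> \<omega>) (\<pi> \<omega>') < (1 / 2) ^ k} \<subseteq> ?C n"
        using nm(5) by (auto simp: cylinder_prefix_word)
      have sub2: "?C m \<subseteq> {\<omega>' \<in> \<Omega>. dist (\<pi> \<omega>) (\<pi> \<omega>') < (1 / 2) ^ (k + 3)}"
        using nm(6) by (auto simp: cylinder_prefix_word)
      have Mn: "ball_measure ?M (\<pi> \<omega>) k \<le> 2 powr (- (h - \<epsilon>1) * n)"
        unfolding ball_M using finite_measure_mono[OF sub1] n0[OF n] by simp
      have Nn: "ball_measure universal (\<pi> \<omega>) k \<le> 2 powr (- (h - \<epsilon>1) * n)"
        unfolding ball_N using \<nu>.finite_measure_mono[OF sub1] n0[OF n] by (simp add: sets_universal_measure)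
      have Mm: "2 powr (- (h + \<epsilon>1) * m) \<le> ball_measure ?M (\<pi> \<omega>) (k + 3)"
        unfolding ball_M using finite_measure_mono[OF sub2] n0[OF m] bm by (simp add: sets_eq)
      have Nm: "2 powr (- (h + \<epsilon>1) * m) \<le> ball_measure universal (\<pi> \<omega>) (k + 3)"
        unfolding ball_N using \<nu>.finite_measure_mono[OF sub2] n0[OF m] bm by (simp add: sets_universal_measure)
      have "- (h - \<epsilon>1) * n \<le> \<epsilon> * k + - (h + \<epsilon>1) * m"
      proof -
        have "h * (real m - n) \<le> h * (\<epsilon>2 * k)" using nm(1) h(1) by (intro mult_left_mono) auto
        moreover have "\<epsilon>1 * (real m + n) \<le> \<epsilon>1 * (\<epsilon>2 * k + 2 * (B * k))" using nm(1,4) e(1) by (intro mult_left_mono) auto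
        moreover have "\<epsilon>1 * (\<epsilon>2 * k) \<le> 1 * (\<epsilon>2 * k)" using e by (intro mult_right_mono) auto
        moreover have "2 * B * \<epsilon>1 * k \<le> \<epsilon> / 3 * k" using e(4) by (intro mult_right_mono) auto
        moreover have "h * (\<epsilon>2 * k) + 1 * (\<epsilon>2 * k) = \<epsilon> / 3 * k" unfolding e(5)[symmetric] by (simp add: algebra_simps)
        moreover have "0 \<le> \<epsilon> / 3 * k" using \<epsilon> by simp
        ultimately have "h * (real m - n) + \<epsilon>1 * (real m + n) \<le> \<epsilon> * k"
          by (simp add: algebra_simps)
        then show ?thesis by (simp add: algebra_simps)
      qed
      then have key: "2 powr (- (h - \<epsilon>1) * n) \<le> 2 powr (\<epsilon> * k) * 2 powr (- (h + \<epsilon>1) * m)"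
        unfolding powr_add[symmetric] by simp
      have *: "2 powr (\<epsilon> * k) * 2 powr (- (h + \<epsilon>1) * m) \<le> 2 powr (\<epsilon> * k) * x" if "2 powr (- (h + \<epsilon>1) * m) \<le> x" for x
        using that by (intro mult_left_mono) auto
      show "ball_measure ?M (\<pi> \<omega>) k \<le> 2 powr (\<epsilon> * k) * ball_measure universal (\<pi> \<omega>) (k + 3) \<and>
        ball_measure universal (\<pi> \<omega>) k \<le> 2 powr (\<epsilon> * k) * ball_measure ?M (\<pi> \<omega>) (k + 3) \<and>
        0 < ball_measure universal (\<pi> \<omega>) (k + 3)"
      proof (intro conjI)
        show "0 < ball_measure universal (\<pi> \<omega>) (k + 3)" by (rule less_le_trans[OF _ Nm]) simp
      qed (use Mn Nn key *[OF Mm] *[OF Nm] in linarith)+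
    qed
  qed
  then show ?thesis
  proof (subst AE_distr_eventually[OF pm(1)])
    fix k
    show "{x. ball_measure ?M x k \<le> 2 powr (\<epsilon> * k) * ball_measure universal x (k + 3) \<and>
      ball_measure universal x k \<le> 2 powr (\<epsilon> * k) * ball_measure ?M x (k + 3) \<and>
      0 < ball_measure universal x (k + 3)} \<in> sets borel"
      unfolding Collect_conj_eq
      by (intro sets.Int sets_ball_measure_le sets_ball_measure(2) fin universal_finite) simp_all
  qed
qed

text \<open>By \<open>gap\<close> a small ball around \<open>\<pi> \<omega>\<close> sees only points
  with the same first letter, and undoing that map expands it by at most \<kappa>. So ball masses do
  not decrease along the shift after a loss of \<open>c\<close> dyadic scales, and
  \<open>decay_exponent\<close> applies. The second bound holds along infinitely many scales, which
  is what the lower local dimension asks for.\<close>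

lemma exact_dimension:
  assumes \<mu>: "ergodic_shift_measure A \<mu>"
  obtains s :: ereal where "0 \<le> s"
    and "\<And>t::real. ereal t < s \<Longrightarrow> AE x in distr \<mu> borel \<pi>. eventually (\<lambda>k. ball_measure (distr \<mu> borel \<pi>) x k \<le> 2 powr (- t * k)) sequentially"
    and "\<And>t::real. s < ereal t \<Longrightarrow> AE x in distr \<mu> borel \<pi>. frequently (\<lambda>k. 2 powr (- t * k) < ball_measure (distr \<mu> borel \<pi>) x k) sequentially"
proof -
  interpret ergodic_code A \<mu> using \<mu> finite_A by unfold_locales
  let ?M = "distr \<mu> borel \<pi>"
  have pm: "\<pi> \<in> borel_measurable \<mu>"
    using projection_measurable measurable_cong_sets[OF sets_eq refl] by blast
  have fin: "finite_measure ?M" by (intro finite_measure_distr_borel pm) unfold_locales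
  interpret M: prob_space ?M by (rule prob_space_distr[OF pm])
  have ball_M: "ball_measure ?M x k = measure \<mu> {\<omega>' \<in> \<Omega>. dist x (\<pi> \<omega>') < (1 / 2) ^ k}" for x k
    unfolding ball_measure_def by (subst measure_distr[OF pm]) (auto simp: space_eq intro!: arg_cong[where f = "measure \<mu>"])
  have bm: "{\<omega>' \<in> \<Omega>. dist x (\<pi> \<omega>') < r} \<in> sets \<mu>" for x r
    unfolding sets_eq using projection_measurable by measurable
  obtain \<rho> where \<rho>: "0 < \<rho>" "\<rho> \<le> 1" "\<And>\<omega> \<omega>'. \<omega> \<in> \<Omega> \<Longrightarrow> \<omega>' \<in> \<Omega> \<Longrightarrow> \<omega> 0 \<noteq> \<omega>' 0 \<Longrightarrow> \<rho> \<le> dist (\<pi> \<omega>) (\<pi> \<omega>')"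
    using gap by blast
  \<comment> \<open>One power serves two purposes: points closer than it have the same first letter,
    and \<kappa> times it is at most 1.\<close>
  obtain c where c: "(1 / 2 :: real) ^ c < \<rho> / \<kappa>"
    using real_arch_pow_inv[of "\<rho> / \<kappa>" "1 / 2"] \<rho>(1) \<kappa> by auto
  have c1: "\<kappa> * (1 / 2) ^ c \<le> 1"
  proof -
    have "\<kappa> * (1 / 2) ^ c \<le> \<kappa> * (\<rho> / \<kappa>)" using c \<kappa> by (intro mult_left_mono) auto
    then show ?thesis using \<rho>(2) \<kappa> by simp
  qed
  have c2: "(1 / 2 :: real) ^ c \<le> \<rho>"
  proof -
    have "\<rho> / \<kappa> \<le> \<rho> / 1" using \<rho>(1) \<kappa> by (intro divide_left_mono) auto
    then show ?thesis using c by simp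
  qed
  have le: "ball_measure ?M (\<pi> \<omega>) (k + c) \<le> ball_measure ?M (\<pi> (left_shift \<omega>)) k" if "\<omega> \<in> space \<mu>" for \<omega> k
  proof -
    have \<omega>: "\<omega> \<in> \<Omega>" using that space_eq by simp
    let ?B = "{\<omega>' \<in> \<Omega>. dist (\<pi> (left_shift \<omega>)) (\<pi> \<omega>') < (1 / 2) ^ k}"
    have "{\<omega>' \<in> \<Omega>. dist (\<pi> \<omega>) (\<pi> \<omega>') < (1 / 2) ^ (k + c)} \<subseteq> left_shift -` ?B \<inter> space \<mu>"
    proof
      fix \<omega>' assume "\<omega>' \<in> {\<omega>' \<in> \<Omega>. dist (\<pi> \<omega>) (\<pi> \<omega>') < (1 / 2) ^ (k + c)}"
      then have \<omega>': "\<omega>' \<in> \<Omega>" and d: "dist (\<pi> \<omega>) (\<pi> \<omega>') < (1 / 2) ^ (k + c)" by auto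
      have "(1 / 2 :: real) ^ (k + c) \<le> (1 / 2) ^ c" by (rule power_decreasing) auto
      then have "dist (\<pi> \<omega>) (\<pi> \<omega>') < \<rho>" using d c2 by linarith
      then have 0: "\<omega> 0 = \<omega>' 0" using \<rho>(3)[OF \<omega> \<omega>'] by force
      have s: "left_shift \<omega> \<in> \<Omega>" "left_shift \<omega>' \<in> \<Omega>" using \<omega> \<omega>' by (auto intro: left_shift_in_code_space)
      have "dist (\<pi> (left_shift \<omega>)) (\<pi> (left_shift \<omega>')) / \<kappa> \<le> dist (\<pi> \<omega>) (\<pi> \<omega>')"
      proof -
        have "\<omega> 0 \<in> A" using \<omega> by (simp add: space_code_space)
        then show ?thesis
          unfolding projection_step[OF \<omega>] projection_step[OF \<omega>'] 0[symmetric]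
          using bilipschitz projection_limit(1) s by blast
      qed
      then have "dist (\<pi> (left_shift \<omega>)) (\<pi> (left_shift \<omega>')) \<le> \<kappa> * dist (\<pi> \<omega>) (\<pi> \<omega>')"
        using \<kappa> by (simp add: pos_divide_le_eq mult.commute)
      also have "\<dots> < \<kappa> * (1 / 2) ^ (k + c)" using d \<kappa> by (intro mult_strict_left_mono) auto
      also have "\<dots> = (\<kappa> * (1 / 2) ^ c) * (1 / 2) ^ k" by (simp add: power_add)
      also have "\<dots> \<le> 1 * (1 / 2) ^ k" using c1 by (intro mult_right_mono) auto
      finally show "\<omega>' \<in> left_shift -` ?B \<inter> space \<mu>" using s \<omega>' space_eq by simp
    qed
    then have "ball_measure ?M (\<pi> \<omega>) (k + c) \<le> measure \<mu> (left_shift -` ?B \<inter> space \<mu>)"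
      unfolding ball_M by (rule finite_measure_mono) (rule measurable_sets[OF shift_measurable bm])
    also have "\<dots> = ball_measure ?M (\<pi> (left_shift \<omega>)) k"
      unfolding ball_M by (rule measure_shift_vimage[OF bm])
    finally show ?thesis .
  qed
  have meas: "(\<lambda>\<omega>. ball_measure ?M (\<pi> \<omega>) k) \<in> borel_measurable \<mu>" for k
    using measurable_compose[OF pm borel_measurable_measure_ball[OF fin]] unfolding ball_measure_def by simp
  have le1: "ball_measure ?M x k \<le> 1" for x k unfolding ball_measure_def by simp
  obtain s :: ereal where s: "0 \<le> s"
    "\<And>t::real. ereal t < s \<Longrightarrow> AE \<omega> in \<mu>. eventually (\<lambda>k. ball_measure ?M (\<pi> \<omega>) k \<le> 2 powr (- t * k)) sequentially"
    "\<And>t::real. s < ereal t \<Longrightarrow> AE \<omega> in \<mu>. frequently (\<lambda>k. 2 powr (- t * k) < ball_measure ?M (\<pi> \<omega>) k) sequentially"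
    by (rule decay_exponent[of "\<lambda>\<omega>. ball_measure ?M (\<pi> \<omega>)" c]) (use meas le le1 in auto)
  show ?thesis
  proof (rule that[OF s(1)])
    fix t :: real
    {
      assume "ereal t < s"
      then show "AE x in ?M. eventually (\<lambda>k. ball_measure ?M x k \<le> 2 powr (- t * k)) sequentially"
        by (subst AE_distr_eventually[OF pm sets_ball_measure(1)[OF fin]]) (simp_all add: s(2)[simplified])
    next
      assume "s < ereal t"
      then show "AE x in ?M. frequently (\<lambda>k. 2 powr (- t * k) < ball_measure ?M x k) sequentially"
        by (subst AE_distr_frequently[OF pm sets_ball_measure(2)[OF fin]]) (simp_all add: s(3)[simplified])
    }
  qed
qed

end

section \<open>Covering arguments\<close>

text \<open>Vitali's lemma selects disjoint balls of radius \<open>r / 8\<close> whose fivefold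
  enlargements cover \<open>S\<close> and have radius below \<open>r\<close>. The masses of \<mu>
  are summed over the large balls, those of \<nu> over the disjoint small ones. An open superset is
  produced because \<open>S\<close> is an arbitrary set.\<close>

lemma Vitali_comparison:
  fixes \<mu> \<nu> :: "'a::euclidean_space measure"
  assumes fin: "finite_measure \<mu>" "finite_measure \<nu>" and sets: "sets \<mu> = sets borel" "sets \<nu> = sets borel"
    and r: "0 < r" and K: "0 \<le> K"
    and le: "\<And>x. x \<in> S \<Longrightarrow> measure \<mu> (ball x r) \<le> K * measure \<nu> (ball x (r / 8))"
  shows "\<exists>U. open U \<and> S \<subseteq> U \<and> measure \<mu> U \<le> K * measure \<nu> (\<Union>x\<in>S. ball x (r / 8))"
proof -
  interpret \<mu>: finite_measure \<mu> by fact
  interpret \<nu>: finite_measure \<nu> by fact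
  obtain C where C: "countable C" "C \<subseteq> S"
    "pairwise (\<lambda>i j. disjnt (cball i (r / 8)) (cball j (r / 8))) C"
    "\<And>i. i \<in> S \<Longrightarrow> \<exists>j. j \<in> C \<and> \<not> disjnt (cball i (r / 8)) (cball j (r / 8)) \<and> cball i (r / 8) \<subseteq> ball j (5 * (r / 8))"
    using Vitali_covering_lemma_cballs_balls[of S "\<lambda>_. r / 8" "r / 8" "\<lambda>x. x"] r by auto
  define N where "N = to_nat_on C ` C"
  define y where "y n = from_nat_into C n" for n
  have y: "y n \<in> C" "to_nat_on C (y n) = n" if "n \<in> N" for n
    using that C(1) by (auto simp: N_def y_def)
  have y_surj: "\<exists>n\<in>N. y n = x" if "x \<in> C" for x
    using that C(1) by (auto simp: N_def y_def)
  define X where "X n = (if n \<in> N then ball (y n) r else {})" for n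
  define Y where "Y n = (if n \<in> N then ball (y n) (r / 8) else {})" for n
  have dis: "disjoint_family Y"
    unfolding disjoint_family_on_def
  proof (intro ballI impI)
    fix m n :: nat assume "m \<noteq> n"
    show "Y m \<inter> Y n = {}"
    proof (cases "m \<in> N \<and> n \<in> N")
      case True
      then have "y m \<noteq> y n" using y(2) \<open>m \<noteq> n\<close> by metis
      then have "disjnt (cball (y m) (r / 8)) (cball (y n) (r / 8))"
        using C(3) y(1) True unfolding pairwise_def by blast
      moreover have "Y m \<subseteq> cball (y m) (r / 8)" "Y n \<subseteq> cball (y n) (r / 8)" by (auto simp: Y_def)
      ultimately show ?thesis unfolding disjnt_def by blast
    qed (auto simp: Y_def)
  qed
  have Xm: "X n \<in> sets \<mu>" and Ym: "Y n \<in> sets \<nu>" for n by (simp_all add: X_def Y_def sets)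
  let ?W = "\<Union>x\<in>S. ball x (r / 8)"
  have Wm: "?W \<in> sets \<nu>" unfolding sets by (intro borel_open open_UN) simp
  have "emeasure \<mu> (\<Union>n. X n) \<le> (\<Sum>n. emeasure \<mu> (X n))"
    using Xm by (intro emeasure_subadditive_countably) auto
  also have "\<dots> \<le> (\<Sum>n. ennreal K * emeasure \<nu> (Y n))"
  proof (rule suminf_le)
    show "emeasure \<mu> (X n) \<le> ennreal K * emeasure \<nu> (Y n)" for n
      using le[of "y n"] y(1)[of n] C(2) K
      by (auto simp: X_def Y_def \<mu>.emeasure_eq_measure \<nu>.emeasure_eq_measure ennreal_mult'[symmetric])
  qed auto
  also have "\<dots> = ennreal K * emeasure \<nu> (\<Union>n. Y n)"
    by (subst suminf_emeasure[symmetric, OF _ dis]) (use Ym in \<open>auto simp: ennreal_suminf_cmult\<close>)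
  also have "\<dots> \<le> ennreal K * emeasure \<nu> ?W"
    using y(1) C(2) Wm by (intro mult_left_mono emeasure_mono) (auto simp: Y_def split: if_splits)
  finally have "measure \<mu> (\<Union>n. X n) \<le> K * measure \<nu> ?W"
    using K by (simp add: \<mu>.emeasure_eq_measure \<nu>.emeasure_eq_measure ennreal_mult'[symmetric])
  moreover have "open (\<Union>n. X n)" by (intro open_UN) (auto simp: X_def)
  moreover have "S \<subseteq> (\<Union>n. X n)"
  proof
    fix x assume "x \<in> S"
    then obtain j where j: "j \<in> C" "cball x (r / 8) \<subseteq> ball j (5 * (r / 8))" using C(4) by blast
    then obtain n where n: "n \<in> N" "y n = j" using y_surj by blast
    have "x \<in> cball x (r / 8)" using r by simp
    then have "x \<in> ball j (5 * (r / 8))" using j(2) by blast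
    then have "x \<in> ball j r" using r by simp
    then show "x \<in> (\<Union>n. X n)" using n by (auto simp: X_def)
  qed
  ultimately show ?thesis by blast
qed

text \<open>Borel--Cantelli, phrased through covers because the exceptional sets of
  \<open>Vitali_comparison\<close> come with open supersets.\<close>

lemma AE_eventually_notin:
  fixes S :: "nat \<Rightarrow> 'a set"
  assumes fin: "finite_measure M" and q: "0 \<le> q" "q < 1"
    and cover: "\<And>k. k \<ge> k0 \<Longrightarrow> \<exists>U\<in>sets M. S k \<subseteq> U \<and> measure M U \<le> C * q ^ k"
  shows "AE x in M. eventually (\<lambda>k. x \<notin> S k) sequentially"
proof -
  interpret finite_measure M by fact
  obtain U where U: "\<And>k. k \<ge> k0 \<Longrightarrow> U k \<in> sets M \<and> S k \<subseteq> U k \<and> measure M (U k) \<le> C * q ^ k"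
    using cover by metis
  have "AE x in M. eventually (\<lambda>k. x \<in> space M - U (k + k0)) sequentially"
  proof (rule borel_cantelli_AE1)
    have "summable (\<lambda>k. C * q ^ (k + k0))"
      unfolding power_add using q by (intro summable_mult summable_mult2 summable_geometric) auto
    then show "summable (\<lambda>k. measure M (U (k + k0)))"
      by (rule summable_comparison_test') (use U in auto)
  qed (use U in \<open>auto simp: emeasure_eq_measure\<close>)
  then show ?thesis
  proof eventually_elim
    case (elim x)
    then have "eventually (\<lambda>k. x \<notin> S (k + k0)) sequentially"
    proof eventually_elim
      case (elim k)
      then show ?case using U[of "k + k0"] by auto
    qed
    then show ?case
      using eventually_sequentially_seg[of "\<lambda>k. x \<notin> S k" k0] by simp
  qed
qed

lemma half_power_add_3: "(1 / 2 :: real) ^ (k + 3) = (1 / 2) ^ k / 8"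
  by (simp add: power_add power3_eq_cube)

text \<open>A substitute for the Besicovitch density theorem, up to subexponential factors.\<close>

lemma AE_ball_measure_le:
  fixes \<mu> \<nu> :: "'a::euclidean_space measure"
  assumes fin: "finite_measure \<mu>" "finite_measure \<nu>" and sets: "sets \<mu> = sets borel" "sets \<nu> = sets borel"
    and \<epsilon>: "0 < (\<epsilon> :: real)"
  shows "AE x in \<mu>. eventually (\<lambda>k. ball_measure \<nu> x (k + 3) \<le> 2 powr (\<epsilon> * k) * ball_measure \<mu> x k) sequentially"
proof -
  interpret \<mu>: finite_measure \<mu> by fact
  interpret \<nu>: finite_measure \<nu> by fact
  define S where "S k = {x. 2 powr (\<epsilon> * k) * ball_measure \<mu> x k < ball_measure \<nu> x (k + 3)}" for k :: nat
  have "AE x in \<mu>. eventually (\<lambda>k. x \<notin> S k) sequentially"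
  proof (rule AE_eventually_notin[OF fin(1), of "2 powr (- \<epsilon>)" 0 S "measure \<nu> (space \<nu>)"])
    show "2 powr (- \<epsilon>) < 1" using \<epsilon> by (simp add: powr_minus inverse_less_1_iff)
    fix k :: nat
    have pk: "(2 powr (- \<epsilon>)) ^ k = 2 powr (- \<epsilon> * k)" by (simp add: powr_realpow[symmetric] powr_powr)
    have "\<exists>U. open U \<and> S k \<subseteq> U \<and> measure \<mu> U \<le> 2 powr (- \<epsilon> * k) * measure \<nu> (\<Union>x\<in>S k. ball x ((1 / 2) ^ k / 8))"
    proof (rule Vitali_comparison[OF fin sets])
      fix x assume "x \<in> S k"
      then have "2 powr (- \<epsilon> * k) * (2 powr (\<epsilon> * k) * ball_measure \<mu> x k) \<le> 2 powr (- \<epsilon> * k) * ball_measure \<nu> x (k + 3)"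
        by (intro mult_left_mono) (auto simp: S_def)
      then show "measure \<mu> (ball x ((1 / 2) ^ k)) \<le> 2 powr (- \<epsilon> * k) * measure \<nu> (ball x ((1 / 2) ^ k / 8))"
        by (simp add: mult.assoc[symmetric] powr_add[symmetric] ball_measure_def half_power_add_3)
    qed auto
    then obtain U where U: "open U" "S k \<subseteq> U"
      "measure \<mu> U \<le> 2 powr (- \<epsilon> * k) * measure \<nu> (\<Union>x\<in>S k. ball x ((1 / 2) ^ k / 8))" by blast
    note U(3)
    also have "2 powr (- \<epsilon> * k) * measure \<nu> (\<Union>x\<in>S k. ball x ((1 / 2) ^ k / 8)) \<le> 2 powr (- \<epsilon> * k) * measure \<nu> (space \<nu>)"
      by (intro mult_left_mono \<nu>.bounded_measure) auto
    finally have "measure \<mu> U \<le> measure \<nu> (space \<nu>) * 2 powr (- \<epsilon> * k)" by (simp only: mult.commute)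
    then show "\<exists>U\<in>sets \<mu>. S k \<subseteq> U \<and> measure \<mu> U \<le> measure \<nu> (space \<nu>) * (2 powr (- \<epsilon>)) ^ k"
      using U sets unfolding pk by (intro bexI[of _ U] conjI) simp_all
  qed simp
  then show ?thesis by (simp add: S_def not_less)
qed

section \<open>Local dimensions along dyadic radii\<close>

lemma filterlim_half_power: "filterlim (\<lambda>k. (1 / 2 :: real) ^ k) (at_right 0) sequentially"
  unfolding filterlim_at
  by (auto intro: LIMSEQ_realpow_zero)

lemma dyadic_scale:
  fixes r :: real
  assumes "0 < r" "r < 1"
  obtains k where "(1 / 2) ^ Suc k \<le> r" "r < (1 / 2) ^ k"
proof -
  have "\<exists>n. (1 / 2) ^ n \<le> r" using real_arch_pow_inv[of r "1 / 2"] assms by (auto intro: less_imp_le)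
  define n where "n = (LEAST n. (1 / 2) ^ n \<le> r)"
  have n: "(1 / 2) ^ n \<le> r" unfolding n_def using \<open>\<exists>n. _\<close> by (rule LeastI_ex)
  have "n \<noteq> 0" using n assms by (intro notI) simp
  then obtain k where k: "n = Suc k" by (cases n) auto
  have "\<not> (1 / 2) ^ k \<le> r" using not_less_Least[of k "\<lambda>n. (1 / 2) ^ n \<le> r"] k unfolding n_def by simp
  then show ?thesis using that[of k] n k by simp
qed

lemma eventually_at_right_dyadic:
  assumes "\<And>k r. k \<ge> k0 \<Longrightarrow> 0 < r \<Longrightarrow> (1 / 2) ^ Suc k \<le> r \<Longrightarrow> r < (1 / 2) ^ k \<Longrightarrow> P r"
  shows "eventually P (at_right (0 :: real))"
proof (rule eventually_at_right[THEN iffD2, OF zero_less_one], intro exI[of _ "(1 / 2) ^ Suc k0"] conjI allI impI)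
  show "0 < (1 / 2 :: real) ^ Suc k0" by simp
  fix r :: real assume "0 < r" "r < (1 / 2) ^ Suc k0"
  moreover have "(1 / 2 :: real) ^ Suc k0 \<le> 1" by (rule power_le_one) auto
  ultimately have r1: "r < 1" by linarith
  obtain k where k: "(1 / 2) ^ Suc k \<le> r" "r < (1 / 2) ^ k" by (rule dyadic_scale[OF \<open>0 < r\<close> r1])
  have "k \<ge> k0"
  proof (rule ccontr)
    assume "\<not> k \<ge> k0"
    then have "(1 / 2 :: real) ^ Suc k0 \<le> (1 / 2) ^ Suc k" by (intro power_decreasing) auto
    then show False using k \<open>r < (1 / 2) ^ Suc k0\<close> by linarith
  qed
  then show "P r" using assms k \<open>0 < r\<close> by blast
qed

lemma half_power_powr: "(1 / 2 :: real) ^ k = 2 powr (- real k)"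
  by (simp add: powr_minus powr_realpow power_one_over inverse_eq_divide)

text \<open>Dividing by the negative \<open>ln r\<close> reverses inequalities: small mass means
  large exponent. A null ball gives \<open>- \<infinity>\<close> over a negative number, that is
  \<infinity>, which is consistent with every \<open>t\<close>.\<close>

lemma elog_div_ln_ge:
  assumes "0 < r" "r < 1" "0 \<le> m" "m \<le> r powr t"
  shows "ereal t \<le> elog (ereal m) / ereal (ln r)"
proof (cases "m = 0")
  case True
  then show ?thesis using assms by (simp add: elog_def)
next
  case False
  have lr: "ln r < 0" using assms by simp
  have "ln m \<le> ln (r powr t)" using assms False by (subst ln_le_cancel_iff) auto
  then have "ln m \<le> t * ln r" using assms by (simp add: ln_powr)
  then have "t \<le> ln m / ln r" using lr by (simp add: neg_le_divide_eq)
  then show ?thesis using assms False lr by (simp add: elog_def)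
qed

lemma elog_div_ln_le:
  assumes "0 < r" "r < 1" "r powr t \<le> m"
  shows "elog (ereal m) / ereal (ln r) \<le> ereal t"
proof -
  have lr: "ln r < 0" using assms by simp
  have m: "0 < m" using assms by (intro less_le_trans[OF _ assms(3)]) simp
  have "ln (r powr t) \<le> ln m" using assms m by (subst ln_le_cancel_iff) auto
  then have "t * ln r \<le> ln m" using assms by (simp add: ln_powr)
  then have "ln m / ln r \<le> t" using lr by (simp add: neg_divide_le_eq)
  then show ?thesis using m lr by (simp add: elog_def)
qed

text \<open>Dyadic radii suffice: between two of them \<open>r powr t'\<close> changes by a bounded
  factor, which the room between \<open>t'\<close> and \<open>t\<close> absorbs. Negative
  \<open>t'\<close> are covered by the total mass 1.\<close>

lemma lower_local_dim_ge:
  fixes \<mu> :: "'a::metric_space measure" and t t' :: real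
  assumes "prob_space \<mu>" and sets: "\<And>r. ball x r \<inter> space \<mu> \<in> sets \<mu>"
    and ev: "eventually (\<lambda>k. measure \<mu> (ball x ((1 / 2) ^ k) \<inter> space \<mu>) \<le> 2 powr (- t * k)) sequentially" and t: "t' < t"
  shows "ereal t' \<le> lower_local_dim \<mu> x"
proof -
  interpret prob_space \<mu> by fact
  let ?g = "\<lambda>r. measure \<mu> (ball x r \<inter> space \<mu>)"
  obtain k1 where k1: "\<And>k. k \<ge> k1 \<Longrightarrow> ?g ((1 / 2) ^ k) \<le> 2 powr (- t * k)"
    using ev unfolding eventually_sequentially by blast
  \<comment> \<open>From here on \<open>t * k\<close> is at least \<open>t' * (k + 1)\<close>; the
    additional 1 is the distance to the next dyadic radius.\<close>
  define k0 where "k0 = max (max 1 k1) (nat \<lceil>t' / (t - t')\<rceil>)"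
  have "eventually (\<lambda>r. ereal t' \<le> elog (ereal (?g r)) / ereal (ln r)) (at_right 0)"
  proof (rule eventually_at_right_dyadic)
    fix k and r :: real assume k: "k0 \<le> k" and r: "0 < r" "(1 / 2) ^ Suc k \<le> r" "r < (1 / 2) ^ k"
    have "(1 / 2 :: real) ^ k \<le> 1" by (rule power_le_one) auto
    then have r1: "r < 1" using r by linarith
    have "?g r \<le> r powr t'"
    proof (cases "t' < 0")
      case True
      have "1 \<le> r powr t'"
      proof -
        have "r powr 0 \<le> r powr t'" using True r r1 by (intro powr_mono') auto
        then show ?thesis using r by simp
      qed
      then show ?thesis using prob_le_1 by (rule order_trans[rotated])
    next
      case False
      have "?g r \<le> ?g ((1 / 2) ^ k)" using r sets by (intro finite_measure_mono) auto
      also have "\<dots> \<le> 2 powr (- t * k)" using k by (intro k1) (simp add: k0_def)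
      also have "\<dots> \<le> 2 powr (- real (Suc k) * t')"
      proof -
        have "t' / (t - t') \<le> k" using k unfolding k0_def by linarith
        then have "t' \<le> k * (t - t')" using t by (simp add: pos_divide_le_eq)
        then have "- t * k \<le> - real (Suc k) * t'" by (simp add: algebra_simps)
        then show ?thesis by simp
      qed
      also have "\<dots> = ((1 / 2) ^ Suc k) powr t'" unfolding half_power_powr by (simp only: powr_powr)
      also have "\<dots> \<le> r powr t'" using r False by (intro powr_mono2) auto
      finally show ?thesis .
    qed
    then show "ereal t' \<le> elog (ereal (?g r)) / ereal (ln r)" using r r1 by (intro elog_div_ln_ge) auto
  qed
  then show ?thesis unfolding lower_local_dim_def by (rule Liminf_bounded)
qed

lemma lower_local_dim_le:
  fixes \<mu> :: "'a::metric_space measure" and t :: real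
  assumes freq: "frequently (\<lambda>k. 2 powr (- t * k) \<le> measure \<mu> (ball x ((1 / 2) ^ k) \<inter> space \<mu>)) sequentially"
  shows "lower_local_dim \<mu> x \<le> ereal t"
proof (rule ccontr)
  assume "\<not> lower_local_dim \<mu> x \<le> ereal t"
  then have "ereal t < lower_local_dim \<mu> x" by simp
  then have "eventually (\<lambda>r. ereal t < elog (ereal (measure \<mu> (ball x r \<inter> space \<mu>))) / ereal (ln r)) (at_right 0)"
    unfolding lower_local_dim_def by (rule less_LiminfD)
  then have "eventually (\<lambda>k. ereal t < elog (ereal (measure \<mu> (ball x ((1 / 2) ^ k) \<inter> space \<mu>))) / ereal (ln ((1 / 2) ^ k))) sequentially"
    using filterlim_half_power unfolding filterlim_iff by blast
  with eventually_gt_at_top[of "0::nat"]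
  have "eventually (\<lambda>k. 0 < k \<and> ereal t < elog (ereal (measure \<mu> (ball x ((1 / 2) ^ k) \<inter> space \<mu>))) / ereal (ln ((1 / 2) ^ k))) sequentially"
    by (rule eventually_conj)
  from frequently_ex[OF frequently_eventually_conj[OF freq this]]
  obtain k where k: "2 powr (- t * k) \<le> measure \<mu> (ball x ((1 / 2) ^ k) \<inter> space \<mu>)" "0 < k"
      "ereal t < elog (ereal (measure \<mu> (ball x ((1 / 2) ^ k) \<inter> space \<mu>))) / ereal (ln ((1 / 2) ^ k))"
    by blast
  have "(1 / 2 :: real) ^ k < 1" using k(2) by (intro power_less_one_iff[THEN iffD2]) auto
  moreover have "((1 / 2) ^ k) powr t = 2 powr (- t * k)"
    unfolding half_power_powr powr_powr by (simp add: mult.commute)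
  ultimately have "elog (ereal (measure \<mu> (ball x ((1 / 2) ^ k) \<inter> space \<mu>))) / ereal (ln ((1 / 2) ^ k)) \<le> ereal t"
    using k(1) by (intro elog_div_ln_le) auto
  then show False using k(3) by simp
qed

lemma ae_filter_not_bot: "prob_space M \<Longrightarrow> ae_filter M \<noteq> bot"
  using prob_space.AE_False[of M] by (auto simp: trivial_limit_def)

lemma has_hdimI:
  fixes \<mu> :: "'a::metric_space measure"
  assumes \<mu>: "prob_space \<mu>" and sets: "\<And>x r. ball x r \<inter> space \<mu> \<in> sets \<mu>"
    and lower: "\<And>t::real. ereal t < s \<Longrightarrow>
      AE x in \<mu>. eventually (\<lambda>k. measure \<mu> (ball x ((1 / 2) ^ k) \<inter> space \<mu>) \<le> 2 powr (- t * k)) sequentially"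
    and upper: "\<And>t::real. s < ereal t \<Longrightarrow>
      AE x in \<mu>. frequently (\<lambda>k. 2 powr (- t * k) \<le> measure \<mu> (ball x ((1 / 2) ^ k) \<inter> space \<mu>)) sequentially"
  shows "has_hdim \<mu> s"
proof -
  have 1: "s \<le> lower_hdim \<mu>"
    unfolding lower_hdim_def le_Liminf_iff
  proof (intro allI impI)
    fix y assume "y < s"
    then obtain t' where t': "y < ereal t'" "ereal t' < s" using ereal_dense2 by blast
    then obtain t where t: "ereal t' < ereal t" "ereal t < s" using ereal_dense2 by blast
    show "eventually (\<lambda>x. y < lower_local_dim \<mu> x) (ae_filter \<mu>)"
      using lower[OF t(2)]
    proof eventually_elim
      case (elim x)
      have "ereal t' \<le> lower_local_dim \<mu> x"
        by (rule lower_local_dim_ge[OF \<mu> sets elim]) (use t in simp)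
      then show ?case using t'(1) by simp
    qed
  qed
  have 2: "upper_hdim \<mu> \<le> s"
    unfolding upper_hdim_def Limsup_le_iff
  proof (intro allI impI)
    fix y assume "s < y"
    then obtain t where t: "s < ereal t" "ereal t < y" using ereal_dense2 by blast
    show "eventually (\<lambda>x. lower_local_dim \<mu> x < y) (ae_filter \<mu>)"
      using upper[OF t(1)]
    proof eventually_elim
      case (elim x)
      then have "lower_local_dim \<mu> x \<le> ereal t" by (rule lower_local_dim_le)
      then show ?case using t(2) by simp
    qed
  qed
  have "lower_hdim \<mu> \<le> upper_hdim \<mu>"
    unfolding lower_hdim_def upper_hdim_def by (rule Liminf_le_Limsup[OF ae_filter_not_bot[OF \<mu>]])
  then show ?thesis using 1 2 unfolding has_hdim_def by auto
qed

text \<open>Every small \<open>r\<close> lies between \<open>(1 / 2) ^ (k + 3)\<close> and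
  \<open>(1 / 2) ^ k\<close> for the \<open>k\<close> of its dyadic scale, so the offset 3 turns the
  comparison at two radii into one at the same radius \<open>r\<close>.\<close>

lemma ball_ratio_bounds:
  fixes \<mu> \<nu> :: "'a::metric_space measure" and x :: 'a and \<epsilon> :: real
  defines "m \<equiv> \<lambda>r. measure \<mu> (ball x r \<inter> space \<mu>)" and "n \<equiv> \<lambda>r. measure \<nu> (ball x r \<inter> space \<nu>)"
  assumes fin: "finite_measure \<mu>" "finite_measure \<nu>"
    and sets: "\<And>r. ball x r \<inter> space \<mu> \<in> sets \<mu>" "\<And>r. ball x r \<inter> space \<nu> \<in> sets \<nu>"
    and ev: "eventually (\<lambda>k. m ((1 / 2) ^ k) \<le> 2 powr (\<epsilon> * k) * n ((1 / 2) ^ (k + 3)) \<and>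
      n ((1 / 2) ^ k) \<le> 2 powr (\<epsilon> * k) * m ((1 / 2) ^ (k + 3)) \<and> 0 < n ((1 / 2) ^ (k + 3))) sequentially"
    and \<epsilon>: "0 < \<epsilon>"
  shows "eventually (\<lambda>r. - ereal \<epsilon> \<le> elog (ball_ratio \<mu> \<nu> x r) / ereal (ln r) \<and>
    elog (ball_ratio \<mu> \<nu> x r) / ereal (ln r) \<le> ereal \<epsilon>) (at_right 0)"
proof -
  interpret \<mu>: finite_measure \<mu> by fact
  interpret \<nu>: finite_measure \<nu> by fact
  have m_mono: "m r \<le> m r'" and n_mono: "n r \<le> n r'" if "r \<le> r'" for r r'
    unfolding m_def n_def using that sets by (auto intro!: \<mu>.finite_measure_mono \<nu>.finite_measure_mono)
  obtain k0 where k0: "\<And>k. k \<ge> k0 \<Longrightarrow> m ((1 / 2) ^ k) \<le> 2 powr (\<epsilon> * k) * n ((1 / 2) ^ (k + 3)) \<and>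
      n ((1 / 2) ^ k) \<le> 2 powr (\<epsilon> * k) * m ((1 / 2) ^ (k + 3)) \<and> 0 < n ((1 / 2) ^ (k + 3))"
    using ev unfolding eventually_sequentially by blast
  show ?thesis
  proof (rule eventually_at_right_dyadic[of "max 1 k0"])
    fix k and r :: real assume k: "max 1 k0 \<le> k" and r: "0 < r" "(1 / 2) ^ Suc k \<le> r" "r < (1 / 2) ^ k"
    have "(1 / 2 :: real) ^ k \<le> 1" by (rule power_le_one) auto
    then have r1: "r < 1" using r by linarith
    have "(1 / 2 :: real) ^ (k + 3) \<le> (1 / 2) ^ Suc k" by (rule power_decreasing) auto
    then have r3: "(1 / 2) ^ (k + 3) \<le> r" using r by linarith
    note K = k0[of k]
    have n_pos: "0 < n r" using K k n_mono[OF r3] by auto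
    then have ratio: "ball_ratio \<mu> \<nu> x r = ereal (m r / n r)"
      unfolding ball_ratio_def m_def n_def by simp
    have r_powr: "2 powr (\<epsilon> * k) \<le> r powr (- \<epsilon>)"
    proof -
      have "2 powr (\<epsilon> * k) = ((1 / 2) ^ k) powr (- \<epsilon>)" unfolding half_power_powr powr_powr by (simp add: mult.commute)
      also have "\<dots> \<le> r powr (- \<epsilon>)" using r \<epsilon> by (intro powr_mono2') auto
      finally show ?thesis .
    qed
    have "m r \<le> m ((1 / 2) ^ k)" using r by (intro m_mono) auto
    also have "\<dots> \<le> 2 powr (\<epsilon> * k) * n ((1 / 2) ^ (k + 3))" using K k by simp
    also have "\<dots> \<le> r powr (- \<epsilon>) * n r" using r_powr n_mono[OF r3] by (intro mult_mono) (auto simp: n_def)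
    finally have up: "m r / n r \<le> r powr (- \<epsilon>)" using n_pos by (simp add: pos_divide_le_eq)
    have "n r \<le> n ((1 / 2) ^ k)" using r by (intro n_mono) auto
    also have "\<dots> \<le> 2 powr (\<epsilon> * k) * m ((1 / 2) ^ (k + 3))" using K k by simp
    also have "\<dots> \<le> r powr (- \<epsilon>) * m r" using r_powr m_mono[OF r3] by (intro mult_mono) (auto simp: m_def)
    finally have "r powr \<epsilon> * n r \<le> r powr \<epsilon> * (r powr (- \<epsilon>) * m r)" by (intro mult_left_mono) auto
    also have "\<dots> = m r" using r by (simp add: mult.assoc[symmetric] powr_add[symmetric])
    finally have low: "r powr \<epsilon> \<le> m r / n r" using n_pos by (simp add: pos_le_divide_eq)
    have "0 \<le> m r / n r" using n_pos by (simp add: m_def)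
    then have "ereal (- \<epsilon>) \<le> elog (ereal (m r / n r)) / ereal (ln r)" using up r r1 by (intro elog_div_ln_ge)
    moreover have "elog (ereal (m r / n r)) / ereal (ln r) \<le> ereal \<epsilon>" using low r r1 by (intro elog_div_ln_le)
    ultimately show "- ereal \<epsilon> \<le> elog (ball_ratio \<mu> \<nu> x r) / ereal (ln r) \<and>
      elog (ball_ratio \<mu> \<nu> x r) / ereal (ln r) \<le> ereal \<epsilon>" unfolding ratio by simp
  qed
qed

text \<open>The inequalities in \<open>rel_dim\<close> are strict, so the weak bounds by \<epsilon>
  are doubled. Its middle inequality holds because neither of the two filters is trivial.\<close>

lemma rel_dim_le:
  fixes \<mu> \<nu> :: "'a::metric_space measure"
  assumes \<mu>: "prob_space \<mu>" and \<epsilon>: "0 < (\<epsilon> :: real)"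
    and ae: "AE x in \<mu>. eventually (\<lambda>r. - ereal \<epsilon> \<le> elog (ball_ratio \<mu> \<nu> x r) / ereal (ln r) \<and>
      elog (ball_ratio \<mu> \<nu> x r) / ereal (ln r) \<le> ereal \<epsilon>) (at_right 0)"
  shows "rel_dim \<mu> \<nu> \<le> ereal (2 * \<epsilon>)"
proof -
  let ?L = "\<lambda>x. Liminf (at_right 0) (\<lambda>r. elog (ball_ratio \<mu> \<nu> x r) / ereal (ln r))"
  let ?U = "\<lambda>x. Limsup (at_right 0) (\<lambda>r. elog (ball_ratio \<mu> \<nu> x r) / ereal (ln r))"
  have nb: "at_right (0::real) \<noteq> bot" by simp
  have LU: "?L x \<le> ?U x" for x by (rule Liminf_le_Limsup[OF nb])
  have "AE x in \<mu>. - ereal \<epsilon> \<le> ?L x"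
    using ae by eventually_elim (intro Liminf_bounded, auto elim: eventually_mono)
  then have 1: "- ereal \<epsilon> \<le> lower_rel_dim \<mu> \<nu>"
    unfolding lower_rel_dim_def by (rule Liminf_bounded)
  have "AE x in \<mu>. ?U x \<le> ereal \<epsilon>"
    using ae by eventually_elim (intro Limsup_bounded, auto elim: eventually_mono)
  then have 2: "upper_rel_dim \<mu> \<nu> \<le> ereal \<epsilon>"
    unfolding upper_rel_dim_def by (rule Limsup_bounded)
  have "lower_rel_dim \<mu> \<nu> \<le> Limsup (ae_filter \<mu>) ?L"
    unfolding lower_rel_dim_def by (rule Liminf_le_Limsup[OF ae_filter_not_bot[OF \<mu>]])
  also have "\<dots> \<le> upper_rel_dim \<mu> \<nu>"
    unfolding upper_rel_dim_def by (rule Limsup_mono) (simp add: LU)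
  finally have 3: "lower_rel_dim \<mu> \<nu> \<le> upper_rel_dim \<mu> \<nu>" .
  have "- ereal (2 * \<epsilon>) < lower_rel_dim \<mu> \<nu>"
    by (rule less_le_trans[OF _ 1]) (use \<epsilon> in simp)
  moreover have "upper_rel_dim \<mu> \<nu> < ereal (2 * \<epsilon>)"
    by (rule le_less_trans[OF 2]) (use \<epsilon> in simp)
  ultimately show ?thesis
    unfolding rel_dim_def using 3 \<epsilon> by (intro Inf_lower) (auto intro!: exI[of _ "2 * \<epsilon>"])
qed

section \<open>Orthogonal projections and the Grassmannian\<close>

lemma orth_proj:
  fixes V :: "(real^'n) set"
  assumes V: "subspace V"
  shows "orth_proj V x \<in> V" and "y \<in> V \<Longrightarrow> (x - orth_proj V x) \<bullet> y = 0"
    and "p \<in> V \<Longrightarrow> (\<And>y. y \<in> V \<Longrightarrow> (x - p) \<bullet> y = 0) \<Longrightarrow> orth_proj V x = p"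
proof -
  have unique: "p = q" if "p \<in> V" "q \<in> V" "\<forall>y\<in>V. (x - p) \<bullet> y = 0" "\<forall>y\<in>V. (x - q) \<bullet> y = 0" for p q
  proof -
    have pq: "p - q \<in> V" using V that by (simp add: subspace_diff)
    have "(p - q) \<bullet> (p - q) = (x - q) \<bullet> (p - q) - (x - p) \<bullet> (p - q)" by (simp add: inner_diff_left)
    also have "\<dots> = 0" using that pq by simp
    finally show ?thesis by simp
  qed
  have sV: "span V = V" using V by (simp add: span_eq_iff)
  obtain q z where q: "q \<in> span V" "\<forall>w\<in>span V. orthogonal z w" "x = q + z"
    using orthogonal_subspace_decomp_exists[of V x] by metis
  then have p: "q \<in> V" "\<forall>y\<in>V. (x - q) \<bullet> y = 0"
    unfolding sV by (auto simp: orthogonal_def)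
  have eq: "orth_proj V x = p" if "p \<in> V" "\<forall>y\<in>V. (x - p) \<bullet> y = 0" for p
    unfolding orth_proj_def
  proof (rule the_equality)
    show "p \<in> V \<and> x - p \<in> orthogonal_comp V"
      using that by (auto simp: orthogonal_comp_def orthogonal_def inner_commute)
    show "q = p" if "q \<in> V \<and> x - q \<in> orthogonal_comp V" for q
      using that \<open>p \<in> V\<close> \<open>\<forall>y\<in>V. (x - p) \<bullet> y = 0\<close>
      by (intro unique) (auto simp: orthogonal_comp_def orthogonal_def inner_commute)
  qed
  show "orth_proj V x \<in> V" "y \<in> V \<Longrightarrow> (x - orth_proj V x) \<bullet> y = 0"
    using eq[OF p] p by auto
  show "p \<in> V \<Longrightarrow> (\<And>y. y \<in> V \<Longrightarrow> (x - p) \<bullet> y = 0) \<Longrightarrow> orth_proj V x = p"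
    by (rule eq) auto
qed

lemma inner_orth_proj: "subspace V \<Longrightarrow> x \<bullet> orth_proj V x = orth_proj V x \<bullet> orth_proj V x"
  using orth_proj(2)[of V "orth_proj V x" x] orth_proj(1)[of V x] by (simp add: inner_diff_left)

lemma norm_orth_proj_le: "subspace V \<Longrightarrow> norm (orth_proj V x) \<le> norm x"
proof -
  assume V: "subspace V"
  have "norm (orth_proj V x) * norm (orth_proj V x) = x \<bullet> orth_proj V x"
    using inner_orth_proj[OF V, of x] by (simp add: dot_square_norm power2_eq_square)
  also have "\<dots> \<le> norm x * norm (orth_proj V x)" by (rule norm_cauchy_schwarz)
  finally show ?thesis by (cases "norm (orth_proj V x) = 0") (auto simp: mult_le_cancel_right)
qed

lemma linear_orth_proj:
  assumes V: "subspace V"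
  shows "linear (orth_proj V)"
proof (rule linearI)
  show "orth_proj V (x + y) = orth_proj V x + orth_proj V y" for x y
  proof (rule orth_proj(3)[OF V])
    show "orth_proj V x + orth_proj V y \<in> V" using V by (intro subspace_add orth_proj(1))
    fix z assume "z \<in> V"
    then show "(x + y - (orth_proj V x + orth_proj V y)) \<bullet> z = 0"
      using orth_proj(2)[OF V, of z x] orth_proj(2)[OF V, of z y] by (simp add: inner_diff_left inner_add_left)
  qed
  show "orth_proj V (c *\<^sub>R x) = c *\<^sub>R orth_proj V x" for c x
  proof (rule orth_proj(3)[OF V])
    show "c *\<^sub>R orth_proj V x \<in> V" using V by (intro subspace_scale orth_proj(1))
    fix z assume "z \<in> V"
    then show "(c *\<^sub>R x - c *\<^sub>R orth_proj V x) \<bullet> z = 0"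
      using orth_proj(2)[OF V, of z x] by (simp add: inner_diff_left scaleR_diff_right[symmetric])
  qed
qed

lemma bounded_linear_orth_proj: "subspace V \<Longrightarrow> bounded_linear (orth_proj V)"
  using linear_orth_proj linear_conv_bounded_linear by blast

lemma orth_proj_diff: "subspace V \<Longrightarrow> orth_proj V (x - y) = orth_proj V x - orth_proj V y"
  by (rule linear_diff[OF linear_orth_proj])

lemma dist_orth_proj_le: "subspace V \<Longrightarrow> dist (orth_proj V x) (orth_proj V y) \<le> dist x y"
  using norm_orth_proj_le[of V "x - y"] by (simp add: dist_norm orth_proj_diff)

lemma borel_orth_proj: "subspace V \<Longrightarrow> orth_proj V \<in> borel_measurable borel"
  by (intro borel_measurable_continuous_onI linear_continuous_on bounded_linear_orth_proj)

lemma orth_proj_image: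
  assumes T: "orthogonal_transformation T" and V: "subspace V"
  shows "orth_proj (T ` V) (T x) = T (orth_proj V x)"
proof (rule orth_proj(3))
  have lin: "linear T" using T by (rule orthogonal_transformation_linear)
  show "subspace (T ` V)" using lin V by (rule linear_subspace_image)
  show "T (orth_proj V x) \<in> T ` V" using orth_proj(1)[OF V] by blast
  fix y assume "y \<in> T ` V"
  then obtain z where z: "z \<in> V" "y = T z" by blast
  have "(T x - T (orth_proj V x)) \<bullet> T z = T (x - orth_proj V x) \<bullet> T z"
    using lin by (simp add: linear_diff)
  also have "\<dots> = (x - orth_proj V x) \<bullet> z" using T by (simp add: orthogonal_transformation_def)
  finally show "(T x - T (orth_proj V x)) \<bullet> y = 0" using orth_proj(2)[OF V z(1)] z(2) by simp
qed

section \<open>Borel structure and orthogonal action on the Grassmannian\<close>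

lemma Grassmannian_subspace: "V \<in> Grassmannian d \<Longrightarrow> subspace V"
  by (simp add: Grassmannian_def)

lemma Blinfun_orth_proj: "V \<in> Grassmannian d \<Longrightarrow> blinfun_apply (Blinfun (orth_proj V)) = orth_proj V"
  by (rule bounded_linear_Blinfun_apply[OF bounded_linear_orth_proj[OF Grassmannian_subspace]])

lemma orth_proj_le_Grassmannian_dist:
  assumes "V \<in> Grassmannian d" "W \<in> Grassmannian d"
  shows "norm (orth_proj V x - orth_proj W x) \<le> Grassmannian_dist V W * norm x"
  using norm_blinfun[of "Blinfun (orth_proj V) - Blinfun (orth_proj W)" x]
  unfolding Grassmannian_dist_def by (simp add: minus_blinfun.rep_eq Blinfun_orth_proj[OF assms(1)] Blinfun_orth_proj[OF assms(2)])

lemma Grassmannian_metric: "Metric_space (Grassmannian d) (Grassmannian_dist :: (real^'n) set \<Rightarrow> _)"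
proof
  fix V W U :: "(real^'n) set"
  show "0 \<le> Grassmannian_dist V W" "Grassmannian_dist V W = Grassmannian_dist W V"
    by (simp_all add: Grassmannian_dist_def norm_minus_commute)
  show "Grassmannian_dist V U \<le> Grassmannian_dist V W + Grassmannian_dist W U"
    unfolding Grassmannian_dist_def
    using norm_triangle_ineq[of "Blinfun (orth_proj V) - Blinfun (orth_proj W)" "Blinfun (orth_proj W) - Blinfun (orth_proj U)"]
    by simp
  assume VW: "V \<in> Grassmannian d" "W \<in> Grassmannian d"
  have "V \<subseteq> W" if "Grassmannian_dist V W = 0" "V \<in> Grassmannian d" "W \<in> Grassmannian d" for V W :: "(real^'n) set"
  proof
    fix x assume x: "x \<in> V"
    then have "orth_proj V x = x" using Grassmannian_subspace[OF that(2)] by (intro orth_proj(3)) auto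
    moreover have "orth_proj V x = orth_proj W x"
      using orth_proj_le_Grassmannian_dist[OF that(2,3), of x] that(1) by simp
    ultimately show "x \<in> W" using orth_proj(1)[OF Grassmannian_subspace[OF that(3)], of x] by simp
  qed
  from this[of V W] this[of W V] show "Grassmannian_dist V W = 0 \<longleftrightarrow> V = W"
    using VW by (auto simp: Grassmannian_dist_def norm_minus_commute)
qed

lemma Grassmannian_open_subset:
  "{U. openin (Metric_space.mtopology (Grassmannian d) Grassmannian_dist) U} \<subseteq> Pow (Grassmannian d :: (real^'n) set set)"
proof -
  interpret Metric_space "Grassmannian d" "Grassmannian_dist :: (real^'n) set \<Rightarrow> _"
    by (rule Grassmannian_metric)
  show ?thesis using openin_subset[of mtopology] by auto
qed

lemma space_Grassmannian_borel: "space (Grassmannian_borel d) = Grassmannian d"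
  unfolding Grassmannian_borel_def by (rule space_measure_of[OF Grassmannian_open_subset])

lemma sets_Grassmannian_borel_open:
  fixes U :: "(real^'n) set set"
  assumes "U \<subseteq> Grassmannian d"
    and "\<And>V. V \<in> U \<Longrightarrow> \<exists>r>0. \<forall>W\<in>Grassmannian d. Grassmannian_dist V W < r \<longrightarrow> W \<in> U"
  shows "U \<in> sets (Grassmannian_borel d)"
proof -
  interpret Metric_space "Grassmannian d" "Grassmannian_dist :: (real^'n) set \<Rightarrow> _"
    by (rule Grassmannian_metric)
  have "openin mtopology U"
    unfolding openin_mtopology
  proof (intro conjI allI impI)
    fix V assume "V \<in> U"
    then obtain r where "r > 0" "\<forall>W\<in>Grassmannian d. Grassmannian_dist V W < r \<longrightarrow> W \<in> U" using assms(2) by blast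
    then show "\<exists>r>0. mball V r \<subseteq> U" by (intro exI[of _ r]) auto
  qed fact
  then show ?thesis
    unfolding Grassmannian_borel_def sets_measure_of[OF Grassmannian_open_subset] by (intro sigma_sets.Basic) simp
qed

text \<open>For fixed \<open>x\<close> the map is Lipschitz with constant \<open>norm x\<close> with
  respect to \<open>Grassmannian_dist\<close>, so its superlevel sets are open.\<close>

lemma borel_orth_proj_component:
  "(\<lambda>V. orth_proj V x $ j) \<in> borel_measurable (Grassmannian_borel d :: (real^'n) set measure)"
proof (rule borel_measurableI_greater)
  fix y
  let ?U = "{V \<in> Grassmannian d. y < orth_proj V x $ j} :: (real^'n) set set"
  have "?U \<in> sets (Grassmannian_borel d)"
  proof (rule sets_Grassmannian_borel_open)
    fix V assume V: "V \<in> ?U"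
    define r where "r = (orth_proj V x $ j - y) / (norm x + 1)"
    have n1: "0 < norm x + 1" using norm_ge_zero[of x] by linarith
    have r: "0 < r" using V n1 by (simp add: r_def)
    have "y < orth_proj W x $ j" if W: "W \<in> Grassmannian d" "Grassmannian_dist V W < r" for W
    proof -
      have "\<bar>(orth_proj V x - orth_proj W x) $ j\<bar> \<le> norm (orth_proj V x - orth_proj W x)" by (rule component_le_norm_cart)
      also have "\<dots> \<le> Grassmannian_dist V W * norm x" using V W by (intro orth_proj_le_Grassmannian_dist) auto
      also have "\<dots> \<le> r * norm x" using W by (intro mult_right_mono) auto
      also have "\<dots> < r * (norm x + 1)" using r by simp
      also have "\<dots> = orth_proj V x $ j - y" using n1 by (simp add: r_def)
      finally show ?thesis by simp
    qed
    then show "\<exists>r>0. \<forall>W\<in>Grassmannian d. Grassmannian_dist V W < r \<longrightarrow> W \<in> ?U" using r by blast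
  qed auto
  then show "{V \<in> space (Grassmannian_borel d). y < orth_proj V x $ j} \<in> sets (Grassmannian_borel d)"
    by (simp only: space_Grassmannian_borel)
qed

text \<open>Under the root stands \<open>z \<bullet> orth_proj V z\<close>, expanded in the matrix
  entries of the projection. This separates \<open>V\<close> from \<open>z\<close> and thus yields
  joint measurability for the later Fubini argument.\<close>

lemma norm_orth_proj_expand:
  fixes V :: "(real^'n) set"
  assumes V: "subspace V"
  shows "norm (orth_proj V z) = sqrt (\<Sum>j\<in>UNIV. \<Sum>i\<in>UNIV. z $ j * (z $ i * orth_proj V (axis i 1) $ j))"
proof -
  have "orth_proj V z = orth_proj V (\<Sum>i\<in>UNIV. z $ i *\<^sub>R axis i 1)"
    by (simp add: basis_expansion scalar_mult_eq_scaleR[symmetric])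
  also have "\<dots> = (\<Sum>i\<in>UNIV. z $ i *\<^sub>R orth_proj V (axis i 1))"
    using linear_orth_proj[OF V] by (simp add: linear_sum linear_scale)
  finally have "orth_proj V z $ j = (\<Sum>i\<in>UNIV. z $ i * orth_proj V (axis i 1) $ j)" for j
    by simp
  then have "z \<bullet> orth_proj V z = (\<Sum>j\<in>UNIV. \<Sum>i\<in>UNIV. z $ j * (z $ i * orth_proj V (axis i 1) $ j))"
    by (simp add: inner_vec_def sum_distrib_left)
  moreover have "norm (orth_proj V z) = sqrt (z \<bullet> orth_proj V z)"
    using inner_orth_proj[OF V, of z] by (simp add: norm_eq_sqrt_inner)
  ultimately show ?thesis by simp
qed

lemma measurable_norm_orth_proj:
  fixes \<gamma> :: "(real^'n) set measure"
  assumes \<gamma>: "sets \<gamma> = sets (Grassmannian_borel d)" and g: "g \<in> measurable M borel"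
  shows "(\<lambda>p. norm (orth_proj (fst p) (g (snd p)))) \<in> borel_measurable (\<gamma> \<Otimes>\<^sub>M M)"
proof -
  have sp: "space \<gamma> = Grassmannian d"
    using sets_eq_imp_space_eq[OF \<gamma>] by (simp add: space_Grassmannian_borel)
  have 1: "(\<lambda>p. orth_proj (fst p) (axis i 1) $ j) \<in> borel_measurable (\<gamma> \<Otimes>\<^sub>M M)" for i j
    using borel_orth_proj_component[of "axis i 1" j d] measurable_cong_sets[OF \<gamma> refl]
    by (intro measurable_compose[OF measurable_fst]) blast
  have 2: "(\<lambda>p. g (snd p) $ i) \<in> borel_measurable (\<gamma> \<Otimes>\<^sub>M M)" for i
  proof -
    have "(\<lambda>x :: real^'n. x $ i) \<in> borel_measurable borel"
      by (intro borel_measurable_continuous_onI continuous_intros)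
    from measurable_compose[OF measurable_compose[OF measurable_snd g] this] show ?thesis .
  qed
  have "(\<lambda>p. sqrt (\<Sum>j\<in>UNIV. \<Sum>i\<in>UNIV. g (snd p) $ j * (g (snd p) $ i * orth_proj (fst p) (axis i 1) $ j)))
      \<in> borel_measurable (\<gamma> \<Otimes>\<^sub>M M)"
    using 1 2 by measurable
  then show ?thesis
    by (rule measurable_cong[THEN iffD1, rotated])
      (auto simp: space_pair_measure sp norm_orth_proj_expand[OF Grassmannian_subspace])
qed

lemma measurable_norm_orth_proj':
  fixes \<gamma> :: "(real^'n) set measure"
  assumes \<gamma>: "sets \<gamma> = sets (Grassmannian_borel d)"
  shows "(\<lambda>V. norm (orth_proj V z)) \<in> borel_measurable \<gamma>"
proof -
  have sp: "space \<gamma> = Grassmannian d"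
    using sets_eq_imp_space_eq[OF \<gamma>] by (simp add: space_Grassmannian_borel)
  have 1: "(\<lambda>V. orth_proj V (axis i 1) $ j) \<in> borel_measurable \<gamma>" for i j
    using borel_orth_proj_component[of "axis i 1" j d] measurable_cong_sets[OF \<gamma> refl] by blast
  have "(\<lambda>V. sqrt (\<Sum>j\<in>UNIV. \<Sum>i\<in>UNIV. z $ j * (z $ i * orth_proj V (axis i 1) $ j))) \<in> borel_measurable \<gamma>"
    using 1 by measurable
  then show ?thesis
    by (rule measurable_cong[THEN iffD1, rotated])
      (auto simp: sp norm_orth_proj_expand[OF Grassmannian_subspace])
qed

lemma Grassmannian_image:
  assumes T: "orthogonal_transformation T" and V: "V \<in> Grassmannian d"
  shows "T ` V \<in> Grassmannian d"
proof -
  have lin: "linear T" using T by (rule orthogonal_transformation_linear)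
  moreover have "inj T" using T by (rule orthogonal_transformation_inj)
  ultimately show ?thesis using V unfolding Grassmannian_def
    by (auto simp: linear_subspace_image dim_image_eq inj_on_subset)
qed

text \<open>The projection onto the image of \<open>V\<close> is the projection onto
  \<open>V\<close> conjugated by \<open>T\<close>; hence the action does not increase
  \<open>Grassmannian_dist\<close> and is continuous.\<close>

lemma measurable_Grassmannian_image:
  fixes T :: "real^'n \<Rightarrow> real^'n"
  assumes T: "orthogonal_transformation T"
  shows "(\<lambda>V. T ` V) \<in> measurable (Grassmannian_borel d) (Grassmannian_borel d)"
proof -
  interpret Metric_space "Grassmannian d" "Grassmannian_dist :: (real^'n) set \<Rightarrow> _"
    by (rule Grassmannian_metric)
  have dist_le: "Grassmannian_dist (T ` V) (T ` W) \<le> Grassmannian_dist V W"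
    if V: "V \<in> Grassmannian d" and W: "W \<in> Grassmannian d" for V W
    unfolding Grassmannian_dist_def[of "T ` V"]
  proof (rule norm_blinfun_bound)
    show "0 \<le> Grassmannian_dist V W" by (rule nonneg)
    fix z
    obtain y where y: "z = T y" using orthogonal_transformation_surj[OF T] by (metis surjD)
    have "blinfun_apply (Blinfun (orth_proj (T ` V)) - Blinfun (orth_proj (T ` W))) z = T (orth_proj V y - orth_proj W y)"
      using Blinfun_orth_proj[OF Grassmannian_image[OF T V]] Blinfun_orth_proj[OF Grassmannian_image[OF T W]]
        linear_diff[OF orthogonal_transformation_linear[OF T]]
      by (simp add: minus_blinfun.rep_eq y orth_proj_image[OF T] Grassmannian_subspace[OF V] Grassmannian_subspace[OF W])
    then have "norm (blinfun_apply (Blinfun (orth_proj (T ` V)) - Blinfun (orth_proj (T ` W))) z) = norm (orth_proj V y - orth_proj W y)"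
      using orthogonal_transformation_norm[OF T] by simp
    also have "\<dots> \<le> Grassmannian_dist V W * norm y" using V W by (rule orth_proj_le_Grassmannian_dist)
    finally show "norm (blinfun_apply (Blinfun (orth_proj (T ` V)) - Blinfun (orth_proj (T ` W))) z) \<le> Grassmannian_dist V W * norm z"
      using orthogonal_transformation_norm[OF T] by (simp add: y)
  qed
  show ?thesis
    unfolding Grassmannian_borel_def[of d] 
  proof (rule measurable_sigma_sets[where A = "{U. openin mtopology U}" and \<Omega> = "Grassmannian d"])
    show "sets (sigma (Grassmannian d) {U. openin mtopology U}) = sigma_sets (Grassmannian d) {U. openin mtopology U}"
      by (rule sets_measure_of[OF Grassmannian_open_subset])
    show "(\<lambda>V. T ` V) \<in> space (sigma (Grassmannian d) {U. openin mtopology U}) \<rightarrow> Grassmannian d"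
      using Grassmannian_image[OF T] unfolding space_measure_of[OF Grassmannian_open_subset] by blast
    fix U assume "U \<in> {U. openin mtopology U}"
    then have U: "U \<subseteq> Grassmannian d" "\<And>V. V \<in> U \<Longrightarrow> \<exists>r>0. mball V r \<subseteq> U" by (auto simp: openin_mtopology)
    have "(\<lambda>V. T ` V) -` U \<inter> Grassmannian d \<in> sets (Grassmannian_borel d)"
    proof (rule sets_Grassmannian_borel_open)
      fix V assume V: "V \<in> (\<lambda>V. T ` V) -` U \<inter> Grassmannian d"
      then obtain r where r: "r > 0" "mball (T ` V) r \<subseteq> U" using U(2) by blast
      have "W \<in> (\<lambda>V. T ` V) -` U \<inter> Grassmannian d" if W: "W \<in> Grassmannian d" "Grassmannian_dist V W < r" for W
      proof -
        have "T ` W \<in> mball (T ` V) r"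
          using V W dist_le[of V W] Grassmannian_image[OF T] by auto
        then show ?thesis using r W by auto
      qed
      then show "\<exists>r>0. \<forall>W\<in>Grassmannian d. Grassmannian_dist V W < r \<longrightarrow> W \<in> (\<lambda>V. T ` V) -` U \<inter> Grassmannian d"
        using r(1) by blast
    qed auto
    then show "(\<lambda>V. T ` V) -` U \<inter> space (sigma (Grassmannian d) {U. openin mtopology U}) \<in> sets (sigma (Grassmannian d) {U. openin mtopology U})"
      unfolding space_measure_of[OF Grassmannian_open_subset] by (simp only: Grassmannian_borel_def)
  qed (rule Grassmannian_open_subset)
qed

section \<open>Small balls for projections\<close>

text \<open>Rounding coordinates along an orthonormal basis of \<open>U\<close> to multiples of
  \<open>r\<close> is injective on \<open>S\<close>: equal roundings allow \<open>3 * r\<close> in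
  each of the \<open>dim U\<close> coordinates of \<open>u - u'\<close>, namely \<open>r\<close>
  from the rounding and \<open>r\<close> from each distance to \<open>U\<close>, and
  \<open>2 * r\<close> for leaving \<open>U\<close>. As \<open>R / r\<close> is at least 1, there
  are at most \<open>5 * R / r\<close> values per coordinate.\<close>

lemma separated_count:
  fixes S :: "'a::euclidean_space set" and r R :: real
  assumes U: "subspace U" and r: "0 < r" "r \<le> R"
    and S: "\<And>x. x \<in> S \<Longrightarrow> norm x \<le> R \<and> (\<exists>u\<in>U. norm (x - u) \<le> r)"
    and sep: "\<And>x y. x \<in> S \<Longrightarrow> y \<in> S \<Longrightarrow> x \<noteq> y \<Longrightarrow> (3 * dim U + 2) * r < dist x y"
  shows "finite S \<and> card S \<le> (5 * R / r) ^ dim U"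
proof -
  obtain B where B: "B \<subseteq> U" "pairwise orthogonal B" "\<And>x. x \<in> B \<Longrightarrow> norm x = 1"
    "independent B" "card B = dim U" "span B = U"
  proof (rule orthonormal_basis_subspace[OF U], goal_cases)
    case (1 B)
    show ?case by (rule 1(1)[OF 1(2-7)])
  qed
  have finB: "finite B" using B(4) by (rule independent_imp_finite)
  define m where "m = \<lceil>R / r\<rceil>"
  define c where "c x = (\<lambda>b\<in>B. \<lfloor>x \<bullet> b / r\<rfloor>)" for x
  have inner_le: "\<bar>w \<bullet> b\<bar> \<le> norm w" if "b \<in> B" for w b
    using Cauchy_Schwarz_ineq2[of w b] B(3)[OF that] by simp
  have "c ` S \<subseteq> PiE B (\<lambda>_. {- m..m})"
  proof (rule image_subsetI)
    fix x assume x: "x \<in> S"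
    have "\<lfloor>x \<bullet> b / r\<rfloor> \<in> {- m..m}" if b: "b \<in> B" for b
    proof -
      have "\<bar>x \<bullet> b\<bar> \<le> R" using inner_le[OF b, of x] S[OF x] by linarith
      then have "\<bar>x \<bullet> b / r\<bar> \<le> R / r" using r by (simp add: divide_right_mono)
      moreover have "R / r \<le> real_of_int m" unfolding m_def by (rule le_of_int_ceiling)
      ultimately have "- real_of_int m \<le> x \<bullet> b / r" "x \<bullet> b / r \<le> real_of_int m" by linarith+
      then show ?thesis by (simp add: le_floor_iff floor_le_iff)
    qed
    then show "c x \<in> PiE B (\<lambda>_. {- m..m})" by (auto simp: c_def)
  qed
  moreover have "inj_on c S"
  proof (rule inj_onI, rule ccontr)
    fix x y assume xy: "x \<in> S" "y \<in> S" "c x = c y" "x \<noteq> y"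
    obtain u u' where u: "u \<in> U" "norm (x - u) \<le> r" "u' \<in> U" "norm (y - u') \<le> r"
      using S[OF xy(1)] S[OF xy(2)] by blast
    have comp: "\<bar>(u - u') \<bullet> b\<bar> \<le> 3 * r" if b: "b \<in> B" for b
    proof -
      have "\<lfloor>x \<bullet> b / r\<rfloor> = \<lfloor>y \<bullet> b / r\<rfloor>" using fun_cong[OF xy(3), of b] b by (simp add: c_def)
      then have "\<bar>x \<bullet> b / r - y \<bullet> b / r\<bar> \<le> 1" by linarith
      then have "\<bar>(x - y) \<bullet> b / r\<bar> \<le> 1" by (simp add: inner_diff_left diff_divide_distrib)
      then have "\<bar>(x - y) \<bullet> b\<bar> \<le> r" using r by (simp add: abs_divide divide_le_eq)
      moreover have "(u - u') \<bullet> b = (x - y) \<bullet> b - (x - u) \<bullet> b + (y - u') \<bullet> b" by (simp add: inner_diff_left)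
      moreover have "\<bar>(x - u) \<bullet> b\<bar> \<le> r" "\<bar>(y - u') \<bullet> b\<bar> \<le> r"
        using inner_le[OF b, of "x - u"] inner_le[OF b, of "y - u'"] u by linarith+
      ultimately show ?thesis by linarith
    qed
    have "u - u' = (\<Sum>b\<in>B. ((u - u') \<bullet> b) *\<^sub>R b)"
      using B u finB U by (intro orthonormal_basis_expand[symmetric]) (auto simp: subspace_diff)
    then have "norm (u - u') = norm (\<Sum>b\<in>B. ((u - u') \<bullet> b) *\<^sub>R b)" by (rule arg_cong)
    also have "\<dots> \<le> (\<Sum>b\<in>B. norm (((u - u') \<bullet> b) *\<^sub>R b))" by (rule norm_sum)
    also have "\<dots> \<le> (\<Sum>b\<in>B. 3 * r)" using comp B(3) by (intro sum_mono) simp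
    finally have "norm (u - u') \<le> (\<Sum>b\<in>B. 3 * r)" .
    then have "norm (u - u') \<le> 3 * dim U * r" using B(5) by simp
    moreover have "dist x y \<le> norm (x - u) + norm (u - u') + norm (y - u')"
      using norm_triangle_ineq[of "x - u" "u - u'"] norm_triangle_ineq4[of "x - u'" "y - u'"]
      by (simp add: dist_norm)
    ultimately have "dist x y \<le> (3 * dim U + 2) * r" using u by (simp add: algebra_simps)
    then show False using sep[OF xy(1,2,4)] by simp
  qed
  moreover have fin: "finite (PiE B (\<lambda>_. {- m..m}))" using finB by (intro finite_PiE) auto
  ultimately have "finite S" "card S \<le> card (PiE B (\<lambda>_. {- m..m}))"
    using inj_on_finite card_inj_on_le by blast+
  moreover have "real (card (PiE B (\<lambda>_. {- m..m}))) \<le> (5 * R / r) ^ dim U"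
  proof -
    have m: "1 \<le> R / r" "real_of_int m \<le> R / r + 1" using r by (auto simp: m_def)
    have "0 \<le> m" using m(1) unfolding m_def by linarith
    have "card (PiE B (\<lambda>_. {- m..m})) = nat (2 * m + 1) ^ dim U"
      using B(5) finB by (simp add: card_PiE)
    also have "real \<dots> = (real_of_int (2 * m + 1)) ^ dim U" using \<open>0 \<le> m\<close> by simp
    also have "\<dots> \<le> (5 * R / r) ^ dim U" using m \<open>0 \<le> m\<close> by (intro power_mono) auto
    finally show ?thesis .
  qed
  ultimately show ?thesis by (meson of_nat_mono order_trans)
qed

text \<open>Invariance makes the probability below independent of \<open>u\<close>; averaging it over the points of a fine
  grid turns the bound into a count of grid points near the orthogonal complement of \<open>V\<close>.\<close>

lemma small_ball:
  fixes \<gamma> :: "(real^'n) set measure"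
  assumes \<gamma>: "invariant_Grassmannian_measure d \<gamma>" and d: "d \<le> CARD('n)"
  shows "\<exists>C>0. \<forall>\<delta>>0. \<forall>u. u \<noteq> 0 \<longrightarrow>
    measure \<gamma> {V \<in> Grassmannian d. norm (orth_proj V u) \<le> \<delta> * norm u} \<le> C * \<delta> ^ d"
proof -
  have sets: "sets \<gamma> = sets (Grassmannian_borel d)" and "prob_space \<gamma>"
    and inv: "\<And>T. orthogonal_transformation T \<Longrightarrow> distr \<gamma> \<gamma> (\<lambda>V. T ` V) = \<gamma>"
    using \<gamma> unfolding invariant_Grassmannian_measure_def by auto
  interpret prob_space \<gamma> by fact
  have sp: "space \<gamma> = Grassmannian d"
    using sets_eq_imp_space_eq[OF sets] by (simp add: space_Grassmannian_borel)
  have meas: "{V \<in> Grassmannian d. norm (orth_proj V u) \<le> a} \<in> sets \<gamma>" for u :: "real^'n" and a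
    using measurable_norm_orth_proj'[OF sets, of u] unfolding sp[symmetric] by measurable
  define Q where "Q u \<delta> = {V \<in> Grassmannian d. norm (orth_proj V u) \<le> \<delta> * norm u}" for u :: "real^'n" and \<delta>
  have Q_scale: "Q (c *\<^sub>R u) \<delta> = Q u \<delta>" if "0 < c" for c u \<delta>
    unfolding Q_def using that
    by (auto simp: linear_scale[OF linear_orth_proj[OF Grassmannian_subspace]] mult.left_commute)
  \<comment> \<open>The sets \<open>Q\<close> ignore positive scaling, and the orthogonal group acts
    transitively on spheres.\<close>
  have Q_const: "measure \<gamma> (Q u \<delta>) = measure \<gamma> (Q v \<delta>)" if "u \<noteq> 0" "v \<noteq> 0" for u v \<delta>
  proof -
    define w where "w = (norm u / norm v) *\<^sub>R v"
    have "norm u = norm w" using that by (simp add: w_def)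
    then obtain T where T: "orthogonal_transformation T" "T u = w" by (rule orthogonal_transformation_exists)
    have Tm: "(\<lambda>V. T ` V) \<in> measurable \<gamma> \<gamma>"
      using measurable_Grassmannian_image[OF T(1), of d] measurable_cong_sets[OF sets sets] by blast
    have "measure \<gamma> (Q v \<delta>) = measure \<gamma> (Q w \<delta>)"
      unfolding w_def using that by (subst Q_scale) auto
    also have "\<dots> = measure (distr \<gamma> \<gamma> (\<lambda>V. T ` V)) (Q w \<delta>)" using inv[OF T(1)] by simp
    also have "\<dots> = measure \<gamma> ((\<lambda>V. T ` V) -` Q w \<delta> \<inter> space \<gamma>)"
      by (rule measure_distr[OF Tm]) (simp add: Q_def meas)
    also have "(\<lambda>V. T ` V) -` Q w \<delta> \<inter> space \<gamma> = Q u \<delta>"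
      unfolding Q_def sp T(2)[symmetric]
      by (auto simp: Grassmannian_image[OF T(1)] orth_proj_image[OF T(1) Grassmannian_subspace] orthogonal_transformation_norm[OF T(1)])
    finally show ?thesis by simp
  qed
  define n where "n = CARD('n)"
  define e where "e = n - d"
  \<comment> \<open>Grid spacing in units of \<delta>: just above the separation
    \<open>3 * dim U + 2\<close> that \<open>separated_count\<close> demands for a complement of
    dimension \<open>e\<close>.\<close>
  define L where "L = real (3 * e + 3)"
  have n: "1 \<le> n" by (simp add: n_def Suc_leI)
  have L: "3 \<le> L" by (simp add: L_def)
  have nL: "1 \<le> real n * L" using mult_mono[of 1 "real n" 1 L] n L by simp
  define C1 where "C1 = 5 ^ e * (2 * n * L) ^ n"
  \<comment> \<open>The second summand makes the bound trivial for those \<delta> that are too large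
    for the grid.\<close>
  define C where "C = C1 + (n * L) ^ d"
  have C1: "0 < C1" using n L by (simp add: C1_def)
  have C: "0 < C" using C1 n L by (simp add: C_def add_pos_nonneg)
  have bound: "measure \<gamma> (Q u \<delta>) \<le> C * \<delta> ^ d" if \<delta>: "0 < \<delta>" and u: "u \<noteq> 0" for u \<delta>
  proof (cases "n * L * \<delta> \<le> 1")
    case False
    have "measure \<gamma> (Q u \<delta>) \<le> 1" by simp
    also have "1 \<le> (n * L * \<delta>) ^ d" using False by (intro one_le_power) simp
    also have "\<dots> = (n * L) ^ d * \<delta> ^ d" by (rule power_mult_distrib)
    also have "\<dots> \<le> C * \<delta> ^ d" using C1 \<delta> by (intro mult_right_mono) (auto simp: C_def)
    finally show ?thesis .
  next
    case True
    define s where "s = L * \<delta>"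
    have s: "0 < s" "n * s \<le> 1" using True L \<delta> by (auto simp: s_def mult.assoc)
    have ns: "0 < n * s" using s n by simp
    have \<delta>1: "\<delta> \<le> 1"
    proof -
      have "1 * \<delta> \<le> n * L * \<delta>" using nL \<delta> by (intro mult_right_mono) auto
      then show ?thesis using True by linarith
    qed
    \<comment> \<open>Coordinates up to \<open>1 / n\<close> keep the sum norm, and hence the norm,
      of grid points at most 1. The indices start at 1 so that no grid point is the zero
      vector.\<close>
    define M where "M = nat \<lfloor>1 / (n * s)\<rfloor>"
    have q1: "1 \<le> 1 / (n * s)" using s ns by (simp add: pos_le_divide_eq)
    have "1 \<le> \<lfloor>1 / (n * s)\<rfloor>" using q1 by linarith
    moreover have "real (nat z) = real_of_int z \<and> 1 \<le> nat z" if "1 \<le> z" for z using that by auto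
    ultimately have "real M = real_of_int \<lfloor>1 / (n * s)\<rfloor>" "1 \<le> M" unfolding M_def by blast+
    then have M: "1 \<le> M" "real M \<le> 1 / (n * s)" "1 / (n * s) \<le> 2 * real M"
      using \<open>1 \<le> \<lfloor>1 / (n * s)\<rfloor>\<close> by linarith+
    define K where "K = PiE (UNIV :: 'n set) (\<lambda>_. {1..M})"
    define g :: "('n \<Rightarrow> nat) \<Rightarrow> real^'n" where "g k = (\<chi> i. s * real (k i))" for k
    have finK: "finite K" unfolding K_def by (intro finite_PiE) auto
    have cardK: "card K = M ^ n" by (simp add: K_def card_PiE n_def)
    have Kb: "1 \<le> k i" "k i \<le> M" if "k \<in> K" for k i using that by (auto simp: K_def PiE_def Pi_def)
    have sep: "s \<le> dist (g k) (g k')" if kk: "k \<noteq> k'" for k k'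
    proof -
      obtain i where i: "k i \<noteq> k' i" using kk by blast
      have "1 \<le> \<bar>real (k i) - real (k' i)\<bar>" using i by linarith
      then have "s * 1 \<le> s * \<bar>real (k i) - real (k' i)\<bar>" using s by (intro mult_left_mono) auto
      also have "\<dots> = \<bar>(g k - g k') $ i\<bar>" using s by (simp add: g_def abs_mult right_diff_distrib[symmetric])
      also have "\<dots> \<le> dist (g k) (g k')" unfolding dist_norm by (rule component_le_norm_cart)
      finally show ?thesis by simp
    qed
    have inj: "inj_on g K" using sep s by (intro inj_onI) (metis dist_self not_le)
    have g_ne: "g k \<noteq> 0" if "k \<in> K" for k
    proof
      assume "g k = 0"
      then have "g k $ undefined = 0" by simp
      then show False using Kb(1)[OF that, of undefined] s by (simp add: g_def)
    qed
    have g_norm: "norm (g k) \<le> 1" if "k \<in> K" for k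
    proof -
      have "norm (g k) \<le> (\<Sum>i\<in>UNIV. \<bar>g k $ i\<bar>)" by (rule norm_le_l1_cart)
      also have "\<dots> \<le> (\<Sum>i\<in>(UNIV :: 'n set). s * M)"
        using Kb(2)[OF that] s by (intro sum_mono) (simp add: g_def)
      also have "\<dots> = n * s * M" by (simp add: n_def)
      also have "\<dots> \<le> n * s * (1 / (n * s))" using M(2) ns by (intro mult_left_mono) auto
      also have "\<dots> = 1" by (simp only: times_divide_eq_right mult_1_right divide_self[OF less_imp_neq[OF ns, symmetric]])
      finally show ?thesis .
    qed
    \<comment> \<open>Grid points with projection at most \<delta> lie within \<delta> of the
      orthogonal complement, of dimension \<open>e\<close>, so their number is of order
      \<open>\<delta>\<close> to the power \<open>- e\<close> for every \<open>V\<close>. Compared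
      with all \<open>M ^ n\<close> grid points this is a proportion of order
      \<open>\<delta> ^ d\<close>.\<close>
    have count: "(\<Sum>k\<in>K. indicator {V \<in> Grassmannian d. norm (orth_proj V (g k)) \<le> \<delta>} V) \<le> (5 / \<delta>) ^ e"
      if V: "V \<in> Grassmannian d" for V
    proof -
      let ?U = "{y \<in> UNIV. \<forall>x\<in>V. orthogonal x y}"
      let ?S = "g ` {k \<in> K. norm (orth_proj V (g k)) \<le> \<delta>}"
      have sV: "subspace V" using V by (rule Grassmannian_subspace)
      have "subspace ?U" using subspace_orthogonal_comp[of V] by (simp add: orthogonal_comp_def)
      have "dim ?U + dim V = dim (UNIV :: (real^'n) set)"
        by (rule dim_subspace_orthogonal_to_vectors[OF sV subspace_UNIV]) simp
      then have dimU: "dim ?U = e" using V by (simp add: Grassmannian_def e_def n_def)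
      have "finite ?S \<and> card ?S \<le> (5 * 1 / \<delta>) ^ dim ?U"
      proof (rule separated_count[OF \<open>subspace ?U\<close> \<delta> \<delta>1])
        fix x assume "x \<in> ?S"
        then obtain k where k: "k \<in> K" "norm (orth_proj V x) \<le> \<delta>" "x = g k" by blast
        have "x - orth_proj V x \<in> ?U"
          using orth_proj(2)[OF sV, of _ x] by (auto simp: orthogonal_def inner_commute)
        then show "norm x \<le> 1 \<and> (\<exists>u\<in>?U. norm (x - u) \<le> \<delta>)"
          using k g_norm by (intro conjI bexI[of _ "x - orth_proj V x"]) auto
      next
        fix x y assume xy: "x \<in> ?S" "y \<in> ?S" "x \<noteq> y"
        then obtain k k' where kk: "x = g k" "y = g k'" by blast
        then have "s \<le> dist x y" using sep[of k k'] xy(3) by auto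
        moreover have "(3 * dim ?U + 2) * \<delta> < s" unfolding dimU s_def L_def using \<delta> by (intro mult_strict_right_mono) auto
        ultimately show "(3 * dim ?U + 2) * \<delta> < dist x y" by linarith
      qed
      moreover have "card ?S = card {k \<in> K. norm (orth_proj V (g k)) \<le> \<delta>}"
        using inj by (intro card_image) (auto intro: inj_on_subset)
      moreover have "(\<Sum>k\<in>K. indicator {V \<in> Grassmannian d. norm (orth_proj V (g k)) \<le> \<delta>} V) = real (card {k \<in> K. norm (orth_proj V (g k)) \<le> \<delta>})"
        using V finK by (simp add: indicator_def sum.If_cases Int_def)
      ultimately show ?thesis unfolding dimU by simp
    qed
    have "(\<Sum>k\<in>K. measure \<gamma> (Q (g k) \<delta>)) = (\<Sum>k\<in>K. measure \<gamma> (Q u \<delta>))"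
      by (intro sum.cong refl Q_const g_ne u)
    then have "M ^ n * measure \<gamma> (Q u \<delta>) = (\<Sum>k\<in>K. measure \<gamma> (Q (g k) \<delta>))"
      by (simp add: cardK)
    also have "\<dots> \<le> (\<Sum>k\<in>K. measure \<gamma> {V \<in> Grassmannian d. norm (orth_proj V (g k)) \<le> \<delta>})"
    proof (intro sum_mono finite_measure_mono meas)
      fix k assume "k \<in> K"
      have "\<delta> * norm (g k) \<le> \<delta>" using g_norm[OF \<open>k \<in> K\<close>] \<delta> by (simp add: mult_left_le)
      then show "Q (g k) \<delta> \<subseteq> {V \<in> Grassmannian d. norm (orth_proj V (g k)) \<le> \<delta>}" unfolding Q_def by auto
    qed
    also have "\<dots> = (\<integral>V. (\<Sum>k\<in>K. indicator {V \<in> Grassmannian d. norm (orth_proj V (g k)) \<le> \<delta>} V) \<partial>\<gamma>)"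
      using meas by (subst Bochner_Integration.integral_sum) (auto simp: emeasure_eq_measure)
    also have "\<dots> \<le> (\<integral>V. (5 / \<delta>) ^ e \<partial>\<gamma>)"
      by (rule integral_mono) (use meas count in \<open>auto simp: emeasure_eq_measure sp\<close>)
    also have "\<dots> = (5 / \<delta>) ^ e" by (simp add: prob_space)
    finally have main: "M ^ n * measure \<gamma> (Q u \<delta>) \<le> (5 / \<delta>) ^ e" by simp
    have "1 \<le> 2 * (n * s) * M" using M(3) ns by (simp add: pos_divide_le_eq mult.commute mult.left_commute)
    then have "1 \<le> (2 * (n * s) * M) ^ n" by (rule one_le_power)
    then have "measure \<gamma> (Q u \<delta>) \<le> (2 * (n * s) * M) ^ n * measure \<gamma> (Q u \<delta>)"
      using mult_right_mono[of 1 "(2 * (n * s) * M) ^ n" "measure \<gamma> (Q u \<delta>)"] by simp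
    also have "\<dots> = (2 * (n * s)) ^ n * (M ^ n * measure \<gamma> (Q u \<delta>))" by (simp add: power_mult_distrib)
    also have "\<dots> \<le> (2 * (n * s)) ^ n * (5 / \<delta>) ^ e" using main ns by (intro mult_left_mono) auto
    also have "\<dots> = C1 * (\<delta> ^ n / \<delta> ^ e)"
      by (simp add: C1_def s_def power_mult_distrib power_divide)
    also have "\<delta> ^ n / \<delta> ^ e = \<delta> ^ d"
    proof -
      have "n = d + e" using d by (simp add: e_def n_def)
      then show ?thesis using \<delta> by (simp add: power_add)
    qed
    also have "C1 * \<delta> ^ d \<le> C * \<delta> ^ d" using n L \<delta> by (intro mult_right_mono) (auto simp: C_def)
    finally show ?thesis .
  qed
  then show ?thesis unfolding Q_def using C by blast
qed

section \<open>Projections of measures\<close>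

text \<open>In \<open>projection_ball_bound\<close> regularity passes from a good point to its
  neighbours, whose balls of index \<open>i\<close> lie in balls of index \<open>i - 1\<close>
  around the good point. This is the origin of \<open>real i - 1\<close> and of the strict
  inequality \<open>j < i\<close>.\<close>

definition regular_points :: "(real^'n) measure \<Rightarrow> real \<Rightarrow> nat \<Rightarrow> nat \<Rightarrow> (real^'n) set" where
  "regular_points \<nu> t j k = {y. \<forall>i\<in>{j<..k}. ball_measure \<nu> y i \<le> 2 powr (- t * (real i - 1))}"

text \<open>A substitute, at one scale, for the energy of the projected measure. The radius is
  doubled so that both points may move by an eighth of \<open>(1 / 2) ^ k\<close>.\<close>

definition near_pairs :: "(real^'n) measure \<Rightarrow> real \<Rightarrow> nat \<Rightarrow> (real^'n) set \<Rightarrow> nat \<Rightarrow> ennreal" where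
  "near_pairs \<nu> t j V k = emeasure (\<nu> \<Otimes>\<^sub>M \<nu>)
     {p. fst p \<in> regular_points \<nu> t j k \<and> norm (orth_proj V (fst p - snd p)) < 2 * (1 / 2) ^ k}"

lemma sets_regular_points:
  assumes "finite_measure \<nu>" "sets \<nu> = sets borel"
  shows "regular_points \<nu> t j k \<in> sets borel"
proof -
  have "regular_points \<nu> t j k = {y \<in> space borel. \<forall>i\<in>{j<..k}. ball_measure \<nu> y i \<le> 2 powr (- t * (real i - 1))}"
    by (simp add: regular_points_def)
  also have "\<dots> \<in> sets borel"
    by (rule sets.sets_Collect_finite_All) (use sets_ball_measure(1)[OF assms] in auto)
  finally show ?thesis .
qed

text \<open>Take the largest \<open>i\<close> up to \<open>k\<close> with
  \<open>dist y y' < (1 / 2) ^ i\<close>, or \<open>i = j\<close> for far pairs. Unless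
  \<open>i = k\<close>, the distance is at least half of \<open>(1 / 2) ^ i\<close>, and the small
  ball estimate gives the weight at \<open>i\<close>; the ratio of radii produces
  \<open>4 ^ d\<close>. Summing over all scales prepares the integration over
  \<open>y'\<close>.\<close>

lemma small_ball_sum:
  fixes \<gamma> :: "(real^'n) set measure"
  assumes \<gamma>: "prob_space \<gamma>" and sets: "sets \<gamma> = sets (Grassmannian_borel d)" and C: "0 < C"
    and small: "\<And>\<delta> u. 0 < \<delta> \<Longrightarrow> u \<noteq> 0 \<Longrightarrow> measure \<gamma> {V \<in> Grassmannian d. norm (orth_proj V u) \<le> \<delta> * norm u} \<le> C * \<delta> ^ d"
    and jk: "j \<le> k"
  shows "measure \<gamma> {V \<in> Grassmannian d. norm (orth_proj V (y - y')) < 2 * (1 / 2) ^ k} \<le>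
    (\<Sum>i\<in>{j..k}. max 1 (C * 4 ^ d) * 2 powr (- real d * (real k - real i)) *
      (if i = j then 1 else indicator (ball y ((1 / 2) ^ i)) y'))"
    (is "measure \<gamma> ?Z \<le> (\<Sum>i\<in>_. ?w i * ?b i)")
proof -
  interpret prob_space \<gamma> by fact
  have sp: "space \<gamma> = Grassmannian d"
    using sets_eq_imp_space_eq[OF sets] by (simp add: space_Grassmannian_borel)
  define I where "I = {i \<in> {j..k}. i = j \<or> dist y y' < (1 / 2) ^ i}"
  have I: "finite I" "I \<noteq> {}" using jk by (auto simp: I_def)
  define i where "i = Max I"
  have i: "i \<in> I" unfolding i_def using I by (rule Max_in)
  then have ijk: "i \<in> {j..k}" and b: "?b i = 1" by (auto simp: I_def)
  have far: "(1 / 2) ^ Suc i \<le> dist y y'" if "i \<noteq> k"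
  proof -
    have "Suc i \<notin> I" using Max_ge[OF I(1), of "Suc i"] unfolding i_def[symmetric] by auto
    then show ?thesis using ijk that unfolding I_def by auto
  qed
  have "measure \<gamma> ?Z \<le> ?w i"
  proof (cases "i = k")
    case True
    have "measure \<gamma> ?Z \<le> max 1 (C * 4 ^ d)" by (rule order_trans[OF prob_le_1 max.cobounded1])
    then show ?thesis using True by simp
  next
    case False
    note far = far[OF this]
    have "0 < dist y y'" by (rule less_le_trans[OF _ far]) simp
    then have u: "0 < norm (y - y')" by (simp only: dist_norm)
    define \<delta> where "\<delta> = 2 * (1 / 2) ^ k / norm (y - y')"
    have \<delta>: "0 < \<delta>" using u by (simp add: \<delta>_def)
    have "\<delta> \<le> 2 * (1 / 2) ^ k / (1 / 2) ^ Suc i"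
      unfolding \<delta>_def using far u by (intro divide_left_mono mult_pos_pos) (auto simp: dist_norm)
    also have "\<dots> = 4 * 2 powr (- (real k - real i))"
      unfolding half_power_powr by (simp add: powr_diff powr_minus powr_add field_simps)
    finally have \<delta>_le: "\<delta> \<le> 4 * 2 powr (- (real k - real i))" .
    have "?Z \<subseteq> {V \<in> Grassmannian d. norm (orth_proj V (y - y')) \<le> \<delta> * norm (y - y')}"
      using u by (auto simp: \<delta>_def)
    moreover have "{V \<in> Grassmannian d. norm (orth_proj V (y - y')) \<le> \<delta> * norm (y - y')} \<in> sets \<gamma>"
      using measurable_norm_orth_proj'[OF sets, of "y - y'"] unfolding sp[symmetric] by measurable
    ultimately have "measure \<gamma> ?Z \<le> measure \<gamma> {V \<in> Grassmannian d. norm (orth_proj V (y - y')) \<le> \<delta> * norm (y - y')}"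
      by (rule finite_measure_mono)
    also have "\<dots> \<le> C * \<delta> ^ d" using \<delta> u by (intro small) auto
    also have "\<dots> \<le> C * (4 * 2 powr (- (real k - real i))) ^ d"
      using C \<delta> \<delta>_le by (intro mult_left_mono power_mono) auto
    also have "\<dots> = C * 4 ^ d * 2 powr (- real d * (real k - real i))"
      by (simp add: power_mult_distrib powr_realpow[symmetric] powr_powr algebra_simps)
    also have "\<dots> \<le> ?w i" by (intro mult_right_mono) auto
    finally show ?thesis .
  qed
  also have "\<dots> = ?w i * ?b i" using b by simp
  also have "\<dots> \<le> (\<Sum>i\<in>{j..k}. ?w i * ?b i)"
    using ijk by (intro member_le_sum) auto
  finally show ?thesis .
qed

text \<open>Since \<open>t \<le> d\<close>, scale \<open>i\<close> contributes at most
  \<open>2 powr (- t * (k - i))\<close> times \<open>2 powr (- t * (i - 1))\<close>, which no longer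
  depends on \<open>i\<close>; the number of scales gives the factor \<open>real k + 1\<close>. At
  \<open>i = j\<close> the total mass replaces the ball, at the cost of
  \<open>2 powr (t * j)\<close>.\<close>

lemma small_ball_integral:
  fixes \<gamma> :: "(real^'n) set measure" and \<nu> :: "(real^'n) measure"
  assumes \<gamma>: "prob_space \<gamma>" and sets: "sets \<gamma> = sets (Grassmannian_borel d)" and C: "0 < C"
    and small: "\<And>\<delta> u. 0 < \<delta> \<Longrightarrow> u \<noteq> 0 \<Longrightarrow> measure \<gamma> {V \<in> Grassmannian d. norm (orth_proj V u) \<le> \<delta> * norm u} \<le> C * \<delta> ^ d"
    and \<nu>: "finite_measure \<nu>" "sets \<nu> = sets borel"
    and jk: "j \<le> k" and t: "0 \<le> t" "t \<le> d" and y: "y \<in> regular_points \<nu> t j k"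
  shows "(\<integral>\<^sup>+ y'. emeasure \<gamma> {V \<in> Grassmannian d. norm (orth_proj V (y - y')) < 2 * (1 / 2) ^ k} \<partial>\<nu>)
    \<le> ennreal (max 1 (C * 4 ^ d) * (2 powr t + measure \<nu> (space \<nu>) * 2 powr (t * j)) * (real k + 1) * 2 powr (- t * k))"
proof -
  interpret \<gamma>: prob_space \<gamma> by fact
  interpret \<nu>: finite_measure \<nu> by fact
  let ?w = "\<lambda>i. max 1 (C * 4 ^ d) * 2 powr (- real d * (real k - real i))"
  let ?b = "\<lambda>i y'. if i = j then 1 else indicator (ball y ((1 / 2) ^ i)) y' :: real"
  let ?D = "max 1 (C * 4 ^ d) * (2 powr t + measure \<nu> (space \<nu>) * 2 powr (t * j))"
  have b_int: "integrable \<nu> (?b i)" for i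
    by (cases "i = j") (auto simp: \<nu> \<nu>.emeasure_eq_measure)
  have "(\<integral>\<^sup>+ y'. emeasure \<gamma> {V \<in> Grassmannian d. norm (orth_proj V (y - y')) < 2 * (1 / 2) ^ k} \<partial>\<nu>)
      \<le> (\<integral>\<^sup>+ y'. ennreal (\<Sum>i\<in>{j..k}. ?w i * ?b i y') \<partial>\<nu>)"
    unfolding \<gamma>.emeasure_eq_measure
    by (intro nn_integral_mono ennreal_leI small_ball_sum[OF \<gamma> sets C small jk])
  also have "\<dots> = ennreal (\<integral>y'. (\<Sum>i\<in>{j..k}. ?w i * ?b i y') \<partial>\<nu>)"
  proof (rule nn_integral_eq_integral)
    show "integrable \<nu> (\<lambda>y'. \<Sum>i\<in>{j..k}. ?w i * ?b i y')"
      by (intro Bochner_Integration.integrable_sum integrable_mult_right b_int)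
    show "AE y' in \<nu>. 0 \<le> (\<Sum>i\<in>{j..k}. ?w i * ?b i y')"
      by (intro AE_I2 sum_nonneg mult_nonneg_nonneg) auto
  qed
  also have "(\<integral>y'. (\<Sum>i\<in>{j..k}. ?w i * ?b i y') \<partial>\<nu>) = (\<Sum>i\<in>{j..k}. ?w i * (\<integral>y'. ?b i y' \<partial>\<nu>))"
    using b_int by (subst Bochner_Integration.integral_sum) auto
  also have "\<dots> \<le> (\<Sum>i\<in>{j..k}. ?D * 2 powr (- t * k))"
  proof (rule sum_mono)
    fix i assume i: "i \<in> {j..k}"
    let ?c = "max 1 (C * 4 ^ d)"
    have "t * (real k - real i) \<le> d * (real k - real i)" using t i by (intro mult_right_mono) auto
    then have w: "?w i \<le> ?c * 2 powr (- t * (real k - real i))"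
      by (intro mult_left_mono) auto
    show "?w i * (\<integral>y'. ?b i y' \<partial>\<nu>) \<le> ?D * 2 powr (- t * k)"
    proof (cases "i = j")
      case True
      then have "?w i * (\<integral>y'. ?b i y' \<partial>\<nu>) = ?w i * measure \<nu> (space \<nu>)" by simp
      also have "\<dots> \<le> ?c * 2 powr (- t * (real k - real i)) * measure \<nu> (space \<nu>)"
        using w by (rule mult_right_mono) simp
      also have "2 powr (- t * (real k - real i)) = 2 powr (t * j) * 2 powr (- t * k)"
        unfolding powr_add[symmetric] True by (rule arg_cong[where f = "\<lambda>x. 2 powr x"]) (simp add: algebra_simps)
      also have "?c * (2 powr (t * j) * 2 powr (- t * k)) * measure \<nu> (space \<nu>) =
          ?c * (measure \<nu> (space \<nu>) * 2 powr (t * j)) * 2 powr (- t * k)" by (simp only: ac_simps)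
      also have "\<dots> \<le> ?D * 2 powr (- t * k)" by (intro mult_right_mono mult_left_mono) auto
      finally show ?thesis .
    next
      case False
      have "(\<integral>y'. ?b i y' \<partial>\<nu>) = ball_measure \<nu> y i"
        using False \<nu>(2) by (simp add: ball_measure_def)
      also have "\<dots> \<le> 2 powr (- t * (real i - 1))"
        using y i False unfolding regular_points_def by auto
      finally have I: "(\<integral>y'. ?b i y' \<partial>\<nu>) \<le> 2 powr (- t * (real i - 1))" .
      have "0 \<le> (\<integral>y'. ?b i y' \<partial>\<nu>)" by (rule Bochner_Integration.integral_nonneg) simp
      then have "?w i * (\<integral>y'. ?b i y' \<partial>\<nu>) \<le> ?c * 2 powr (- t * (real k - real i)) * 2 powr (- t * (real i - 1))"
        by (intro mult_mono[OF w I] mult_nonneg_nonneg) simp_all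
      also have "\<dots> = ?c * (2 powr (- t * (real k - real i)) * 2 powr (- t * (real i - 1)))" by (simp only: mult.assoc)
      also have "2 powr (- t * (real k - real i)) * 2 powr (- t * (real i - 1)) = 2 powr t * 2 powr (- t * k)"
        unfolding powr_add[symmetric] by (rule arg_cong[where f = "\<lambda>x. 2 powr x"]) (simp add: algebra_simps)
      also have "?c * (2 powr t * 2 powr (- t * k)) = ?c * 2 powr t * 2 powr (- t * k)" by (simp only: mult.assoc)
      also have "\<dots> \<le> ?D * 2 powr (- t * k)" by (intro mult_right_mono mult_left_mono) auto
      finally show ?thesis .
    qed
  qed
  also have "\<dots> = real (card {j..k}) * (?D * 2 powr (- t * k))" by simp
  also have "\<dots> \<le> (real k + 1) * (?D * 2 powr (- t * k))"
    by (intro mult_right_mono) auto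
  also have "\<dots> = ?D * (real k + 1) * 2 powr (- t * k)" by (simp only: ac_simps)
  finally show ?thesis by (simp add: ennreal_leI)
qed

text \<open>Fubini over \<open>V\<close> and the pairs bounds the mean of \<open>near_pairs\<close>.
  Markov's inequality and Borel--Cantelli then cost \<epsilon>, which also absorbs the linear factor
  \<open>real k + 1\<close>.\<close>

lemma AE_near_pairs_le:
  fixes \<gamma> :: "(real^'n) set measure" and \<nu> :: "(real^'n) measure" and t \<epsilon> :: real
  assumes \<gamma>: "invariant_Grassmannian_measure d \<gamma>" and d: "d \<le> CARD('n)"
    and \<nu>: "finite_measure \<nu>" "sets \<nu> = sets borel"
    and t: "0 \<le> t" "t \<le> d" and \<epsilon>: "0 < \<epsilon>"
  shows "AE V in \<gamma>. eventually (\<lambda>k. near_pairs \<nu> t j V k \<le> ennreal (2 powr (- (t - \<epsilon>) * k))) sequentially"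
proof -
  have sets: "sets \<gamma> = sets (Grassmannian_borel d)" and prob: "prob_space \<gamma>"
    using \<gamma> unfolding invariant_Grassmannian_measure_def by auto
  obtain C where C: "0 < C" "\<And>\<delta> u. 0 < \<delta> \<Longrightarrow> u \<noteq> 0 \<Longrightarrow>
    measure \<gamma> {V \<in> Grassmannian d. norm (orth_proj V u) \<le> \<delta> * norm u} \<le> C * \<delta> ^ d"
    using small_ball[OF \<gamma> d] by blast
  interpret \<gamma>: prob_space \<gamma> by fact
  interpret \<nu>: finite_measure \<nu> by fact
  interpret \<nu>\<nu>: pair_sigma_finite \<nu> \<nu> ..
  interpret \<gamma>\<nu>: pair_sigma_finite \<gamma> "\<nu> \<Otimes>\<^sub>M \<nu>" ..
  have \<nu>\<nu>_sf: "sigma_finite_measure (\<nu> \<Otimes>\<^sub>M \<nu>)" by unfold_locales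
  have sp: "space \<gamma> = Grassmannian d"
    using sets_eq_imp_space_eq[OF sets] by (simp add: space_Grassmannian_borel)
  have sp\<nu>: "space \<nu> = UNIV" using sets_eq_imp_space_eq[OF \<nu>(2)] by simp
  define D where "D = max 1 (C * 4 ^ d) * (2 powr t + measure \<nu> (space \<nu>) * 2 powr (t * j))"
  have D: "0 \<le> D" unfolding D_def by (intro mult_nonneg_nonneg add_nonneg_nonneg) auto
  let ?F = "regular_points \<nu> t j"
  have Fm: "?F k \<in> sets \<nu>" for k using sets_regular_points[OF \<nu>] \<nu>(2) by simp
  define Q where "Q k = {p \<in> space (\<gamma> \<Otimes>\<^sub>M (\<nu> \<Otimes>\<^sub>M \<nu>)). fst (snd p) \<in> ?F k \<and> norm (orth_proj (fst p) (fst (snd p) - snd (snd p))) < 2 * (1 / 2) ^ k}" for k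
  have diffm: "(\<lambda>p. fst p - snd p) \<in> measurable (\<nu> \<Otimes>\<^sub>M \<nu>) borel"
    using \<nu>(2) by (intro borel_measurable_diff) (auto intro: measurable_compose[OF measurable_fst] measurable_compose[OF measurable_snd] simp: measurable_ident_sets)
  have Qm: "Q k \<in> sets (\<gamma> \<Otimes>\<^sub>M (\<nu> \<Otimes>\<^sub>M \<nu>))" for k
  proof -
    have "(\<lambda>p. norm (orth_proj (fst p) (fst (snd p) - snd (snd p)))) \<in> borel_measurable (\<gamma> \<Otimes>\<^sub>M (\<nu> \<Otimes>\<^sub>M \<nu>))"
      using measurable_norm_orth_proj[OF sets diffm] .
    moreover have "{p \<in> space (\<gamma> \<Otimes>\<^sub>M (\<nu> \<Otimes>\<^sub>M \<nu>)). fst (snd p) \<in> ?F k} \<in> sets (\<gamma> \<Otimes>\<^sub>M (\<nu> \<Otimes>\<^sub>M \<nu>))"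
      using Fm by measurable
    ultimately show ?thesis unfolding Q_def
      by (intro sets.sets_Collect_conj) (auto simp: borel_measurable_iff_less)
  qed
  have near: "near_pairs \<nu> t j V k = emeasure (\<nu> \<Otimes>\<^sub>M \<nu>) (Pair V -` Q k)" if "V \<in> space \<gamma>" for V k
    unfolding near_pairs_def Q_def using that
    by (intro arg_cong[where f = "emeasure (\<nu> \<Otimes>\<^sub>M \<nu>)"]) (auto simp: space_pair_measure sp\<nu>)
  have nearm: "(\<lambda>V. emeasure (\<nu> \<Otimes>\<^sub>M \<nu>) (Pair V -` Q k)) \<in> borel_measurable \<gamma>" for k
    by (rule sigma_finite_measure.measurable_emeasure_Pair[OF \<nu>\<nu>_sf Qm])
  have int_le: "(\<integral>\<^sup>+V. emeasure (\<nu> \<Otimes>\<^sub>M \<nu>) (Pair V -` Q k) \<partial>\<gamma>) \<le>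
      ennreal (D * (real k + 1) * 2 powr (- t * k)) * emeasure \<nu> (space \<nu>)" if jk: "j \<le> k" for k
  proof -
    have "(\<integral>\<^sup>+V. emeasure (\<nu> \<Otimes>\<^sub>M \<nu>) (Pair V -` Q k) \<partial>\<gamma>) = emeasure (\<gamma> \<Otimes>\<^sub>M (\<nu> \<Otimes>\<^sub>M \<nu>)) (Q k)"
      by (rule sigma_finite_measure.emeasure_pair_measure_alt[OF \<nu>\<nu>_sf Qm, symmetric])
    also have "\<dots> = (\<integral>\<^sup>+p. emeasure \<gamma> ((\<lambda>V. (V, p)) -` Q k) \<partial>(\<nu> \<Otimes>\<^sub>M \<nu>))"
      by (rule \<gamma>\<nu>.emeasure_pair_measure_alt2[OF Qm])
    also have "\<dots> = (\<integral>\<^sup>+y. \<integral>\<^sup>+y'. emeasure \<gamma> ((\<lambda>V. (V, (y, y'))) -` Q k) \<partial>\<nu> \<partial>\<nu>)"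
      by (rule \<nu>.nn_integral_fst[symmetric]) (rule \<gamma>\<nu>.measurable_emeasure_Pair2[OF Qm])
    also have "\<dots> \<le> (\<integral>\<^sup>+y. ennreal (D * (real k + 1) * 2 powr (- t * k)) \<partial>\<nu>)"
    proof (rule nn_integral_mono)
      fix y
      show "(\<integral>\<^sup>+y'. emeasure \<gamma> ((\<lambda>V. (V, (y, y'))) -` Q k) \<partial>\<nu>) \<le> ennreal (D * (real k + 1) * 2 powr (- t * k))"
      proof (cases "y \<in> ?F k")
        case True
        have "(\<lambda>V. (V, (y, y'))) -` Q k = {V \<in> Grassmannian d. norm (orth_proj V (y - y')) < 2 * (1 / 2) ^ k}" for y'
          using True by (auto simp: Q_def space_pair_measure sp sp\<nu>)
        then show ?thesis
          using small_ball_integral[OF prob sets C \<nu> jk t True] unfolding D_def by simp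
      next
        case False
        then have "(\<lambda>V. (V, (y, y'))) -` Q k = {}" for y' by (auto simp: Q_def)
        then show ?thesis by simp
      qed
    qed
    also have "\<dots> = ennreal (D * (real k + 1) * 2 powr (- t * k)) * emeasure \<nu> (space \<nu>)" by simp
    finally show ?thesis .
  qed
  define S where "S k = {V \<in> space \<gamma>. ennreal (2 powr (- (t - \<epsilon>) * k)) < emeasure (\<nu> \<Otimes>\<^sub>M \<nu>) (Pair V -` Q k)}" for k
  have Sm: "S k \<in> sets \<gamma>" for k using nearm[of k] unfolding S_def by measurable
  \<comment> \<open>By Bernoulli's inequality \<open>real k + 1\<close> is at most a constant times
    \<open>(1 + x) ^ k\<close>, that is, times \<open>2 powr (\<epsilon> / 2 * k)\<close>.\<close>
  define x where "x = 2 powr (\<epsilon> / 2) - 1"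
  have x: "0 < x" using \<epsilon> by (simp add: x_def)
  define B where "B = D * (1 + 1 / x) * measure \<nu> (space \<nu>)"
  have S_le: "measure \<gamma> (S k) \<le> B * (2 powr (- \<epsilon> / 2)) ^ k" if jk: "j \<le> k" for k
  proof -
    let ?a = "2 powr ((t - \<epsilon>) * k)"
    have "emeasure \<gamma> (S k) \<le> emeasure \<gamma> {V \<in> space \<gamma>. 1 \<le> ennreal ?a * emeasure (\<nu> \<Otimes>\<^sub>M \<nu>) (Pair V -` Q k)}"
    proof (rule emeasure_mono)
      show "{V \<in> space \<gamma>. 1 \<le> ennreal ?a * emeasure (\<nu> \<Otimes>\<^sub>M \<nu>) (Pair V -` Q k)} \<in> sets \<gamma>"
        using nearm[of k] by measurable
      show "S k \<subseteq> {V \<in> space \<gamma>. 1 \<le> ennreal ?a * emeasure (\<nu> \<Otimes>\<^sub>M \<nu>) (Pair V -` Q k)}"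
      proof
        fix V assume "V \<in> S k"
        then have V: "V \<in> space \<gamma>" "ennreal (2 powr (- (t - \<epsilon>) * k)) \<le> emeasure (\<nu> \<Otimes>\<^sub>M \<nu>) (Pair V -` Q k)"
          by (auto simp: S_def)
        have "1 = ennreal ?a * ennreal (2 powr (- (t - \<epsilon>) * k))"
        proof -
          have "(t - \<epsilon>) * k + - (t - \<epsilon>) * k = 0" by (simp only: mult_minus_left right_minus)
          then have "?a * 2 powr (- (t - \<epsilon>) * k) = 1" unfolding powr_add[symmetric] by simp
          then show ?thesis by (simp only: ennreal_mult'[symmetric] powr_ge_zero ennreal_1)
        qed
        also have "\<dots> \<le> ennreal ?a * emeasure (\<nu> \<Otimes>\<^sub>M \<nu>) (Pair V -` Q k)" using V(2) by (rule mult_left_mono) simp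
        finally show "V \<in> {V \<in> space \<gamma>. 1 \<le> ennreal ?a * emeasure (\<nu> \<Otimes>\<^sub>M \<nu>) (Pair V -` Q k)}" using V(1) by simp
      qed
    qed
    also have "\<dots> \<le> ennreal ?a * (\<integral>\<^sup>+V. emeasure (\<nu> \<Otimes>\<^sub>M \<nu>) (Pair V -` Q k) * indicator (space \<gamma>) V \<partial>\<gamma>)"
      using nn_integral_Markov_inequality[of "\<lambda>V. emeasure (\<nu> \<Otimes>\<^sub>M \<nu>) (Pair V -` Q k)" "space \<gamma>" \<gamma> "ennreal ?a"] nearm[of k]
      by simp
    also have "(\<integral>\<^sup>+V. emeasure (\<nu> \<Otimes>\<^sub>M \<nu>) (Pair V -` Q k) * indicator (space \<gamma>) V \<partial>\<gamma>) = (\<integral>\<^sup>+V. emeasure (\<nu> \<Otimes>\<^sub>M \<nu>) (Pair V -` Q k) \<partial>\<gamma>)"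
      by (intro nn_integral_cong) simp
    also have "ennreal ?a * \<dots> \<le> ennreal ?a * (ennreal (D * (real k + 1) * 2 powr (- t * k)) * emeasure \<nu> (space \<nu>))"
      using int_le[OF jk] by (rule mult_left_mono) simp
    also have "\<dots> = ennreal (?a * (D * (real k + 1) * 2 powr (- t * k) * measure \<nu> (space \<nu>)))"
      using D by (simp add: \<nu>.emeasure_eq_measure ennreal_mult'[symmetric])
    finally have "measure \<gamma> (S k) \<le> ?a * (D * (real k + 1) * 2 powr (- t * k) * measure \<nu> (space \<nu>))"
      using D by (simp add: \<gamma>.emeasure_eq_measure)
    also have "\<dots> = D * measure \<nu> (space \<nu>) * (real k + 1) * (?a * 2 powr (- t * k))" by (simp only: ac_simps)
    also have "?a * 2 powr (- t * k) = 2 powr (- \<epsilon> * k)"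
      unfolding powr_add[symmetric] by (rule arg_cong[where f = "\<lambda>x. 2 powr x"]) (simp add: algebra_simps)
    also have "D * measure \<nu> (space \<nu>) * (real k + 1) * 2 powr (- \<epsilon> * k) \<le>
        D * measure \<nu> (space \<nu>) * ((1 + 1 / x) * 2 powr (\<epsilon> / 2 * k)) * 2 powr (- \<epsilon> * k)"
    proof (intro mult_right_mono mult_left_mono)
      have p: "2 powr (\<epsilon> / 2 * k) = (x + 1) ^ k" by (simp add: x_def powr_realpow[symmetric] powr_powr)
      have "real k * x + 1 \<le> (x + 1) ^ k" using x by (intro linear_plus_1_le_power) simp
      then have 1: "real k * x \<le> (x + 1) ^ k" by simp
      have 2: "1 \<le> (x + 1) ^ k" using x by (intro one_le_power) simp
      have "real k \<le> (x + 1) ^ k / x" using 1 x by (simp add: pos_le_divide_eq)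
      then have "real k + 1 \<le> (x + 1) ^ k + (x + 1) ^ k / x" using 2 by simp
      also have "\<dots> = (1 + 1 / x) * 2 powr (\<epsilon> / 2 * k)" unfolding p by (simp add: distrib_right)
      finally show "real k + 1 \<le> (1 + 1 / x) * 2 powr (\<epsilon> / 2 * k)" .
    qed (use D in auto)
    also have "\<dots> = B * (2 powr (\<epsilon> / 2 * k) * 2 powr (- \<epsilon> * k))" unfolding B_def by (simp only: ac_simps)
    also have "2 powr (\<epsilon> / 2 * k) * 2 powr (- \<epsilon> * k) = (2 powr (- \<epsilon> / 2)) ^ k"
      by (simp add: powr_add[symmetric] powr_realpow[symmetric] powr_powr)
    finally show ?thesis .
  qed
  have "AE V in \<gamma>. eventually (\<lambda>k. V \<notin> S k) sequentially"
  proof (rule AE_eventually_notin[where ?k0.0 = j and C = B and q = "2 powr (- \<epsilon> / 2)"])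
    show "finite_measure \<gamma>" by unfold_locales
    show "2 powr (- \<epsilon> / 2) < 1" using \<epsilon> powr_less_mono[of "- \<epsilon> / 2" 0 2] by simp
    show "\<exists>U\<in>sets \<gamma>. S k \<subseteq> U \<and> measure \<gamma> U \<le> B * (2 powr (- \<epsilon> / 2)) ^ k" if "j \<le> k" for k
      using Sm S_le[OF that] by blast
  qed simp
  then show ?thesis
    using AE_space
  proof eventually_elim
    case (elim V)
    from elim(1) show ?case
    proof eventually_elim
      case (elim k)
      then show ?case using \<open>V \<in> space \<gamma>\<close> near[of V k] by (simp add: S_def not_less)
    qed
  qed
qed

text \<open>At scale \<open>r\<close>, the \<open>\<mu>\<close>-mass of a set of good points is controlled by the \<open>\<nu>\<close>-mass of its
  \<open>r / 8\<close>-neighbourhood. Applied first to tubes and then to the set of centres of heavy tubes, this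
  transfers the bound on \<open>near_pairs\<close> from \<open>\<nu>\<close> to \<open>\<mu>\<close>, although \<open>\<mu>\<close> may be singular with respect to \<open>\<nu>\<close>.\<close>

lemma projection_ball_bound:
  fixes V :: "(real^'n) set" and \<mu> \<nu> :: "(real^'n) measure" and t \<epsilon> :: real
  assumes V: "subspace V" and fin: "finite_measure \<mu>" "finite_measure \<nu>"
    and sets: "sets \<mu> = sets borel" "sets \<nu> = sets borel" and \<epsilon>: "0 < \<epsilon>"
    and comparison: "AE x in \<mu>. eventually (\<lambda>k.
      ball_measure \<mu> x k \<le> 2 powr (\<epsilon> * k) * ball_measure \<nu> x (k + 3) \<and>
      ball_measure \<nu> x k \<le> 2 powr (\<epsilon> * k) * ball_measure \<mu> x (k + 3)) sequentially"
    and dimension: "AE x in \<mu>. eventually (\<lambda>k. ball_measure \<mu> x k \<le> 2 powr (- (t + \<epsilon>) * k)) sequentially"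
    and near: "\<And>j. eventually (\<lambda>k. near_pairs \<nu> t j V k \<le> ennreal (2 powr (- (t - \<epsilon>) * k))) sequentially"
  shows "AE x in \<mu>. eventually (\<lambda>k. ball_measure (distr \<mu> borel (orth_proj V)) (orth_proj V x) k \<le> 2 powr (- (t - 6 * \<epsilon>) * k)) sequentially"
proof -
  interpret \<mu>: finite_measure \<mu> by fact
  interpret \<nu>: finite_measure \<nu> by fact
  interpret \<nu>\<nu>: pair_sigma_finite \<nu> \<nu> ..
  have sp: "space \<mu> = UNIV" "space \<nu> = UNIV"
    using sets_eq_imp_space_eq[OF sets(1)] sets_eq_imp_space_eq[OF sets(2)] by simp_all
  let ?P = "orth_proj V"
  have Pm: "?P \<in> borel_measurable borel" by (rule borel_orth_proj[OF V])
  have Pm\<mu>: "?P \<in> borel_measurable \<mu>" using Pm measurable_cong_sets[OF sets(1) refl] by blast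
  have contP: "continuous_on UNIV ?P" by (intro linear_continuous_on bounded_linear_orth_proj V)
  define T where "T x k = {y. norm (?P (y - x)) < (1 / 2) ^ k}" for x and k :: nat
  have T_eq: "T x k = {y. dist (?P x) (?P y) < (1 / 2) ^ k}" for x k
    by (simp add: T_def orth_proj_diff[OF V] dist_norm norm_minus_commute)
  have T_borel: "T x k \<in> sets borel" for x k
    unfolding T_eq by (intro borel_open open_Collect_less continuous_intros contP)
  \<comment> \<open>Points that are good from scale \<open>j\<close> on. The decay of \<nu> with
    exponent \<open>t\<close> comes from that of \<mu> with exponent \<open>t + \<epsilon>\<close>,
    the difference paying for the comparison of balls.\<close>
  define E where "E j = {x. \<forall>k\<ge>j. ball_measure \<nu> x k \<le> 2 powr (- t * k) \<and>
    ball_measure \<mu> x k \<le> 2 powr (\<epsilon> * k) * ball_measure \<nu> x (k + 3)}" for j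
  have E_borel: "E j \<in> sets borel" for j
  proof -
    have "{x \<in> space borel. \<forall>k. j \<le> k \<longrightarrow> ball_measure \<nu> x k \<le> 2 powr (- t * k) \<and>
        ball_measure \<mu> x k \<le> 2 powr (\<epsilon> * k) * ball_measure \<nu> x (k + 3)} \<in> sets borel"
      using sets_ball_measure(1)[OF fin(2) sets(2)] sets_ball_measure_le[OF fin(1) sets(1) fin(2) sets(2)]
      by (intro sets.sets_Collect_countable_All sets.sets_Collect_imp sets.sets_Collect_const sets.sets_Collect_conj) simp_all
    then show ?thesis by (simp only: E_def space_borel UNIV_I simp_thms)
  qed
  have E_all: "AE x in \<mu>. \<exists>j. x \<in> E j"
    using comparison dimension
  proof eventually_elim
    case (elim x)
    then have "eventually (\<lambda>k. ball_measure \<nu> x k \<le> 2 powr (- t * k) \<and>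
      ball_measure \<mu> x k \<le> 2 powr (\<epsilon> * k) * ball_measure \<nu> x (k + 3)) sequentially"
    proof eventually_elim
      case (elim k)
      have "ball_measure \<mu> x (k + 3) \<le> ball_measure \<mu> x k"
        unfolding ball_measure_def
        by (intro \<mu>.finite_measure_mono subset_ball power_decreasing) (auto simp: sets)
      then have "2 powr (\<epsilon> * k) * ball_measure \<mu> x (k + 3) \<le> 2 powr (\<epsilon> * k) * 2 powr (- (t + \<epsilon>) * k)"
        using elim by (intro mult_left_mono) auto
      also have "\<dots> = 2 powr (- t * k)"
        unfolding powr_add[symmetric] by (rule arg_cong[where f = "\<lambda>x. 2 powr x"]) (simp add: algebra_simps)
      finally show ?case using elim by linarith
    qed
    then show ?case unfolding eventually_sequentially E_def by blast
  qed
  \<comment> \<open>Of the four units of \<epsilon>, one is the loss in \<open>near_pairs\<close>,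
    two pay for the two transfers from \<mu> to \<nu>, and one is left to make the measures of the
    exceptional sets summable.\<close>
  define \<theta> where "\<theta> k = 2 powr (- (t - 4 * \<epsilon>) * real k)" for k
  have transfer: "\<exists>U. open U \<and> S \<subseteq> U \<and> measure \<mu> U \<le> 2 powr (\<epsilon> * k) * measure \<nu> (\<Union>x\<in>S. ball x ((1 / 2) ^ k / 8))"
    if S: "S \<subseteq> E j" and k: "j \<le> k" for S j k
  proof (rule Vitali_comparison[OF fin sets])
    fix x assume "x \<in> S"
    then have "ball_measure \<mu> x k \<le> 2 powr (\<epsilon> * k) * ball_measure \<nu> x (k + 3)"
      using S k unfolding E_def by blast
    then show "measure \<mu> (ball x ((1 / 2) ^ k)) \<le> 2 powr (\<epsilon> * k) * measure \<nu> (ball x ((1 / 2) ^ k / 8))"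
      unfolding ball_measure_def half_power_add_3 .
  qed auto
  have few: "AE x in \<mu>. eventually (\<lambda>k. x \<in> E j \<longrightarrow> measure \<mu> (E j \<inter> T x k) \<le> \<theta> k) sequentially" for j
  proof -
    obtain k1 where k1: "\<And>k. k \<ge> k1 \<Longrightarrow> near_pairs \<nu> t j V k \<le> ennreal (2 powr (- (t - \<epsilon>) * k))"
      using near[of j] unfolding eventually_sequentially by blast
    define S where "S k = {x \<in> E j. \<theta> k < measure \<mu> (E j \<inter> T x k)}" for k
    have "AE x in \<mu>. eventually (\<lambda>k. x \<notin> S k) sequentially"
    proof (rule AE_eventually_notin[OF fin(1), where ?k0.0 = "max j k1" and C = 1 and q = "2 powr (- \<epsilon>)"])
      show "2 powr (- \<epsilon>) < 1" using \<epsilon> by (simp add: powr_minus inverse_less_1_iff)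
      fix k assume "max j k1 \<le> k"
      then have jk: "j \<le> k" and k1k: "k1 \<le> k" by auto
      let ?r = "(1 / 2 :: real) ^ k"
      let ?N = "\<Union>x\<in>S k. ball x (?r / 8)"
      obtain U where U: "open U" "S k \<subseteq> U" "measure \<mu> U \<le> 2 powr (\<epsilon> * k) * measure \<nu> ?N"
      proof -
        have "S k \<subseteq> E j" by (auto simp: S_def)
        from transfer[OF this jk] show ?thesis using that by blast
      qed
      let ?R = "{p. fst p \<in> regular_points \<nu> t j k \<and> norm (?P (fst p - snd p)) < 2 * (1 / 2) ^ k}"
      have N_point: "z \<in> regular_points \<nu> t j k \<and> \<theta> k \<le> 2 powr (\<epsilon> * k) * measure \<nu> {y'. norm (?P (z - y')) < 2 * ?r}"
        \<comment> \<open>Near a heavy centre \<open>x\<close> both properties persist for \<nu>: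
          balls around \<open>z\<close> fit into balls of twice the radius around \<open>x\<close>,
          and the neighbourhood of the good part of the tube of width \<open>?r\<close> around
          \<open>x\<close> fits into the tube of width \<open>2 * ?r\<close> around
          \<open>z\<close>.\<close>
        if z: "z \<in> ?N" for z
      proof
        obtain x where x: "x \<in> S k" "dist x z < ?r / 8" using z by auto
        have xE: "x \<in> E j" using x(1) by (simp add: S_def)
        show "z \<in> regular_points \<nu> t j k"
          unfolding regular_points_def
        proof (intro CollectI ballI)
          fix i assume i: "i \<in> {j<..k}"
          then obtain i' where i': "i = Suc i'" "j \<le> i'" by (cases i) auto
          have "?r \<le> (1 / 2) ^ i" using i by (intro power_decreasing) auto
          have "ball z ((1 / 2) ^ i) \<subseteq> ball x ((1 / 2) ^ i')"
          proof
            fix w assume "w \<in> ball z ((1 / 2) ^ i)"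
            then have "dist z w < (1 / 2) ^ i" by simp
            moreover have "0 \<le> ?r" "(1 / 2 :: real) ^ i' = 2 * (1 / 2) ^ i" by (simp_all add: i'(1))
            ultimately have "dist x w < (1 / 2) ^ i'"
              using dist_triangle[of x w z] x(2) \<open>?r \<le> (1 / 2) ^ i\<close> by linarith
            then show "w \<in> ball x ((1 / 2) ^ i')" by simp
          qed
          then have "ball_measure \<nu> z i \<le> ball_measure \<nu> x i'"
            unfolding ball_measure_def by (intro \<nu>.finite_measure_mono) (auto simp: sets)
          also have "\<dots> \<le> 2 powr (- t * real i')" using xE i'(2) unfolding E_def by blast
          finally show "ball_measure \<nu> z i \<le> 2 powr (- t * (real i - 1))" using i'(1) by simp
        qed
        let ?S' = "E j \<inter> T x k"
        obtain U' where U': "open U'" "?S' \<subseteq> U'" "measure \<mu> U' \<le> 2 powr (\<epsilon> * k) * measure \<nu> (\<Union>y\<in>?S'. ball y (?r / 8))"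
        proof -
          have "?S' \<subseteq> E j" by blast
          from transfer[OF this jk] show ?thesis using that by blast
        qed
        have "\<theta> k \<le> measure \<mu> ?S'" using x(1) by (simp add: S_def)
        also have "\<dots> \<le> measure \<mu> U'" using U' by (intro \<mu>.finite_measure_mono) (auto simp: sets)
        also have "\<dots> \<le> 2 powr (\<epsilon> * k) * measure \<nu> (\<Union>y\<in>?S'. ball y (?r / 8))" by (rule U'(3))
        also have "\<dots> \<le> 2 powr (\<epsilon> * k) * measure \<nu> {y'. norm (?P (z - y')) < 2 * ?r}"
        proof (intro mult_left_mono \<nu>.finite_measure_mono subsetI)
          fix y' assume "y' \<in> (\<Union>y\<in>?S'. ball y (?r / 8))"
          then obtain y where y: "norm (?P (y - x)) < ?r" "dist y y' < ?r / 8" by (auto simp: T_def)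
          have "z - y' = (z - x) - (y - x) + (y - y')" by simp
          then have "?P (z - y') = ?P ((z - x) - (y - x) + (y - y'))" by (rule arg_cong)
          also have "\<dots> = ?P (z - x) - ?P (y - x) + ?P (y - y')"
            by (simp only: linear_add[OF linear_orth_proj[OF V]] linear_diff[OF linear_orth_proj[OF V]])
          finally have "?P (z - y') = ?P (z - x) - ?P (y - x) + ?P (y - y')" .
          then have "norm (?P (z - y')) \<le> norm (?P (z - x)) + norm (?P (y - x)) + norm (?P (y - y'))"
            using norm_triangle_ineq[of "?P (z - x) - ?P (y - x)" "?P (y - y')"] norm_triangle_ineq4[of "?P (z - x)" "?P (y - x)"] by simp
          also have "\<dots> < ?r / 8 + ?r + ?r / 8"
            using norm_orth_proj_le[OF V, of "z - x"] norm_orth_proj_le[OF V, of "y - y'"] x(2) y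
            by (simp add: dist_norm norm_minus_commute)
          also have "\<dots> \<le> 2 * ?r" by simp
          finally show "y' \<in> {y'. norm (?P (z - y')) < 2 * ?r}" by simp
        next
          have "open {y'. norm (?P z - ?P y') < 2 * ?r}"
            by (intro open_Collect_less continuous_intros contP)
          then show "{y'. norm (?P (z - y')) < 2 * ?r} \<in> sets \<nu>" by (simp add: sets orth_proj_diff[OF V])
        qed simp
        finally show "\<theta> k \<le> 2 powr (\<epsilon> * k) * measure \<nu> {y'. norm (?P (z - y')) < 2 * ?r}" .
      qed
      have N_open: "open ?N" by auto
      have R_sets: "?R \<in> sets (\<nu> \<Otimes>\<^sub>M \<nu>)"
      proof -
        have pair: "sets (\<nu> \<Otimes>\<^sub>M \<nu>) = sets (borel :: ((real^'n) \<times> (real^'n)) measure)"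
          using sets_pair_measure_cong[OF sets(2) sets(2)] borel_prod by metis
        have near_open: "open {p :: (real^'n) \<times> (real^'n). norm (?P (fst p - snd p)) < 2 * ?r}"
          by (intro open_Collect_less continuous_intros continuous_on_compose2[OF contP]) auto
        have "{p :: (real^'n) \<times> (real^'n). fst p \<in> regular_points \<nu> t j k} \<in> sets borel"
        proof -
          have "fst -` regular_points \<nu> t j k \<inter> space (borel :: ((real^'n) \<times> (real^'n)) measure) \<in> sets borel"
            using sets_regular_points[OF fin(2) sets(2)] by (intro measurable_sets[of fst borel borel] borel_measurable_continuous_onI continuous_intros) auto
          then show ?thesis by (simp add: vimage_def)
        qed
        then show ?thesis unfolding pair Collect_conj_eq by (rule sets.Int[OF _ borel_open[OF near_open]])
      qed
      \<comment> \<open>Each point of \<open>?N\<close> carries a slice of \<open>?R\<close> of mass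
        at least \<open>\<theta> k / 2 powr (\<epsilon> * k)\<close>, so Fubini bounds the
        \<nu>-mass of \<open>?N\<close> in terms of \<open>near_pairs\<close>.\<close>
      have "ennreal (\<theta> k / 2 powr (\<epsilon> * k)) * emeasure \<nu> ?N = (\<integral>\<^sup>+z. ennreal (\<theta> k / 2 powr (\<epsilon> * k)) * indicator ?N z \<partial>\<nu>)"
        using N_open by (simp add: nn_integral_cmult_indicator sets)
      also have "\<dots> \<le> (\<integral>\<^sup>+z. emeasure \<nu> (Pair z -` ?R) \<partial>\<nu>)"
      proof (rule nn_integral_mono)
        fix z
        show "ennreal (\<theta> k / 2 powr (\<epsilon> * k)) * indicator ?N z \<le> emeasure \<nu> (Pair z -` ?R)"
        proof (cases "z \<in> ?N")
          case True
          note p = N_point[OF True]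
          then have "Pair z -` ?R = {y'. norm (?P (z - y')) < 2 * ?r}" by auto
          moreover have "\<theta> k / 2 powr (\<epsilon> * k) \<le> measure \<nu> {y'. norm (?P (z - y')) < 2 * ?r}"
            using p by (simp add: pos_divide_le_eq mult.commute)
          ultimately show ?thesis using True by (simp add: \<nu>.emeasure_eq_measure ennreal_leI)
        qed simp
      qed
      also have "\<dots> = near_pairs \<nu> t j V k"
        unfolding near_pairs_def by (rule \<nu>.emeasure_pair_measure_alt[OF R_sets, symmetric])
      also have "\<dots> \<le> ennreal (2 powr (- (t - \<epsilon>) * k))" by (rule k1[OF k1k])
      finally have "\<theta> k / 2 powr (\<epsilon> * k) * measure \<nu> ?N \<le> 2 powr (- (t - \<epsilon>) * k)"
        by (simp add: \<nu>.emeasure_eq_measure ennreal_mult'[symmetric] \<theta>_def)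
      then have "2 powr (2 * \<epsilon> * k) / \<theta> k * (\<theta> k / 2 powr (\<epsilon> * k) * measure \<nu> ?N) \<le> 2 powr (2 * \<epsilon> * k) / \<theta> k * 2 powr (- (t - \<epsilon>) * k)"
        by (intro mult_left_mono) (auto simp: \<theta>_def)
      moreover have "2 powr (2 * \<epsilon> * k) / \<theta> k * (\<theta> k / 2 powr (\<epsilon> * k) * measure \<nu> ?N) = 2 powr (\<epsilon> * k) * measure \<nu> ?N"
      proof -
        have "2 powr (2 * \<epsilon> * k) = 2 powr (\<epsilon> * k) * 2 powr (\<epsilon> * k)"
          unfolding powr_add[symmetric] by (rule arg_cong[where f = "\<lambda>x. 2 powr x"]) simp
        then show ?thesis by (simp add: \<theta>_def)
      qed
      moreover have "2 powr (2 * \<epsilon> * k) / \<theta> k * 2 powr (- (t - \<epsilon>) * k) = 2 powr (- \<epsilon> * k)"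
        unfolding \<theta>_def powr_diff[symmetric] powr_add[symmetric]
        by (rule arg_cong[where f = "\<lambda>x. 2 powr x"]) (simp add: algebra_simps)
      ultimately have "measure \<mu> U \<le> 2 powr (- \<epsilon> * k)" using U(3) by linarith
      also have "\<dots> = 1 * (2 powr (- \<epsilon>)) ^ k" by (simp add: powr_realpow[symmetric] powr_powr)
      finally show "\<exists>U\<in>sets \<mu>. S k \<subseteq> U \<and> measure \<mu> U \<le> 1 * (2 powr (- \<epsilon>)) ^ k"
        using U(1,2) sets by (intro bexI[of _ U]) auto
    qed simp
    then show ?thesis by (simp add: S_def not_less)
  qed
  have "AE x in \<mu>. x \<in> E j \<longrightarrow> eventually (\<lambda>k. ball_measure (distr \<mu> borel ?P) (?P x) k \<le> 2 powr (- (t - 6 * \<epsilon>) * k)) sequentially" for j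
  proof -
    \<comment> \<open>The bound \<open>few\<close> concerns only the part of \<mu> in
      \<open>E j\<close>. Its projection is compared with that of all of \<mu> by
      \<open>AE_ball_measure_le\<close>, applied to the projected measures.\<close>
    define \<mu>' where "\<mu>' = density \<mu> (indicator (E j))"
    have E\<mu>: "E j \<in> sets \<mu>" using E_borel sets by simp
    have \<mu>'_sets: "sets \<mu>' = sets borel" by (simp add: \<mu>'_def sets)
    have \<mu>'_em: "emeasure \<mu>' X = emeasure \<mu> (E j \<inter> X)" if "X \<in> sets \<mu>" for X
      unfolding \<mu>'_def by (rule emeasure_restricted[OF E\<mu> that])
    have \<mu>'_fin: "finite_measure \<mu>'"
    proof
      show "emeasure \<mu>' (space \<mu>') \<noteq> \<infinity>"
        using \<mu>'_em[of UNIV] sets sp by (simp add: \<mu>'_def \<mu>.emeasure_eq_measure)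
    qed
    have Pm': "?P \<in> borel_measurable \<mu>'" using Pm measurable_cong_sets[OF \<mu>'_sets refl] by blast
    let ?\<pi> = "distr \<mu> borel ?P" and ?\<pi>' = "distr \<mu>' borel ?P"
    have fin_\<pi>: "finite_measure ?\<pi>" "finite_measure ?\<pi>'"
      by (intro finite_measure_distr_borel fin Pm\<mu> \<mu>'_fin Pm')+
    have "AE y in ?\<pi>'. eventually (\<lambda>k. ball_measure ?\<pi> y (k + 3) \<le> 2 powr (\<epsilon> * k) * ball_measure ?\<pi>' y k) sequentially"
      by (rule AE_ball_measure_le[OF fin_\<pi>(2,1) _ _ \<epsilon>]) simp_all
    then have "AE x in \<mu>'. eventually (\<lambda>k. ball_measure ?\<pi> (?P x) (k + 3) \<le> 2 powr (\<epsilon> * k) * ball_measure ?\<pi>' (?P x) k) sequentially"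
      by (subst (asm) AE_distr_eventually[OF Pm'], intro sets_ball_measure_le fin_\<pi>) simp_all
    then have "AE x in \<mu>. x \<in> E j \<longrightarrow> eventually (\<lambda>k. ball_measure ?\<pi> (?P x) (k + 3) \<le> 2 powr (\<epsilon> * k) * ball_measure ?\<pi>' (?P x) k) sequentially"
      unfolding \<mu>'_def using E\<mu> by (subst (asm) AE_density) (auto simp: indicator_def)
    then show ?thesis
      using few[of j]
    proof eventually_elim
      case (elim x)
      show ?case
      proof
        assume x: "x \<in> E j"
        have \<pi>': "ball_measure ?\<pi>' (?P x) k = measure \<mu> (E j \<inter> T x k)" for k
        proof -
          have "ball_measure ?\<pi>' (?P x) k = measure \<mu>' (?P -` ball (?P x) ((1 / 2) ^ k) \<inter> space \<mu>')"
            unfolding ball_measure_def by (rule measure_distr[OF Pm']) simp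
          also have "?P -` ball (?P x) ((1 / 2) ^ k) \<inter> space \<mu>' = T x k"
            by (auto simp: T_eq \<mu>'_def sp)
          also have "measure \<mu>' (T x k) = measure \<mu> (E j \<inter> T x k)"
            using \<mu>'_em[of "T x k"] T_borel sets by (simp add: measure_def)
          finally show ?thesis .
        qed
        \<comment> \<open>Beyond this \<open>k\<close> the last \<epsilon> pays for replacing
          \<open>k\<close> by \<open>k + 3\<close>; with four units in \<theta> and one from the
          density comparison this makes six.\<close>
        have "eventually (\<lambda>k::nat. k > nat \<lceil>3 * (t - 6 * \<epsilon>) / \<epsilon>\<rceil>) sequentially" by (rule eventually_gt_at_top)
        moreover note elim(2)
        moreover have "eventually (\<lambda>k. ball_measure ?\<pi> (?P x) (k + 3) \<le> 2 powr (\<epsilon> * k) * ball_measure ?\<pi>' (?P x) k) sequentially"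
          using elim(1) x by blast
        ultimately have "eventually (\<lambda>k. ball_measure ?\<pi> (?P x) (k + 3) \<le> 2 powr (- (t - 6 * \<epsilon>) * real (k + 3))) sequentially"
        proof eventually_elim
          case (elim k)
          have "3 * (t - 6 * \<epsilon>) / \<epsilon> \<le> real k" using elim(1) by linarith
          then have k: "3 * (t - 6 * \<epsilon>) \<le> k * \<epsilon>" unfolding pos_divide_le_eq[OF \<epsilon>] .
          have "ball_measure ?\<pi> (?P x) (k + 3) \<le> 2 powr (\<epsilon> * k) * measure \<mu> (E j \<inter> T x k)" using elim(3) \<pi>' by simp
          also have "\<dots> \<le> 2 powr (\<epsilon> * k) * \<theta> k" using elim(2) x by (intro mult_left_mono) auto
          also have "\<dots> = 2 powr (\<epsilon> * k + - (t - 4 * \<epsilon>) * k)" unfolding \<theta>_def powr_add ..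
          also have "\<dots> \<le> 2 powr (- (t - 6 * \<epsilon>) * real (k + 3))"
          proof -
            have "\<epsilon> * k + - (t - 4 * \<epsilon>) * k \<le> - (t - 6 * \<epsilon>) * real (k + 3)"
              using k by (simp add: algebra_simps)
            then show ?thesis by simp
          qed
          finally show ?case .
        qed
        then show "eventually (\<lambda>k. ball_measure ?\<pi> (?P x) k \<le> 2 powr (- (t - 6 * \<epsilon>) * k)) sequentially"
          using eventually_sequentially_seg[of "\<lambda>k. ball_measure ?\<pi> (?P x) k \<le> 2 powr (- (t - 6 * \<epsilon>) * real k)" 3] by simp
      qed
    qed
  qed
  then have "AE x in \<mu>. \<forall>j. x \<in> E j \<longrightarrow> eventually (\<lambda>k. ball_measure (distr \<mu> borel ?P) (?P x) k \<le> 2 powr (- (t - 6 * \<epsilon>) * k)) sequentially"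
    by (subst AE_all_countable) blast
  then show ?thesis using E_all by eventually_elim blast
qed

text \<open>A bounded part of \<open>V\<close> contains at most a constant times
  \<open>2 powr (d * k)\<close> disjoint balls of scale \<open>k\<close>; if all of them are lighter
  than \<open>2 powr (- (d + \<epsilon>) * k)\<close>, the total is summable in \<open>k\<close>.
  The parameter \<open>R\<close> runs through an exhaustion of \<open>V\<close> by bounded
  parts.\<close>

lemma projection_dimension_le:
  fixes V :: "(real^'n) set" and \<mu> :: "(real^'n) measure" and \<epsilon> :: real
  assumes V: "V \<in> Grassmannian d" and fin: "finite_measure \<mu>" and sets: "sets \<mu> = sets borel" and \<epsilon>: "0 < \<epsilon>"
  shows "AE y in distr \<mu> borel (orth_proj V). eventually (\<lambda>k.
    2 powr (- (d + \<epsilon>) * k) \<le> ball_measure (distr \<mu> borel (orth_proj V)) y k) sequentially"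
proof -
  have sV: "subspace V" and dimV: "dim V = d" using V by (auto simp: Grassmannian_def)
  let ?\<pi> = "distr \<mu> borel (orth_proj V)"
  have Pm: "orth_proj V \<in> borel_measurable \<mu>"
    using borel_orth_proj[OF sV] measurable_cong_sets[OF sets refl] by blast
  have fin_\<pi>: "finite_measure ?\<pi>" by (intro finite_measure_distr_borel fin Pm)
  interpret \<pi>: finite_measure ?\<pi> by (rule fin_\<pi>)
  have "AE y in ?\<pi>. eventually (\<lambda>k. y \<notin> {y \<in> V. norm y \<le> real R + 1 \<and> ball_measure ?\<pi> y k < 2 powr (- (d + \<epsilon>) * k)}) sequentially"
    (is "AE y in ?\<pi>. eventually (\<lambda>k. y \<notin> ?S k) sequentially") for R :: nat
  proof -
    \<comment> \<open>Centres of disjoint balls of radius \<open>?r / 8\<close> are more than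
      \<open>?r / 4\<close> apart, and \<open>separated_count\<close> at radius
      \<open>?r / L\<close> needs separation \<open>(3 * d + 2) * (?r / L)\<close>, which equals
      \<open>?r / 4\<close>.\<close>
    define L where "L = 4 * (3 * real d + 2)"
    have L: "1 \<le> L" by (simp add: L_def)
    show ?thesis
    proof (rule AE_eventually_notin[OF fin_\<pi>, where ?k0.0 = 0 and C = "(5 * (real R + 1) * L) ^ d" and q = "2 powr (- \<epsilon>)"])
      show "2 powr (- \<epsilon>) < 1" using \<epsilon> by (simp add: powr_minus inverse_less_1_iff)
      fix k :: nat
      let ?r = "(1 / 2 :: real) ^ k"
      obtain C where C: "countable C" "C \<subseteq> ?S k"
        "pairwise (\<lambda>i j. disjnt (cball i (?r / 8)) (cball j (?r / 8))) C"
        "\<And>i. i \<in> ?S k \<Longrightarrow> \<exists>j. j \<in> C \<and> \<not> disjnt (cball i (?r / 8)) (cball j (?r / 8)) \<and> cball i (?r / 8) \<subseteq> ball j (5 * (?r / 8))"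
        using Vitali_covering_lemma_cballs_balls[of "?S k" "\<lambda>_. ?r / 8" "?r / 8" "\<lambda>x. x"] by auto
      have rL: "0 < ?r / L" "?r / L \<le> real R + 1"
      proof -
        show "0 < ?r / L" using L by simp
        have "?r / L \<le> ?r / 1" using L by (intro divide_left_mono) auto
        also have "?r / 1 \<le> 1" using power_le_one[of "1 / 2 :: real" k] by simp
        finally show "?r / L \<le> real R + 1" by simp
      qed
      have "finite C \<and> card C \<le> (5 * (real R + 1) / (?r / L)) ^ dim V"
      proof (rule separated_count[OF sV rL])
        fix x assume "x \<in> C"
        then have "x \<in> V" "norm x \<le> real R + 1" using C(2) by auto
        then show "norm x \<le> real R + 1 \<and> (\<exists>u\<in>V. norm (x - u) \<le> ?r / L)" using rL(1) by (intro conjI bexI[of _ x]) auto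
      next
        fix x y assume xy: "x \<in> C" "y \<in> C" "x \<noteq> y"
        then have dis: "disjnt (cball x (?r / 8)) (cball y (?r / 8))" using C(3) unfolding pairwise_def by blast
        have "?r / 4 < dist x y"
        proof (rule ccontr)
          assume "\<not> ?r / 4 < dist x y"
          then have d: "dist x y \<le> ?r / 4" by simp
          have "dist x (midpoint x y) \<le> ?r / 8" "dist y (midpoint x y) \<le> ?r / 8"
            using d by (simp_all add: dist_midpoint)
          then show False using dis unfolding disjnt_def by auto
        qed
        moreover have "real (3 * dim V + 2) * (?r / L) = ?r / 4"
        proof -
          have "c * (q / (4 * c)) = q / 4" if "c \<noteq> 0" for c q :: real using that by simp
          moreover have "3 * real d + 2 \<noteq> 0" using of_nat_0_le_iff[of d, where 'a = real] by linarith
          ultimately have "(3 * real d + 2) * (?r / (4 * (3 * real d + 2))) = ?r / 4" by blast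
          then show ?thesis unfolding L_def dimV of_nat_add of_nat_mult of_nat_numeral .
        qed
        ultimately show "real (3 * dim V + 2) * (?r / L) < dist x y" by simp
      qed
      then have finC: "finite C" and cardC: "card C \<le> (5 * (real R + 1) * L) ^ d * 2 powr (real d * k)"
      proof -
        assume *: "finite C \<and> card C \<le> (5 * (real R + 1) / (?r / L)) ^ dim V"
        then show "finite C" by blast
        have "(5 * (real R + 1) / (?r / L)) ^ dim V = (5 * (real R + 1) * L) ^ d * (1 / ?r) ^ d"
          unfolding dimV power_mult_distrib[symmetric] by simp
        also have "(1 / ?r) ^ d = 2 powr (real d * k)"
          unfolding half_power_powr by (simp add: powr_minus powr_realpow[symmetric] powr_powr mult.commute inverse_eq_divide[symmetric])
        finally show "card C \<le> (5 * (real R + 1) * L) ^ d * 2 powr (real d * k)" using * by simp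
      qed
      let ?U = "\<Union>y\<in>C. ball y ?r"
      have "measure ?\<pi> ?U \<le> (\<Sum>y\<in>C. measure ?\<pi> (ball y ?r))"
        by (rule \<pi>.finite_measure_subadditive_finite[OF finC]) auto
      also have "\<dots> \<le> (\<Sum>y\<in>C. 2 powr (- (d + \<epsilon>) * k))"
      proof (rule sum_mono)
        fix y assume "y \<in> C"
        then have "y \<in> ?S k" using C(2) by blast
        then show "measure ?\<pi> (ball y ?r) \<le> 2 powr (- (d + \<epsilon>) * k)" by (simp add: ball_measure_def)
      qed
      also have "\<dots> = card C * 2 powr (- (d + \<epsilon>) * k)" by simp
      also have "\<dots> \<le> (5 * (real R + 1) * L) ^ d * 2 powr (real d * k) * 2 powr (- (d + \<epsilon>) * k)"
        by (rule mult_right_mono[OF cardC]) simp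
      also have "\<dots> = (5 * (real R + 1) * L) ^ d * (2 powr (real d * k) * 2 powr (- (d + \<epsilon>) * k))" by (simp only: mult.assoc)
      also have "2 powr (real d * k) * 2 powr (- (d + \<epsilon>) * k) = 2 powr (- \<epsilon> * k)"
        unfolding powr_add[symmetric] by (rule arg_cong[where f = "\<lambda>x. 2 powr x"]) (simp add: algebra_simps)
      also have "2 powr (- \<epsilon> * k) = (2 powr (- \<epsilon>)) ^ k" by (simp add: powr_realpow[symmetric] powr_powr)
      finally have "measure ?\<pi> ?U \<le> (5 * (real R + 1) * L) ^ d * (2 powr (- \<epsilon>)) ^ k" .
      moreover have "?S k \<subseteq> ?U"
      proof
        fix x assume "x \<in> ?S k"
        then obtain j where j: "j \<in> C" "cball x (?r / 8) \<subseteq> ball j (5 * (?r / 8))" using C(4) by blast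
        have "x \<in> cball x (?r / 8)" by simp
        then have "x \<in> ball j (5 * (?r / 8))" using j(2) by blast
        then have "dist j x < 5 * (?r / 8)" by simp
        also have "5 * (?r / 8) \<le> ?r" by simp
        finally show "x \<in> ?U" using j(1) by auto
      qed
      moreover have "?U \<in> sets ?\<pi>" unfolding sets_distr by (intro borel_open open_UN ballI open_ball)
      ultimately show "\<exists>U\<in>sets ?\<pi>. ?S k \<subseteq> U \<and> measure ?\<pi> U \<le> (5 * (real R + 1) * L) ^ d * (2 powr (- \<epsilon>)) ^ k"
        by blast
    qed simp
  qed
  then have "AE y in ?\<pi>. \<forall>R::nat. eventually (\<lambda>k. y \<notin> {y \<in> V. norm y \<le> real R + 1 \<and> ball_measure ?\<pi> y k < 2 powr (- (d + \<epsilon>) * k)}) sequentially"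
    by (subst AE_all_countable) blast
  moreover have "AE y in ?\<pi>. y \<in> V"
  proof (subst AE_distr_iff[OF Pm])
    show "{x \<in> space borel. x \<in> V} \<in> sets borel" using closed_subspace[OF sV] by simp
    show "AE x in \<mu>. orth_proj V x \<in> V" using orth_proj(1)[OF sV] by simp
  qed
  ultimately show ?thesis
  proof eventually_elim
    case (elim y)
    obtain R :: nat where "norm y \<le> R" using real_arch_simple by blast
    then have R: "norm y \<le> real R + 1" by simp
    have "eventually (\<lambda>k. y \<notin> {y \<in> V. norm y \<le> real R + 1 \<and> ball_measure ?\<pi> y k < 2 powr (- (d + \<epsilon>) * k)}) sequentially"
      using elim(1) by blast
    then show ?case using elim(2) R by (simp add: not_less)
  qed
qed

section \<open>Ergodic measures on the attractor\<close>

context separated_IFS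
begin

abbreviation "\<Lambda> \<equiv> attractor V0 A f"

abbreviation on_attractor :: "(nat \<Rightarrow> 'i) measure \<Rightarrow> (real^'n) measure" where
  "on_attractor m \<equiv> distr m (restrict_space borel \<Lambda>) \<pi>"

text \<open>The covering arguments need measures on the whole space, whereas ergodic measures have
  the attractor as their space; these facts translate between the two.\<close>

lemma on_attractor:
  assumes sets: "sets m = sets (code_space A)" and fin: "finite_measure m"
  shows measure_on_attractor: "measure (on_attractor m) (ball x r \<inter> space (on_attractor m)) = measure (distr m borel \<pi>) (ball x r)"
    and AE_on_attractor: "(AE x in distr m borel \<pi>. Q x) \<Longrightarrow> (AE x in on_attractor m. Q x)"
    and sets_on_attractor: "ball x r \<inter> space (on_attractor m) \<in> sets (on_attractor m)"
    and finite_borel_on_attractor: "finite_borel_measure_on \<Lambda> (on_attractor m)"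
    and distr_on_attractor: "g \<in> borel_measurable borel \<Longrightarrow> distr (on_attractor m) borel g = distr (distr m borel \<pi>) borel g"
proof -
  have sp: "space m = \<Omega>" using sets by (rule sets_eq_imp_space_eq)
  have pm: "\<pi> \<in> borel_measurable m"
    using projection_measurable measurable_cong_sets[OF sets refl] by blast
  have pr: "\<pi> \<in> measurable m (restrict_space borel \<Lambda>)"
    using pm projection_in_attractor sp by (intro measurable_restrict_space2) auto
  have id: "(\<lambda>x. x) \<in> measurable (restrict_space borel \<Lambda>) (borel :: (real^'n) measure)"
    by (intro measurable_restrict_space1 measurable_ident_sets refl)
  have M: "distr m borel \<pi> = distr (on_attractor m) borel (\<lambda>x. x)"
    by (subst distr_distr[OF id pr]) (simp add: comp_def)
  have space: "space (on_attractor m) = \<Lambda>" by (simp add: space_restrict_space)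
  show sball: "ball x r \<inter> space (on_attractor m) \<in> sets (on_attractor m)"
    unfolding space by (simp add: sets_restrict_space Int_commute)
  have "measure (distr (on_attractor m) borel (\<lambda>x. x)) (ball x r) = measure (on_attractor m) (ball x r \<inter> space (on_attractor m))"
    by (subst measure_distr) (use id in auto)
  then show "measure (on_attractor m) (ball x r \<inter> space (on_attractor m)) = measure (distr m borel \<pi>) (ball x r)"
    unfolding M[symmetric] by (rule sym)
  show "AE x in on_attractor m. Q x" if Q: "AE x in distr m borel \<pi>. Q x"
  proof (rule AE_distrD[where f = "\<lambda>x. x" and M' = borel])
    show "(\<lambda>x. x) \<in> measurable (on_attractor m) borel" using id by simp
    show "AE x in distr (on_attractor m) borel (\<lambda>x. x). Q x" using Q unfolding M .
  qed
  show "finite_borel_measure_on \<Lambda> (on_attractor m)"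
    unfolding finite_borel_measure_on_def using finite_measure.finite_measure_distr[OF fin pr] by simp
  show "distr (on_attractor m) borel g = distr (distr m borel \<pi>) borel g" if g: "g \<in> borel_measurable borel"
    unfolding distr_distr[OF measurable_restrict_space1[OF g] pr] distr_distr[OF g pm] ..
qed

lemma relative_dimension_separable:
  "relative_dimension_separable \<Lambda> (ergodic_measures V0 A f)"
  unfolding relative_dimension_separable_def
proof (intro conjI ballI exI[of _ "{on_attractor (universal_measure A)}"] allI impI)
  have \<nu>: "sets (universal_measure A) = sets (code_space A)" "finite_measure (universal_measure A)"
    using sets_universal_measure finite_universal_measure[OF A_ne] by auto
  show "countable {on_attractor (universal_measure A)}" by simp
  show "finite_borel_measure_on \<Lambda> \<nu>'" if "\<nu>' \<in> {on_attractor (universal_measure A)}" for \<nu>'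
    using that finite_borel_on_attractor[OF \<nu>] by simp
  fix \<mu> assume "\<mu> \<in> ergodic_measures V0 A f"
  then obtain m where m: "ergodic_shift_measure A m" and \<mu>: "\<mu> = on_attractor m"
    unfolding ergodic_measures_def by blast
  interpret ergodic_code A m using m finite_A by unfold_locales
  have fin: "finite_measure m" by unfold_locales
  show "finite_borel_measure_on \<Lambda> \<mu>" unfolding \<mu> by (rule finite_borel_on_attractor[OF sets_eq fin])
  fix \<epsilon> :: real assume \<epsilon>: "0 < \<epsilon>"
  have pr: "\<pi> \<in> measurable m (restrict_space borel \<Lambda>)"
    using projection_measurable projection_in_attractor space_eq measurable_cong_sets[OF sets_eq refl]
    by (intro measurable_restrict_space2) auto
  have prob: "prob_space (on_attractor m)" by (rule prob_space_distr[OF pr])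
  \<comment> \<open>A quarter of \<epsilon>, since \<open>rel_dim_le\<close> doubles it and the
    final inequality is strict.\<close>
  have "AE x in on_attractor m. eventually (\<lambda>k.
    ball_measure (distr m borel \<pi>) x k \<le> 2 powr (\<epsilon> / 4 * k) * ball_measure universal x (k + 3) \<and>
    ball_measure universal x k \<le> 2 powr (\<epsilon> / 4 * k) * ball_measure (distr m borel \<pi>) x (k + 3) \<and>
    0 < ball_measure universal x (k + 3)) sequentially"
    by (rule AE_on_attractor[OF sets_eq fin ball_comparison[OF m]]) (use \<epsilon> in simp)
  then have "AE x in on_attractor m. eventually (\<lambda>r.
    - ereal (\<epsilon> / 4) \<le> elog (ball_ratio (on_attractor m) (on_attractor (universal_measure A)) x r) / ereal (ln r) \<and>
    elog (ball_ratio (on_attractor m) (on_attractor (universal_measure A)) x r) / ereal (ln r) \<le> ereal (\<epsilon> / 4)) (at_right 0)"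
  proof eventually_elim
    case (elim x)
    show ?case
    proof (rule ball_ratio_bounds)
      show "finite_measure (on_attractor m)" "finite_measure (on_attractor (universal_measure A))"
        using finite_borel_on_attractor[OF sets_eq fin] finite_borel_on_attractor[OF \<nu>]
        unfolding finite_borel_measure_on_def by blast+
      show "ball x r \<inter> space (on_attractor m) \<in> sets (on_attractor m)" for r
        by (rule sets_on_attractor[OF sets_eq fin])
      show "ball x r \<inter> space (on_attractor (universal_measure A)) \<in> sets (on_attractor (universal_measure A))" for r
        by (rule sets_on_attractor[OF \<nu>])
      show "0 < \<epsilon> / 4" using \<epsilon> by simp
    qed (use elim in \<open>simp only: measure_on_attractor[OF sets_eq fin] measure_on_attractor[OF \<nu>] ball_measure_def\<close>)
  qed
  then have "rel_dim (on_attractor m) (on_attractor (universal_measure A)) \<le> ereal (2 * (\<epsilon> / 4))"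
    using \<epsilon> by (intro rel_dim_le prob) auto
  also have "\<dots> < ereal \<epsilon>" using \<epsilon> by simp
  finally show "\<exists>\<nu>\<in>{on_attractor (universal_measure A)}. rel_dim \<mu> \<nu> < ereal \<epsilon>" unfolding \<mu> by simp
qed

text \<open>The conditions on \<open>V\<close> involve only the universal measure and countably many
  parameters. The lower bound feeds a rational \<open>t\<close> below \<open>min d s\<close> into
  \<open>projection_ball_bound\<close>. The upper bound has two sources: the covering of
  \<open>V\<close> for \<open>d\<close>, and for \<open>s\<close> the fact that projections do not
  increase distances.\<close>

lemma projection_has_hdim:
  fixes V :: "(real^'n) set"
  assumes V: "V \<in> Grassmannian d" and m: "ergodic_shift_measure A m"
    and near: "\<And>(t :: rat) (q :: nat) j. 0 \<le> real_of_rat t \<Longrightarrow> real_of_rat t \<le> d \<Longrightarrow>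
      eventually (\<lambda>k. near_pairs universal (real_of_rat t) j V k \<le> ennreal (2 powr (- (real_of_rat t - 1 / (real q + 1)) * k))) sequentially"
  shows "\<exists>s. has_hdim (on_attractor m) s \<and>
    has_hdim (distr (on_attractor m) borel (orth_proj V)) (min (ereal (real d)) s)"
proof -
  interpret ergodic_code A m using m finite_A by unfold_locales
  have fin: "finite_measure m" by unfold_locales
  have sV: "subspace V" using V by (rule Grassmannian_subspace)
  have pm: "\<pi> \<in> borel_measurable m"
    using projection_measurable measurable_cong_sets[OF sets_eq refl] by blast
  have pr: "\<pi> \<in> measurable m (restrict_space borel \<Lambda>)"
    using pm projection_in_attractor space_eq by (intro measurable_restrict_space2) auto
  let ?M = "distr m borel \<pi>"
  have finM: "finite_measure ?M" by (intro finite_measure_distr_borel pm fin)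
  interpret M: prob_space ?M by (rule prob_space_distr[OF pm])
  have Pm: "orth_proj V \<in> borel_measurable ?M" using borel_orth_proj[OF sV] by simp
  let ?\<pi> = "distr ?M borel (orth_proj V)"
  have fin_\<pi>: "finite_measure ?\<pi>" by (intro finite_measure_distr_borel Pm finM)
  have prob_\<pi>: "prob_space ?\<pi>" by (rule M.prob_space_distr[OF Pm])
  have \<pi>_eq: "distr (on_attractor m) borel (orth_proj V) = ?\<pi>"
    by (rule distr_on_attractor[OF sets_eq fin borel_orth_proj[OF sV]])
  obtain s :: ereal where s: "0 \<le> s"
    "\<And>t::real. ereal t < s \<Longrightarrow> AE x in ?M. eventually (\<lambda>k. ball_measure ?M x k \<le> 2 powr (- t * k)) sequentially"
    "\<And>t::real. s < ereal t \<Longrightarrow> AE x in ?M. frequently (\<lambda>k. 2 powr (- t * k) < ball_measure ?M x k) sequentially"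
    by (rule exact_dimension[OF m]) (use that in auto)
  have "has_hdim (on_attractor m) s"
  proof (rule has_hdimI)
    show "prob_space (on_attractor m)" by (rule prob_space_distr[OF pr])
    show "ball x r \<inter> space (on_attractor m) \<in> sets (on_attractor m)" for x r
      by (rule sets_on_attractor[OF sets_eq fin])
    fix t :: real
    show "AE x in on_attractor m. eventually (\<lambda>k. measure (on_attractor m) (ball x ((1 / 2) ^ k) \<inter> space (on_attractor m)) \<le> 2 powr (- t * k)) sequentially"
      if "ereal t < s"
      using AE_on_attractor[OF sets_eq fin s(2)[OF that]] unfolding measure_on_attractor[OF sets_eq fin] ball_measure_def .
    show "AE x in on_attractor m. frequently (\<lambda>k. 2 powr (- t * k) \<le> measure (on_attractor m) (ball x ((1 / 2) ^ k) \<inter> space (on_attractor m))) sequentially"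
      if st: "s < ereal t"
    proof -
      have "AE x in on_attractor m. frequently (\<lambda>k. 2 powr (- t * k) < ball_measure ?M x k) sequentially"
        by (rule AE_on_attractor[OF sets_eq fin s(3)[OF st]])
      then show ?thesis
        unfolding measure_on_attractor[OF sets_eq fin] ball_measure_def
        by eventually_elim (erule frequently_elim1, simp)
    qed
  qed
  moreover have "has_hdim ?\<pi> (min (ereal (real d)) s)"
  proof (rule has_hdimI[OF prob_\<pi>])
    show "ball x r \<inter> space ?\<pi> \<in> sets ?\<pi>" for x r by simp
    fix t0 :: real
    have ball_\<pi>: "measure ?\<pi> (ball x ((1 / 2) ^ k) \<inter> space ?\<pi>) = ball_measure ?\<pi> x k" for x k
      by (simp add: ball_measure_def)
    show "AE x in ?\<pi>. eventually (\<lambda>k. measure ?\<pi> (ball x ((1 / 2) ^ k) \<inter> space ?\<pi>) \<le> 2 powr (- t0 * k)) sequentially"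
      if less: "ereal t0 < min (ereal (real d)) s"
    proof (cases "t0 < 0")
      case True
      have "measure ?\<pi> X \<le> 2 powr (- t0 * real k)" for X and k :: nat
      proof -
        have "1 \<le> 2 powr (- t0 * real k)" using True by (intro ge_one_powr_ge_zero) (auto simp: mult_nonpos_nonneg)
        then show ?thesis using prob_space.prob_le_1[OF prob_\<pi>, of X] by linarith
      qed
      then show ?thesis by (intro AE_I2 always_eventually allI)
    next
      case False
      \<comment> \<open>The chain \<open>t0 < t < u < s\<close> leaves room on both sides:
        \<open>6 * \<epsilon>\<close> below \<open>t\<close> for the loss in
        \<open>projection_ball_bound\<close>, and \<epsilon> above it for the decay required
        there.\<close>
      obtain u :: real where u: "ereal t0 < ereal u" "ereal u < min (ereal (real d)) s"
        using ereal_dense2[OF less] by blast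
      then obtain tq :: rat where tq: "t0 < real_of_rat tq" "real_of_rat tq < u" using of_rat_dense[of t0 u] by auto
      define t where "t = real_of_rat tq"
      have ud: "u < real d" using u(2) by simp
      have t: "t0 < t" "t < u" "0 \<le> t" "t \<le> d"
        using tq ud False unfolding t_def by linarith+
      obtain q :: nat where q: "1 / (real q + 1) < min ((t - t0) / 6) (u - t)"
        using reals_Archimedean[of "min ((t - t0) / 6) (u - t)"] t by (auto simp: inverse_eq_divide add.commute)
      define \<epsilon> where "\<epsilon> = 1 / (real q + 1)"
      have \<epsilon>: "0 < \<epsilon>" "6 * \<epsilon> < t - t0" "\<epsilon> < u - t" using q by (auto simp: \<epsilon>_def)
      have "AE x in ?M. eventually (\<lambda>k. ball_measure ?\<pi> (orth_proj V x) k \<le> 2 powr (- (t - 6 * \<epsilon>) * k)) sequentially"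
      proof (rule projection_ball_bound[OF sV finM universal_finite _ _ \<epsilon>(1)])
        show "AE x in ?M. eventually (\<lambda>k. ball_measure ?M x k \<le> 2 powr (\<epsilon> * k) * ball_measure universal x (k + 3) \<and>
          ball_measure universal x k \<le> 2 powr (\<epsilon> * k) * ball_measure ?M x (k + 3)) sequentially"
          using ball_comparison[OF m \<epsilon>(1)] by eventually_elim (erule eventually_mono, blast)
        have "ereal (t + \<epsilon>) < ereal u" using \<epsilon>(3) by simp
        also have "\<dots> < s" using u(2) by simp
        finally show "AE x in ?M. eventually (\<lambda>k. ball_measure ?M x k \<le> 2 powr (- (t + \<epsilon>) * k)) sequentially" by (rule s(2))
        show "eventually (\<lambda>k. near_pairs universal t j V k \<le> ennreal (2 powr (- (t - \<epsilon>) * k))) sequentially" for j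
          unfolding t_def \<epsilon>_def by (rule near) (use t in \<open>auto simp: t_def\<close>)
      qed simp_all
      then have "AE x in ?M. eventually (\<lambda>k. ball_measure ?\<pi> (orth_proj V x) k \<le> 2 powr (- t0 * k)) sequentially"
      proof eventually_elim
        case (elim x)
        then show ?case
        proof eventually_elim
          case (elim k)
          have "- (t - 6 * \<epsilon>) * k \<le> - t0 * k" using \<epsilon>(2) by (intro mult_right_mono) auto
          then have "2 powr (- (t - 6 * \<epsilon>) * k) \<le> 2 powr (- t0 * k)" by simp
          then show ?case using elim by linarith
        qed
      qed
      then show ?thesis
        unfolding ball_\<pi> by (subst AE_distr_eventually[OF Pm sets_ball_measure(1)[OF fin_\<pi>]]) simp_all
    qed
    show "AE x in ?\<pi>. frequently (\<lambda>k. 2 powr (- t0 * k) \<le> measure ?\<pi> (ball x ((1 / 2) ^ k) \<inter> space ?\<pi>)) sequentially"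
      if less: "min (ereal (real d)) s < ereal t0"
    proof (cases "real d < t0")
      case True
      have "AE y in ?\<pi>. eventually (\<lambda>k. 2 powr (- (d + (t0 - d)) * k) \<le> ball_measure ?\<pi> y k) sequentially"
        by (rule projection_dimension_le[OF V finM]) (use True in simp_all)
      then show ?thesis
        unfolding ball_\<pi> by eventually_elim (intro eventually_frequently, simp_all)
    next
      case False
      then have st: "s < ereal t0" using less by (auto simp: min_def split: if_splits)
      have "AE x in ?M. frequently (\<lambda>k. 2 powr (- t0 * k) < ball_measure ?\<pi> (orth_proj V x) k) sequentially"
        using s(3)[OF st]
      proof eventually_elim
        case (elim x)
        then show ?case
        proof (rule frequently_elim1)
          fix k assume k: "2 powr (- t0 * real k) < ball_measure ?M x k"
          have "ball_measure ?M x k \<le> measure ?M (orth_proj V -` ball (orth_proj V x) ((1 / 2) ^ k) \<inter> space ?M)"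
            unfolding ball_measure_def
          proof (rule M.finite_measure_mono)
            show "ball x ((1 / 2) ^ k) \<subseteq> orth_proj V -` ball (orth_proj V x) ((1 / 2) ^ k) \<inter> space ?M"
              using le_less_trans[OF dist_orth_proj_le[OF sV, of x]] by auto
            show "orth_proj V -` ball (orth_proj V x) ((1 / 2) ^ k) \<inter> space ?M \<in> sets ?M"
              by (rule measurable_sets[OF Pm]) simp
          qed
          also have "\<dots> = ball_measure ?\<pi> (orth_proj V x) k"
            unfolding ball_measure_def by (rule measure_distr[OF Pm, symmetric]) simp
          finally show "2 powr (- t0 * real k) < ball_measure ?\<pi> (orth_proj V x) k" using k by linarith
        qed
      qed
      then have "AE y in ?\<pi>. frequently (\<lambda>k. 2 powr (- t0 * k) < ball_measure ?\<pi> y k) sequentially"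
        by (subst AE_distr_frequently[OF Pm sets_ball_measure(2)[OF fin_\<pi>]]) simp_all
      then show ?thesis
        unfolding ball_\<pi> by eventually_elim (erule frequently_elim1, simp)
    qed
  qed
  ultimately show ?thesis unfolding \<pi>_eq by blast
qed

text \<open>The exceptional set is a countable union, over \<open>t\<close>, \<open>q\<close> and
  \<open>j\<close>, of null sets that depend on the universal measure only; ergodic measures enter
  after \<open>V\<close> has been fixed.\<close>

lemma simultaneous_projection:
  fixes \<gamma> :: "(real^'n) set measure"
  assumes \<gamma>: "invariant_Grassmannian_measure d \<gamma>" and d: "d \<le> CARD('n)"
  shows "AE V in \<gamma>. \<forall>\<mu>\<in>ergodic_measures V0 A f.
    \<exists>s. has_hdim \<mu> s \<and> has_hdim (distr \<mu> borel (orth_proj V)) (min (ereal (real d)) s)"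
proof -
  have sets: "sets \<gamma> = sets (Grassmannian_borel d)"
    using \<gamma> unfolding invariant_Grassmannian_measure_def by auto
  have sp: "space \<gamma> = Grassmannian d"
    using sets_eq_imp_space_eq[OF sets] by (simp add: space_Grassmannian_borel)
  have "AE V in \<gamma>. 0 \<le> real_of_rat t \<longrightarrow> real_of_rat t \<le> d \<longrightarrow>
      eventually (\<lambda>k. near_pairs universal (real_of_rat t) j V k \<le> ennreal (2 powr (- (real_of_rat t - 1 / (real q + 1)) * k))) sequentially"
    for t :: rat and q j :: nat
  proof (cases "0 \<le> real_of_rat t \<and> real_of_rat t \<le> d")
    case True
    have "AE V in \<gamma>. eventually (\<lambda>k. near_pairs universal (real_of_rat t) j V k \<le> ennreal (2 powr (- (real_of_rat t - 1 / (real q + 1)) * k))) sequentially"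
      by (rule AE_near_pairs_le[OF \<gamma> d universal_finite]) (use True in auto)
    then show ?thesis by eventually_elim blast
  qed auto
  then have "AE V in \<gamma>. \<forall>(t :: rat) (q :: nat) (j :: nat). 0 \<le> real_of_rat t \<longrightarrow> real_of_rat t \<le> d \<longrightarrow>
      eventually (\<lambda>k. near_pairs universal (real_of_rat t) j V k \<le> ennreal (2 powr (- (real_of_rat t - 1 / (real q + 1)) * k))) sequentially"
    unfolding AE_all_countable by blast
  then show ?thesis
    using AE_space
  proof eventually_elim
    case (elim V)
    show ?case
    proof
      fix \<mu> assume "\<mu> \<in> ergodic_measures V0 A f"
      then obtain m where m: "ergodic_shift_measure A m" and \<mu>: "\<mu> = on_attractor m"
        unfolding ergodic_measures_def by blast
      show "\<exists>s. has_hdim \<mu> s \<and> has_hdim (distr \<mu> borel (orth_proj V)) (min (ereal (real d)) s)"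
        unfolding \<mu> by (rule projection_has_hdim[OF _ m]) (use elim sp in auto)
    qed
  qed
qed

end

text \<open>An empty alphabet satisfies the definition of \<open>conformal_IFS\<close> for suitable
  \<open>V0\<close> but is excluded by the locale. Its code space is empty and carries no
  probability measure.\<close>

lemma ergodic_measures_empty_alphabet: "ergodic_measures V0 {} f = {}"
proof -
  have "\<not> ergodic_shift_measure {} \<mu>" for \<mu> :: "(nat \<Rightarrow> 'i) measure"
  proof
    assume \<mu>: "ergodic_shift_measure {} \<mu>"
    then have "space \<mu> = {}"
      using sets_eq_imp_space_eq[of \<mu> "code_space {}"] by (auto simp: ergodic_shift_measure_def space_code_space)
    then show False using \<mu> prob_space.not_empty unfolding ergodic_shift_measure_def by blast
  qed
  then show ?thesis unfolding ergodic_measures_def by blast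
qed

theorem theorem3p5:
  fixes \<theta> :: real
    and V0 :: "(real^'n) set"
    and A :: "'i set"
    and f :: "'i \<Rightarrow> real^'n \<Rightarrow> real^'n"
  assumes "conformal_IFS \<theta> V0 A f"
    and "strong_separation V0 A f"
  shows "relative_dimension_separable (attractor V0 A f) (ergodic_measures V0 A f) \<and>
    (\<forall>d \<gamma>. 1 \<le> d \<and> d < CARD('n) \<and> invariant_Grassmannian_measure d (\<gamma> :: (real^'n) set measure) \<longrightarrow>
      (AE V in \<gamma>. \<forall>\<mu>\<in>ergodic_measures V0 A f.
         \<exists>s. has_hdim \<mu> s \<and> has_hdim (distr \<mu> borel (orth_proj V)) (min (ereal (real d)) s)))"
proof (cases "A = {}")
  case True
  have "relative_dimension_separable X ({} :: (real^'n) measure set)" for X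
    unfolding relative_dimension_separable_def by (intro conjI exI[of _ "{}"]) auto
  then show ?thesis unfolding True ergodic_measures_empty_alphabet by auto
next
  case False
  then obtain scale a b \<kappa> where "separated_IFS V0 A f scale a b \<kappa>"
    using conformal_IFS_imp_separated[OF assms] by blast
  then interpret separated_IFS V0 A f scale a b \<kappa> .
  show ?thesis using relative_dimension_separable simultaneous_projection by auto
qed

end
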